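(* Let $X$ be the moving maxima marked point process built from a Poisson process $P$ with regularly varying marks distributed as $\zeta$ with tail index $\alpha>0$, a neighbourhood map $\Phi$ and a weight function $w$ (see context), and let $\xi$ be the score at the origin of its Palm version. Assume that $w$ is bounded and that $\mathbf E[\widetilde N(0)]<\infty$. Then the following statements hold. (i) The score $\xi$ satisfies $$\lim_{u\to\infty}\frac{\mathbf P(\xi>u)}{\mathbf P(\zeta>u)}=\mathbf E\Big[\sum_{t\in\widetilde\Phi(0)}w(t)^\alpha\Big]=:\kappa\in(0,\infty).$$ In particular, $\xi$ is regularly varying with tail index $\alpha$. (ii) The tail configuration of $X$ exists for the constant scaling function $r\equiv1$, and the distribution of its spectral part $\Theta\in\mathcal N$ is given by $$\mathbf E[h(\Theta)]=\kappa^{-1}\,\mathbf E\Big[\sum_{x\in\widetilde\Phi(0)}h\Big(\Big\{\Big(t,\frac{w(x-t)}{w(x)}\Big):t\in\widetilde P',\ x\in\widetilde\Phi(t)\Big\}\Big)\,w(x)^\alpha\Big]$$ for all measurable $h:\mathcal N\to[0,\infty)$, where the summand corresponding to $x$ is understood to be $0$ if $w(x)=0$, and $h$ of a point set in $\mathbb R^d\times[0,\infty)$ means $h$ of its restriction to $\mathbb R^d\times(0,\infty)$ (points of the form $(t,0)$ are neglected).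
   Context: Spaces. $\mathbb E=\mathbb R^d\times(0,\infty)$; for $(t,s)\in\mathbb E$, $t$ is the position and $s$ the score. A counting measure is a Borel measure on $\mathbb E$ with values in $\{0,1,2,\dots\}\cup\{\infty\}$; it is simple if $\mu(\{t\}\times(0,\infty))\le1$ for all $t\in\mathbb R^d$. Such measures are identified with their sets of atoms, and $\mu(t):=s$ if $(t,s)\in\mu$. $\mathcal B_{11}$ is the family of Borel subsets of $\mathbb E$ contained in $B\times(\varepsilon,\infty)$ for some bounded $B\subset\mathbb R^d$ and $\varepsilon>0$; $\mathcal N$ is the set of simple counting measures finite on $\mathcal B_{11}$; $\mathcal N_{10}\subset\mathcal N$ is the set of simple counting measures finite on $B\times(0,\infty)$ for all bounded Borel $B$. The $\mathcal B_{11}$-vague topology on $\mathcal N$ is the smallest one making $\mu\mapsto\int f\,d\mu$ continuous for all bounded continuous $f:\mathbb E\to\mathbb R$ with support in a set of $\mathcal B_{11}$; the $\sigma$-algebra is generated by the maps $\mu\mapsto\mu(B)$, $B$ Borel. Scalings: $T_{v,u}\mu=\sum_{(t,s)\in\mu}\delta_{(t/v,s/u)}$, $u,v>0$. Moving maxima model. $\zeta$ is a positive random variable with distribution $m$ and regularly varying tail of index $\alpha>0$: $\mathbf P(\zeta>uy)/\mathbf P(\zeta>u)\to y^{-\alpha}$ as $u\to\infty$ for $y>0$. $P=\sum\delta_{(t,\zeta_t)}$ is a Poisson process on $\mathbb E$ with intensity measure $\mathrm{Leb}\times m$ (a unit rate stationary Poisson process on $\mathbb R^d$ with i.i.d. marks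 $\zeta_t$ of law $m$). $\mathcal N_g$ is the space of simple locally finite point measures on $\mathbb R^d$ (identified with locally finite sets) with the usual $\sigma$-algebra. $\mu'$ denotes the projection of $\mu\in\mathcal N_{10}$ on $\mathbb R^d$. $\Phi:\mathbb R^d\times\mathcal N_g\to\mathcal N_g$ is measurable, such that for each $\mu'\in\mathcal N_g$ and $t\in\mu'$, $\Phi(t,\mu')$ is a finite subset of $\mu'$ containing $t$, and $\Phi(t-x,\mu'-x)=\Phi(t,\mu')-x$ for all $\mu'\in\mathcal N_g$, $t\in\mu'$, $x\in\mathbb R^d$. $w:\mathbb R^d\to[0,\infty)$ is a deterministic measurable weight function with $w(0)=1$. The scoring function is $\psi(t,\mu)=\max_{x\in\Phi(t,\mu')}w(x-t)\mu(x)$, $t\in\mu'$, and $X=\{(t,\psi(t,P)):t\in P'\}$, a stationary marked point process of unit intensity. Its Palm version is $\widetilde X=\{(t,\psi(t,\widetilde P)):t\in\widetilde P'\}$, where $\widetilde P=P+\delta_{(0,\zeta_0)}$ with $\zeta_0$ of law $m$ independent of $P$; $\xi:=\widetilde X(0)$. Write $\widetilde\Phi(t)=\Phi(t,\widetilde P')$, and $\widetilde N(t)$ for the cardinality of $\widetilde\Phi(t)$, $t\in\widetilde P'$. Tail configuration. A random element $Y$ of $\mathcal N$ with $Y(\{0\}\times(1,\infty))=1$ a.s. is the tail configuration of $X$ with respect to $r\equiv1$ if $\mathbf P(T_{1,u}\widetilde X\in\cdot\mid\xi>u)$ converges weakly to $\mathbf P(Y\in\cdot)$ as $u\to\infty$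 with respect to the $\mathcal B_{11}$-vague topology. With $\eta:=Y(0)$, its spectral part (spectral tail configuration) is $\Theta:=T_{1,\eta}Y$. *)

theory Defs
  imports "HOL-Probability.Probability"
begin

text \<open>
  The space \<open>\<real>\<^sup>d\<close> is a type of class \<open>euclidean_space\<close>. Simple counting measures are identified
  with their sets of atoms, so configurations of scored points have type
  \<open>('a \<times> real) set\<close> and configurations of positions have type \<open>'a set\<close>.
\<close>

definition score_space :: "('a::euclidean_space \<times> real) set" where
  "score_space = UNIV \<times> {0<..}"

text \<open>The value \<open>\<mu>(B)\<close> of the counting measure with set of atoms \<open>\<mu>\<close>.\<close>

definition count_on :: "'c set \<Rightarrow> 'c set \<Rightarrow> ennreal" where
  "count_on \<mu> B = emeasure (count_space UNIV) (\<mu> \<inter> B)"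

text \<open>
  The family of configurations \<open>C\<close> with the \<open>\<sigma>\<close>-algebra generated by the maps \<open>\<mu> \<mapsto> \<mu>(B)\<close>.
\<close>

definition config_algebra :: "'c::topological_space set set \<Rightarrow> 'c set measure" where
  "config_algebra C =
     sigma C {{\<mu> \<in> C. count_on \<mu> B \<in> V} | B V. B \<in> sets borel \<and> V \<in> sets borel}"

definition bounded_family :: "('a::euclidean_space \<times> real) set set" where
  "bounded_family =
     {A \<in> sets borel. \<exists>B \<epsilon>. bounded B \<and> 0 < \<epsilon> \<and> A \<subseteq> B \<times> {\<epsilon><..}}"

definition simple_config :: "('a::euclidean_space \<times> real) set \<Rightarrow> bool" where
  "simple_config \<mu> \<longleftrightarrow> \<mu> \<subseteq> score_space \<and> (\<forall>t. count_on \<mu> ({t} \<times> {0<..}) \<le> 1)"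

definition configs :: "('a::euclidean_space \<times> real) set set" where
  "configs = {\<mu>. simple_config \<mu> \<and> (\<forall>A\<in>bounded_family. count_on \<mu> A < \<infinity>)}"

definition configs10 :: "('a::euclidean_space \<times> real) set set" where
  "configs10 = {\<mu> \<in> configs. \<forall>B\<in>sets borel. bounded B \<longrightarrow> count_on \<mu> (B \<times> {0<..}) < \<infinity>}"

definition ground_configs :: "'a::euclidean_space set set" where
  "ground_configs = {\<mu>. \<forall>B\<in>sets borel. bounded B \<longrightarrow> count_on \<mu> B < \<infinity>}"

text \<open>
  Integration against the counting measure \<open>\<mu>\<close> is integration against \<open>count_space \<mu>\<close>.
  Requiring only the set where \<open>f\<close> is nonzero, rather than its closure, to lie in a set of the
  family makes no difference, as \<open>B\<close> and \<open>\<epsilon>\<close> may be replaced by \<open>closure B\<close> and \<open>\<epsilon>/2\<close>.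
\<close>

definition vague_test :: "(('a::euclidean_space \<times> real) \<Rightarrow> real) \<Rightarrow> bool" where
  "vague_test f \<longleftrightarrow>
     continuous_on score_space f \<and> bounded (f ` score_space) \<and>
     (\<exists>A\<in>bounded_family. {p \<in> score_space. f p \<noteq> 0} \<subseteq> A)"

definition vague_topology :: "('a::euclidean_space \<times> real) set topology" where
  "vague_topology =
     topology_generated_by
       {{\<mu> \<in> configs. (\<integral>p. f p \<partial>count_space \<mu>) \<in> U} | f U. vague_test f \<and> open U}"

definition vague_weak_conv ::
  "('i \<Rightarrow> ('a::euclidean_space \<times> real) set measure) \<Rightarrow> ('a \<times> real) set measure \<Rightarrow>
     'i filter \<Rightarrow> bool" where
  "vague_weak_conv Q Q0 F \<longleftrightarrow>
     (\<forall>f. continuous_map vague_topology euclideanreal f \<and> bounded (f ` configs) \<longrightarrow>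
        ((\<lambda>i. \<integral>\<mu>. f \<mu> \<partial>Q i) \<longlongrightarrow> (\<integral>\<mu>. f \<mu> \<partial>Q0)) F)"

definition scaling ::
  "real \<Rightarrow> real \<Rightarrow> ('a::euclidean_space \<times> real) set \<Rightarrow> ('a \<times> real) set" where
  "scaling v u \<mu> = (\<lambda>(t, s). (t /\<^sub>R v, s / u)) ` \<mu>"

definition score_at :: "('a \<times> real) set \<Rightarrow> 'a \<Rightarrow> real" where
  "score_at \<mu> t = (THE s. (t, s) \<in> \<mu>)"

definition regularly_varying_tail :: "'o measure \<Rightarrow> ('o \<Rightarrow> real) \<Rightarrow> real \<Rightarrow> bool" where
  "regularly_varying_tail M \<zeta> \<alpha> \<longleftrightarrow>
     (\<forall>y>0. ((\<lambda>u. \<P>(\<omega> in M. \<zeta> \<omega> > u * y) / \<P>(\<omega> in M. \<zeta> \<omega> > u)) \<longlongrightarrow> y powr (- \<alpha>)) at_top)"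

definition poisson_process :: "'o measure \<Rightarrow> ('o \<Rightarrow> 'c set) \<Rightarrow> 'c measure \<Rightarrow> bool" where
  "poisson_process M P \<Lambda> \<longleftrightarrow>
     (\<forall>A\<in>sets \<Lambda>. emeasure \<Lambda> A < \<infinity> \<longrightarrow>
        (\<forall>k::nat. \<P>(\<omega> in M. count_on (P \<omega>) A = of_nat k) =
           exp (- measure \<Lambda> A) * measure \<Lambda> A ^ k / fact k)) \<and>
     (\<forall>A\<in>sets \<Lambda>. emeasure \<Lambda> A = \<infinity> \<longrightarrow> (AE \<omega> in M. count_on (P \<omega>) A = \<infinity>)) \<and>
     (\<forall>(n::nat) A. (\<forall>i<n. A i \<in> sets \<Lambda>) \<and> disjoint_family_on A {..<n} \<longrightarrow>
        prob_space.indep_vars M (\<lambda>_. borel) (\<lambda>i \<omega>. count_on (P \<omega>) (A i)) {..<n})"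

definition neighbourhood_map :: "('a::euclidean_space \<Rightarrow> 'a set \<Rightarrow> 'a set) \<Rightarrow> bool" where
  "neighbourhood_map \<Phi> \<longleftrightarrow>
     case_prod \<Phi> \<in> borel \<Otimes>\<^sub>M config_algebra ground_configs \<rightarrow>\<^sub>M config_algebra ground_configs \<and>
     (\<forall>\<mu>\<in>ground_configs. \<forall>t\<in>\<mu>. finite (\<Phi> t \<mu>) \<and> \<Phi> t \<mu> \<subseteq> \<mu> \<and> t \<in> \<Phi> t \<mu>) \<and>
     (\<forall>\<mu>\<in>ground_configs. \<forall>t\<in>\<mu>. \<forall>x.
        \<Phi> (t - x) ((\<lambda>y. y - x) ` \<mu>) = (\<lambda>y. y - x) ` \<Phi> t \<mu>)"

definition scoring ::
  "('a::euclidean_space \<Rightarrow> 'a set \<Rightarrow> 'a set) \<Rightarrow> ('a \<Rightarrow> real) \<Rightarrow> 'a \<Rightarrow> ('a \<times> real) set \<Rightarrow> real" where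
  "scoring \<Phi> w t \<mu> = Max ((\<lambda>x. w (x - t) * score_at \<mu> x) ` \<Phi> t (fst ` \<mu>))"

definition moving_maxima ::
  "('a::euclidean_space \<Rightarrow> 'a set \<Rightarrow> 'a set) \<Rightarrow> ('a \<Rightarrow> real) \<Rightarrow> ('a \<times> real) set \<Rightarrow>
     ('a \<times> real) set" where
  "moving_maxima \<Phi> w \<mu> = {(t, scoring \<Phi> w t \<mu>) | t. t \<in> fst ` \<mu>}"

text \<open>
  The configuration \<open>\<mu>\<close> with a point of score \<open>z\<close> added at \<open>0\<close>. A Poisson process has almost surely no point located at \<open>0\<close>; discarding such a
  point changes the process only on a null set and makes its values simple everywhere.
\<close>

definition add_origin ::
  "('a::euclidean_space \<times> real) set \<Rightarrow> real \<Rightarrow> ('a \<times> real) set" where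
  "add_origin \<mu> z = insert (0, z) {p \<in> \<mu>. fst p \<noteq> 0}"

text \<open>
  \<open>Y\<close>, defined on the probability space \<open>N\<close>, is the tail configuration with respect to the
  constant scaling function 1 of the stationary marked point process whose Palm version is \<open>X\<close>,
  defined on \<open>M\<close>.
\<close>

definition tail_configuration ::
  "'o measure \<Rightarrow> ('o \<Rightarrow> ('a::euclidean_space \<times> real) set) \<Rightarrow>
     'p measure \<Rightarrow> ('p \<Rightarrow> ('a \<times> real) set) \<Rightarrow> bool" where
  "tail_configuration M X N Y \<longleftrightarrow>
     prob_space N \<and> Y \<in> N \<rightarrow>\<^sub>M config_algebra configs \<and>
     (AE \<omega> in N. count_on (Y \<omega>) ({0} \<times> {1<..}) = 1) \<and>
     vague_weak_conv
       (\<lambda>u. distr (uniform_measure M {\<omega> \<in> space M. score_at (X \<omega>) 0 > u})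
              (config_algebra configs) (\<lambda>\<omega>. scaling 1 u (X \<omega>)))
       (distr N (config_algebra configs) Y) at_top"

definition spectral_part :: "('a::euclidean_space \<times> real) set \<Rightarrow> ('a \<times> real) set" where
  "spectral_part \<mu> = scaling 1 (score_at \<mu> 0) \<mu>"

text \<open>Intersecting with \<open>score_space\<close> discards the points of score 0.\<close>

definition spectral_config ::
  "('a::euclidean_space \<Rightarrow> 'a set \<Rightarrow> 'a set) \<Rightarrow> ('a \<Rightarrow> real) \<Rightarrow> 'a set \<Rightarrow> 'a \<Rightarrow>
     ('a \<times> real) set" where
  "spectral_config \<Phi> w \<mu> x =
     {(t, w (x - t) / w x) | t. t \<in> \<mu> \<and> x \<in> \<Phi> t \<mu>} \<inter> score_space"

end

theory Submission
  imports Defs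
begin

text \<open>
  A high score at the origin of the Palm version is caused by a single large mark. Splitting the
  event \<open>\<xi> > u\<close> evenly among the points \<open>x\<close> of the neighbourhood of the origin with
  \<open>w x * \<zeta>\<^sub>x > u\<close> turns the expectation of a function of the process on this event into a sum over
  the points of the Poisson process. The Mecke equation makes this an integral over the position
  \<open>x\<close> and the mark \<open>s\<close> of one added point, the remaining process being independent of \<open>(x, s)\<close> and
  of \<open>u\<close>. With \<open>s\<close> of order \<open>u\<close> and everything else fixed, the added point is eventually the only
  exceedance and the scaled process converges vaguely to the cluster generated by \<open>x\<close>. Regular
  variation gives the limit law of \<open>s / u\<close>, and the integrals converge by domination with the
  indicator that \<open>x\<close> lies in the neighbourhood of the origin, which is integrable because the
  expected size of this neighbourhood is finite. Constant functions give (i); bounded vaguely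
  continuous functions give the tail configuration, whose law is unique since such functions
  determine a law on configurations.
\<close>

section \<open>Configurations and void events\<close>

text \<open>Neighbourhoods depend on positions only. After a point has been inserted at
  \<open>x\<close>, positions and neighbourhoods stay fixed while its mark grows, and finitely many
  fixed marks compete with it at each position; this makes the limit elementary for a frozen
  environment. The Palm version already contains the origin, so its Mecke equation is an integral
  against Lebesgue measure plus a unit mass at 0, the latter standing for a large mark of the origin
  itself. The uniform bound comes from \<open>w \<le> W\<close>: an exceedance needs a mark above
  \<open>u / W\<close>, and the tail ratio between \<open>u / W\<close> and \<open>u\<close>
  converges. The same Mecke equation, with the constant 1, identifies the integral of the remaining
  indicator with the expected neighbourhood size. The factor \<open>w x powr \<alpha>\<close> is the
  limiting tail ratio between \<open>u / w x\<close> and \<open>u\<close>; the score left at the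
  origin is Pareto and multiplies the whole cluster, so dividing by it leaves ratios of weights.
  Configurations are sets without a metric, hence two technical reductions: measurability is tested
  on void events, and vague continuity is used along sequences.\<close>

lemma space_config_algebra [simp]: "space (config_algebra C) = C"
  unfolding config_algebra_def by (rule space_measure_of) auto

lemma sets_config_algebra:
  "sets (config_algebra C) =
    sigma_sets C {{\<mu> \<in> C. count_on \<mu> B \<in> V} | B V. B \<in> sets borel \<and> V \<in> sets borel}"
  unfolding config_algebra_def by (rule sets_measure_of) auto

lemma count_on_eq_0_iff: "count_on \<mu> B = 0 \<longleftrightarrow> \<mu> \<inter> B = {}"
  unfolding count_on_def by (subst emeasure_count_space_eq_0) auto

lemma count_on_finite: "finite (\<mu> \<inter> B) \<Longrightarrow> count_on \<mu> B = of_nat (card (\<mu> \<inter> B))"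
  unfolding count_on_def by (rule emeasure_count_space_finite) auto

lemma count_on_infinite: "infinite (\<mu> \<inter> B) \<Longrightarrow> count_on \<mu> B = \<infinity>"
  unfolding count_on_def by (simp add: emeasure_count_space)

lemma count_on_less_top_iff: "count_on \<mu> B < top \<longleftrightarrow> finite (\<mu> \<inter> B)"
  by (cases "finite (\<mu> \<inter> B)") (simp_all add: count_on_finite count_on_infinite of_nat_less_top)

lemma measurable_count_on [measurable]:
  assumes "B \<in> sets borel"
  shows "(\<lambda>\<mu>. count_on \<mu> B) \<in> borel_measurable (config_algebra C)"
proof (rule measurableI)
  fix V :: "ennreal set" assume "V \<in> sets borel"
  then have "{\<mu> \<in> C. count_on \<mu> B \<in> V} \<in> sets (config_algebra C)"
    unfolding sets_config_algebra using assms by (blast intro: sigma_sets.Basic)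
  then show "(\<lambda>\<mu>. count_on \<mu> B) -` V \<inter> space (config_algebra C) \<in> sets (config_algebra C)"
    by (simp add: vimage_def Int_def conj_commute)
qed simp

lemma sets_void:
  assumes "B \<in> sets borel"
  shows "{\<mu> \<in> C. \<mu> \<inter> B = {}} \<in> sets (config_algebra C)"
proof -
  have "{\<mu> \<in> space (config_algebra C). count_on \<mu> B = 0} \<in> sets (config_algebra C)"
    using assms by measurable
  then show ?thesis by (simp add: count_on_eq_0_iff)
qed

lemma of_nat_le_count_on_iff:
  "of_nat k \<le> count_on \<mu> B \<longleftrightarrow> (\<exists>F. finite F \<and> F \<subseteq> \<mu> \<inter> B \<and> card F = k)"
proof (cases "finite (\<mu> \<inter> B)")
  case True
  show ?thesis
  proof
    assume "of_nat k \<le> count_on \<mu> B"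
    then have "k \<le> card (\<mu> \<inter> B)" using True by (simp add: count_on_finite)
    then show "\<exists>F. finite F \<and> F \<subseteq> \<mu> \<inter> B \<and> card F = k"
      using True by (meson obtain_subset_with_card_n finite_subset)
  next
    assume "\<exists>F. finite F \<and> F \<subseteq> \<mu> \<inter> B \<and> card F = k"
    then have "k \<le> card (\<mu> \<inter> B)" using True card_mono by blast
    then show "of_nat k \<le> count_on \<mu> B" using True by (simp add: count_on_finite)
  qed
next
  case False
  then show ?thesis
    using infinite_arbitrarily_large[OF False, of k] by (auto simp: count_on_infinite)
qed

text \<open>
  At least \<open>k\<close> points of a set are separated by \<open>k\<close> disjoint sets of a countable base; hence void
  events determine all counts.
\<close>

lemma of_nat_le_count_on_iff_base:
  fixes \<mu> :: "'c::{second_countable_topology, metric_space} set"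
  assumes base: "topological_basis \<U>"
  shows "of_nat k \<le> count_on \<mu> B \<longleftrightarrow>
    (\<exists>S\<in>{S. finite S \<and> S \<subseteq> \<U> \<and> card S = k \<and> disjoint S}. \<forall>U\<in>S. \<mu> \<inter> (B \<inter> U) \<noteq> {})"
proof
  assume "of_nat k \<le> count_on \<mu> B"
  then obtain F where F: "finite F" "F \<subseteq> \<mu> \<inter> B" "card F = k"
    by (auto simp: of_nat_le_count_on_iff)
  \<comment> \<open>Each point gets half of its own distance bound to the rest of \<open>F\<close>
    as radius. Both full radii are at most the distance of the two centres, so the triangle
    inequality keeps the base sets apart.\<close>
  have "\<forall>a. \<exists>d>0. \<forall>x\<in>F. x \<noteq> a \<longrightarrow> d \<le> dist a x"
    using finite_set_avoid[OF F(1)] by auto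
  then obtain d where d: "\<And>a. d a > 0" "\<And>a x. x \<in> F \<Longrightarrow> x \<noteq> a \<Longrightarrow> d a \<le> dist a x"
    by metis
  have "\<exists>U\<in>\<U>. a \<in> U \<and> U \<subseteq> ball a (d a / 2)" for a
    using topological_basisE[OF base, of "ball a (d a / 2)" a] d(1)[of a]
    by (metis open_ball centre_in_ball half_gt_zero)
  then obtain U where U: "\<And>a. U a \<in> \<U>" "\<And>a. a \<in> U a" "\<And>a. U a \<subseteq> ball a (d a / 2)"
    by metis
  have disj: "U a \<inter> U b = {}" if "a \<in> F" "b \<in> F" "a \<noteq> b" for a b
  proof (rule ccontr)
    assume "U a \<inter> U b \<noteq> {}"
    then obtain x where "x \<in> U a" "x \<in> U b" by auto
    then have "dist a x < d a / 2" "dist b x < d b / 2"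
      using U(3)[of a] U(3)[of b] by (auto simp: subset_iff)
    moreover have "d a \<le> dist a b" "d b \<le> dist a b"
      using d(2)[of b a] d(2)[of a b] that by (auto simp: dist_commute)
    ultimately show False
      using dist_triangle2[of a b x] by linarith
  qed
  have inj: "inj_on U F"
    by (metis disj U(2) inj_onI disjoint_iff)
  have "disjoint (U ` F)"
    by (auto simp: pairwise_def disjnt_def dest: disj)
  moreover have "\<forall>V\<in>U ` F. \<mu> \<inter> (B \<inter> V) \<noteq> {}"
    using F(2) U(2) by auto
  moreover have "card (U ` F) = k" using F inj by (simp add: card_image)
  ultimately show "\<exists>S\<in>{S. finite S \<and> S \<subseteq> \<U> \<and> card S = k \<and> disjoint S}.
      \<forall>U\<in>S. \<mu> \<inter> (B \<inter> U) \<noteq> {}"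
    using F(1) U(1) by (intro bexI[of _ "U ` F"]) auto
next
  assume "\<exists>S\<in>{S. finite S \<and> S \<subseteq> \<U> \<and> card S = k \<and> disjoint S}. \<forall>U\<in>S. \<mu> \<inter> (B \<inter> U) \<noteq> {}"
  then obtain S where S: "finite S" "card S = k" "disjoint S"
    and ne: "\<And>U. U \<in> S \<Longrightarrow> \<mu> \<inter> (B \<inter> U) \<noteq> {}" by auto
  obtain c where c: "\<And>U. U \<in> S \<Longrightarrow> c U \<in> \<mu> \<inter> (B \<inter> U)"
    using bchoice[of S "\<lambda>U x. x \<in> \<mu> \<inter> (B \<inter> U)"] ne by blast
  have "inj_on c S"
  proof (rule inj_onI)
    fix U V assume UV: "U \<in> S" "V \<in> S" "c U = c V"
    then have "c U \<in> U \<inter> V" using c by fastforce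
    then show "U = V" using S(3) UV by (auto simp: pairwise_def disjnt_def)
  qed
  then show "of_nat k \<le> count_on \<mu> B"
    unfolding of_nat_le_count_on_iff
    using S c by (intro exI[of _ "c ` S"]) (auto simp: card_image)
qed

text \<open>Writes the count through the events that at least \<open>k\<close> points occur, which
  is the form in which void events give measurability.\<close>

lemma count_on_eq_SUP:
  "count_on \<mu> B = (SUP k. of_nat k * indicator {\<mu>. of_nat k \<le> count_on \<mu> B} \<mu>)"
proof (rule antisym)
  show "(SUP k. of_nat k * indicator {\<mu>. of_nat k \<le> count_on \<mu> B} \<mu>) \<le> count_on \<mu> B"
    by (rule SUP_least) (auto split: split_indicator)
  show "count_on \<mu> B \<le> (SUP k. of_nat k * indicator {\<mu>. of_nat k \<le> count_on \<mu> B} \<mu>)"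
  proof (cases "finite (\<mu> \<inter> B)")
    case True
    then show ?thesis
      by (intro SUP_upper2[of "card (\<mu> \<inter> B)"]) (auto simp: count_on_finite)
  next
    case False
    then have "of_nat k * indicator {\<mu>. of_nat k \<le> count_on \<mu> B} \<mu> = (of_nat k :: ennreal)" for k
      by (simp add: count_on_infinite)
    then show ?thesis by (simp only: ennreal_SUP_of_nat_eq_top) simp
  qed
qed

text \<open>By the separation with base sets, having at least \<open>k\<close> points in
  \<open>B\<close> is a countable union, over finite disjoint subfamilies of the base, of finite
  intersections of non-void events. Void events alone therefore control every count; the random
  configurations constructed below are shown measurable in this way.\<close>

lemma measurable_config_algebraI:
  fixes T :: "'o \<Rightarrow> 'c::{second_countable_topology, metric_space} set"
  assumes C: "\<And>\<omega>. \<omega> \<in> space M \<Longrightarrow> T \<omega> \<in> C"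
    and void: "\<And>B. B \<in> sets borel \<Longrightarrow> {\<omega> \<in> space M. T \<omega> \<inter> B = {}} \<in> sets M"
  shows "T \<in> M \<rightarrow>\<^sub>M config_algebra C"
proof -
  obtain \<U> :: "'c set set" where \<U>: "countable \<U>" "topological_basis \<U>"
    using ex_countable_basis by auto
  have U_open: "U \<in> sets borel" if "U \<in> \<U>" for U
    using topological_basis_open[OF \<U>(2) that] by simp
  have count: "(\<lambda>\<omega>. count_on (T \<omega>) B) \<in> borel_measurable M" if B: "B \<in> sets borel" for B
  proof -
    have "{\<omega> \<in> space M. of_nat k \<le> count_on (T \<omega>) B} \<in> sets M" for k
    proof -
      let ?\<S> = "{S. finite S \<and> S \<subseteq> \<U> \<and> card S = k \<and> disjoint S}"
      have cnt: "countable ?\<S>"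
        by (rule countable_subset[OF _ countable_Collect_finite_subset[OF \<U>(1)]]) auto
      have eq: "{\<omega> \<in> space M. of_nat k \<le> count_on (T \<omega>) B} =
          (\<Union>S\<in>?\<S>. space M - (\<Union>U\<in>S. {\<omega> \<in> space M. T \<omega> \<inter> (B \<inter> U) = {}}))"
        unfolding of_nat_le_count_on_iff_base[OF \<U>(2)] by blast
      show ?thesis
        unfolding eq
      proof (rule sets.countable_UN'[OF cnt], safe)
        fix S assume "S \<subseteq> \<U>" "finite S"
        then show "space M - (\<Union>U\<in>S. {\<omega> \<in> space M. T \<omega> \<inter> (B \<inter> U) = {}}) \<in> sets M"
          using B by (intro sets.Diff sets.top sets.finite_UN void sets.Int)
            (auto intro: U_open)
      qed
    qed
    then have [measurable]: "Measurable.pred M (\<lambda>\<omega>. of_nat k \<le> count_on (T \<omega>) B)" for k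
      by (auto simp: pred_def)
    show ?thesis
      by (subst count_on_eq_SUP) (simp add: indicator_def, measurable)
  qed
  show ?thesis
    unfolding config_algebra_def
  proof (rule measurable_measure_of)
    show "T \<in> space M \<rightarrow> C" using C by auto
    fix A assume "A \<in> {{\<mu> \<in> C. count_on \<mu> B \<in> V} | B V. B \<in> sets borel \<and> V \<in> sets borel}"
    then obtain B V where A: "A = {\<mu> \<in> C. count_on \<mu> B \<in> V}" "B \<in> sets borel" "V \<in> sets borel"
      by auto
    have "T -` A \<inter> space M = (\<lambda>\<omega>. count_on (T \<omega>) B) -` V \<inter> space M"
      using C A by auto
    then show "T -` A \<inter> space M \<in> sets M"
      using measurable_sets[OF count A(3)] A(2) by simp
  qed auto
qed

text \<open>Counting measure on an uncountable space is not sigma-finite, so Fubini arguments need a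
  countable Borel cover, common to all configurations in \<open>C\<close>, whose members each
  contain finitely many points of a configuration.\<close>

definition sigma_finite_configs :: "'c::topological_space set set \<Rightarrow> bool" where
  "sigma_finite_configs C \<longleftrightarrow>
     (\<exists>K::nat \<Rightarrow> 'c set. (\<forall>n. K n \<in> sets borel) \<and>
        (\<forall>\<mu>\<in>C. \<mu> \<subseteq> (\<Union>n. K n) \<and> (\<forall>n. finite (\<mu> \<inter> K n))))"

lemma sigma_finite_configsE:
  assumes "sigma_finite_configs C"
  obtains K :: "nat \<Rightarrow> 'c::topological_space set"
  where "\<And>n. K n \<in> sets borel" "disjoint_family K"
    "\<And>\<mu>. \<mu> \<in> C \<Longrightarrow> \<mu> \<subseteq> (\<Union>n. K n)" "\<And>\<mu> n. \<mu> \<in> C \<Longrightarrow> finite (\<mu> \<inter> K n)"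
proof -
  obtain K :: "nat \<Rightarrow> 'c set" where K: "\<And>n. K n \<in> sets borel"
    "\<And>\<mu>. \<mu> \<in> C \<Longrightarrow> \<mu> \<subseteq> (\<Union>n. K n)" "\<And>\<mu> n. \<mu> \<in> C \<Longrightarrow> finite (\<mu> \<inter> K n)"
    using assms unfolding sigma_finite_configs_def by blast
  have "\<mu> \<inter> disjointed K n \<subseteq> \<mu> \<inter> K n" for \<mu> n
    using disjointed_subset[of K n] by auto
  then have fin: "finite (\<mu> \<inter> disjointed K n)" if "\<mu> \<in> C" for \<mu> n
    using K(3)[OF that] by (rule finite_subset)
  show thesis
  proof (rule that[of "disjointed K"])
    show "disjointed K n \<in> sets borel" for n
      using sets.range_disjointed_sets[of K borel] K(1) by auto
  qed (use K(2) fin in \<open>auto simp: disjoint_family_disjointed UN_disjointed_eq\<close>)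
qed

text \<open>A Dynkin argument starting from measurable rectangles. Counting within \<open>K\<close>
  keeps all counts finite, which makes the complement step a legitimate subtraction in
  \<open>ennreal\<close>.\<close>

lemma count_on_section_measurable:
  fixes T :: "'o \<Rightarrow> 'c::topological_space set"
  assumes T [measurable]: "T \<in> N \<rightarrow>\<^sub>M config_algebra C"
    and K [measurable]: "K \<in> sets borel" and fin: "\<And>\<mu>. \<mu> \<in> C \<Longrightarrow> finite (\<mu> \<inter> K)"
    and A: "A \<in> sets (N \<Otimes>\<^sub>M borel)"
  shows "(\<lambda>y. count_on (T y) (K \<inter> Pair y -` A)) \<in> borel_measurable N"
proof -
  let ?G = "{a \<times> b |a b. a \<in> sets N \<and> b \<in> sets (borel :: 'c measure)}"
  have TC: "T y \<in> C" if "y \<in> space N" for y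
    using measurable_space[OF T that] by simp
  have "A \<in> sigma_sets (space N \<times> space borel) ?G"
    using A by (simp add: sets_pair_measure)
  with Int_stable_pair_measure_generator pair_measure_closed show ?thesis
  proof (induct rule: sigma_sets_induct_disjoint)
    fix A assume "A \<in> ?G"
    then obtain a b where A: "A = a \<times> b" and [measurable]: "a \<in> sets N" "b \<in> sets borel" by auto
    have "count_on (T y) (K \<inter> Pair y -` A) = indicator a y * count_on (T y) (K \<inter> b)" for y
      by (auto simp: A count_on_def split: split_indicator)
    then show "(\<lambda>y. count_on (T y) (K \<inter> Pair y -` A)) \<in> borel_measurable N" by simp
  next
    show "(\<lambda>y. count_on (T y) (K \<inter> Pair y -` {})) \<in> borel_measurable N"
      by (simp add: count_on_def)
  next
    fix A assume [measurable]: "(\<lambda>y. count_on (T y) (K \<inter> Pair y -` A)) \<in> borel_measurable N"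
    have "count_on (T y) (K \<inter> Pair y -` (space N \<times> space borel - A)) =
        count_on (T y) K - count_on (T y) (K \<inter> Pair y -` A)" if y: "y \<in> space N" for y
    proof -
      have "T y \<inter> (K \<inter> Pair y -` (space N \<times> space borel - A)) =
          (T y \<inter> K) - (T y \<inter> (K \<inter> Pair y -` A))" using y by auto
      moreover have "finite (T y \<inter> (K \<inter> Pair y -` A))"
        by (rule finite_subset[OF _ fin[OF TC[OF y]]]) auto
      ultimately show ?thesis
        unfolding count_on_def by (simp only:) (rule emeasure_Diff, auto)
    qed
    then show "(\<lambda>y. count_on (T y) (K \<inter> Pair y -` (space N \<times> space borel - A))) \<in> borel_measurable N"
      by (subst measurable_cong) auto
  next
    fix A :: "nat \<Rightarrow> ('o \<times> 'c) set"
    assume d: "disjoint_family A"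
      and [measurable]: "\<And>i. (\<lambda>y. count_on (T y) (K \<inter> Pair y -` A i)) \<in> borel_measurable N"
    have "count_on (T y) (K \<inter> Pair y -` (\<Union>i. A i)) = (\<Sum>i. count_on (T y) (K \<inter> Pair y -` A i))" for y
    proof -
      have "(\<Sum>i. count_on (T y) (K \<inter> Pair y -` A i)) =
          emeasure (count_space UNIV) (\<Union>i. T y \<inter> (K \<inter> Pair y -` A i))"
        unfolding count_on_def
        by (rule suminf_emeasure) (use d in \<open>auto simp: disjoint_family_on_def\<close>)
      also have "(\<Union>i. T y \<inter> (K \<inter> Pair y -` A i)) = T y \<inter> (K \<inter> Pair y -` (\<Union>i. A i))" by auto
      finally show ?thesis by (simp add: count_on_def)
    qed
    then show "(\<lambda>y. count_on (T y) (K \<inter> Pair y -` (\<Union>i. A i))) \<in> borel_measurable N" by simp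
  qed
qed

lemma nn_integral_count_space_indicator_eq:
  "(\<integral>\<^sup>+p. indicator A p \<partial>count_space \<mu>) = count_on \<mu> A"
proof -
  have "(\<integral>\<^sup>+p. indicator A p \<partial>count_space \<mu>) =
      (\<integral>\<^sup>+p. indicator A p * indicator \<mu> p \<partial>count_space UNIV)"
    by (rule nn_integral_count_space_indicator) auto
  also have "(\<lambda>p. indicator A p * indicator \<mu> p) = (indicator (\<mu> \<inter> A) :: _ \<Rightarrow> ennreal)"
    by (auto split: split_indicator)
  finally show ?thesis by (simp add: count_on_def)
qed

text \<open>Monotone class induction over the integrand. For an indicator, the disjoint pieces
  \<open>K n\<close> reduce the sum over points to finite counts of sections.\<close>

lemma borel_measurable_nn_integral_count_space:
  fixes T :: "'o \<Rightarrow> 'c::topological_space set"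
  assumes T: "T \<in> N \<rightarrow>\<^sub>M config_algebra C" and C: "sigma_finite_configs C"
    and G: "G \<in> borel_measurable (N \<Otimes>\<^sub>M borel)"
  shows "(\<lambda>y. \<integral>\<^sup>+p. G (y, p) \<partial>count_space (T y)) \<in> borel_measurable N"
proof -
  obtain K :: "nat \<Rightarrow> 'c set" where K: "\<And>n. K n \<in> sets borel" "disjoint_family K"
    "\<And>\<mu>. \<mu> \<in> C \<Longrightarrow> \<mu> \<subseteq> (\<Union>n. K n)" "\<And>\<mu> n. \<mu> \<in> C \<Longrightarrow> finite (\<mu> \<inter> K n)"
    by (rule sigma_finite_configsE[OF C]) blast
  have TC: "T y \<in> C" if "y \<in> space N" for y
    using measurable_space[OF T that] by simp
  show ?thesis
    using G
  proof (induct rule: borel_measurable_induct)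
    case (cong f g)
    have "(\<integral>\<^sup>+p. f (y, p) \<partial>count_space (T y)) = (\<integral>\<^sup>+p. g (y, p) \<partial>count_space (T y))"
      if "y \<in> space N" for y
      by (rule nn_integral_cong) (use cong that in \<open>auto simp: space_pair_measure\<close>)
    with cong show ?case by (subst measurable_cong)
  next
    case (set A)
    have "(\<integral>\<^sup>+p. indicator A (y, p) \<partial>count_space (T y)) =
        (\<Sum>n. count_on (T y) (K n \<inter> Pair y -` A))" if y: "y \<in> space N" for y
    proof -
      have "(\<integral>\<^sup>+p. indicator A (y, p) \<partial>count_space (T y)) = count_on (T y) (Pair y -` A)"
        by (simp flip: nn_integral_count_space_indicator_eq add: indicator_vimage)
      also have "\<dots> = emeasure (count_space UNIV) (\<Union>n. T y \<inter> (K n \<inter> Pair y -` A))"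
        unfolding count_on_def using K(3)[OF TC[OF y]] by (intro arg_cong2[where f=emeasure]) auto
      also have "\<dots> = (\<Sum>n. count_on (T y) (K n \<inter> Pair y -` A))"
        unfolding count_on_def
        by (rule suminf_emeasure[symmetric]) (use K(2) in \<open>auto simp: disjoint_family_on_def\<close>)
      finally show ?thesis .
    qed
    then show ?case
      using count_on_section_measurable[OF T K(1) K(4) set]
      by (subst measurable_cong) auto
  next
    case (mult u c)
    then show ?case by (simp add: nn_integral_cmult)
  next
    case (add u v)
    then show ?case by (simp add: nn_integral_add)
  next
    case (seq U)
    have "(\<integral>\<^sup>+p. (SUP i. U i) (y, p) \<partial>count_space (T y)) =
        (SUP i. \<integral>\<^sup>+p. U i (y, p) \<partial>count_space (T y))" for y
      unfolding SUP_apply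
      by (rule nn_integral_monotone_convergence_SUP)
        (use seq in \<open>auto simp: incseq_def le_fun_def\<close>)
    with seq show ?case by simp
  qed
qed

text \<open>
  A positive linear functional with monotone convergence is a measure; this constructs sums of
  measures and Campbell measures.
\<close>

lemma nn_integral_functional:
  fixes I :: "('b \<Rightarrow> ennreal) \<Rightarrow> ennreal"
  assumes cong: "\<And>f g. f \<in> borel_measurable N \<Longrightarrow> g \<in> borel_measurable N \<Longrightarrow>
      (\<And>x. x \<in> space N \<Longrightarrow> f x = g x) \<Longrightarrow> I f = I g"
    and zero: "I (\<lambda>_. 0) = 0"
    and add: "\<And>f g. f \<in> borel_measurable N \<Longrightarrow> g \<in> borel_measurable N \<Longrightarrow>
      I (\<lambda>x. f x + g x) = I f + I g"
    and mult: "\<And>f c. f \<in> borel_measurable N \<Longrightarrow> I (\<lambda>x. c * f x) = c * I f"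
    and sup: "\<And>F. (\<And>i::nat. F i \<in> borel_measurable N) \<Longrightarrow> incseq F \<Longrightarrow>
      I (\<lambda>x. SUP i. F i x) = (SUP i. I (F i))"
  obtains L where "sets L = sets N" "\<And>f. f \<in> borel_measurable N \<Longrightarrow> (\<integral>\<^sup>+x. f x \<partial>L) = I f"
proof -
  define L where "L = measure_of (space N) (sets N) (\<lambda>A. I (indicator A))"
  have sum: "I (\<lambda>x. \<Sum>i<n. f i x) = (\<Sum>i<n. I (f i))"
    if "\<And>i. f i \<in> borel_measurable N" for n :: nat and f
    using that by (induct n) (simp_all add: zero add)
  have sets [simp]: "sets L = sets N" and space [simp]: "space L = space N"
    unfolding L_def by simp_all
  have em: "emeasure L A = I (indicator A)" if "A \<in> sets N" for A
    unfolding L_def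
  proof (rule emeasure_measure_of_sigma)
    show "positive (sets N) (\<lambda>A. I (indicator A))"
      using zero by (simp add: positive_def indicator_def[abs_def])
    show "countably_additive (sets N) (\<lambda>A. I (indicator A))"
    proof (rule countably_additiveI)
      fix A :: "nat \<Rightarrow> 'b set"
      assume A: "range A \<subseteq> sets N" "disjoint_family A" "(\<Union>i. A i) \<in> sets N"
      have [measurable]: "A i \<in> sets N" for i using A(1) by auto
      let ?F = "\<lambda>n x. \<Sum>i<n. indicator (A i) x :: ennreal"
      have "(\<Sum>i. I (indicator (A i))) = (SUP n. \<Sum>i<n. I (indicator (A i)))"
        by (rule suminf_eq_SUP)
      also have "\<dots> = (SUP n. I (?F n))" by (simp add: sum)
      also have "\<dots> = I (\<lambda>x. SUP n. ?F n x)"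
        by (rule sup[symmetric]) (auto simp: incseq_def le_fun_def intro!: sum_mono2)
      also have "(\<lambda>x. SUP n. ?F n x) = (\<lambda>x. \<Sum>i. indicator (A i) x)"
        by (simp add: suminf_eq_SUP)
      also have "\<dots> = indicator (\<Union>i. A i)"
        using suminf_indicator[OF A(2)] by auto
      finally show "(\<Sum>i. I (indicator (A i))) = I (indicator (\<Union>i. A i))" .
    qed
  qed (use that sets.sigma_algebra_axioms in auto)
  show thesis
  proof (rule that[of L])
    fix f :: "'b \<Rightarrow> ennreal" assume "f \<in> borel_measurable N"
    then show "(\<integral>\<^sup>+x. f x \<partial>L) = I f"
    proof (induct rule: borel_measurable_induct)
      case (cong f g)
      then show ?case using assms(1)[of f g] nn_integral_cong[of L f g] by simp
    next
      case (set A)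
      then show ?case by (simp add: em)
    next
      case (mult u c)
      then show ?case
        using assms(4)[of u c] by (simp add: nn_integral_cmult cong: measurable_cong_sets)
    next
      case (add u v)
      then show ?case
        using assms(3)[of v u] by (simp add: nn_integral_add cong: measurable_cong_sets)
    next
      case (seq U)
      have "(\<integral>\<^sup>+x. (SUP i. U i) x \<partial>L) = (SUP i. \<integral>\<^sup>+x. U i x \<partial>L)"
        unfolding SUP_apply using seq
        by (intro nn_integral_monotone_convergence_SUP) (auto cong: measurable_cong_sets)
      also have "\<dots> = I (\<lambda>x. SUP i. U i x)"
        using seq sup[of U] by simp
      finally show ?case by (simp add: image_comp)
    qed
  qed simp
qed

text \<open>A point with property \<open>R\<close> exists exactly when the sum of the indicator of
  \<open>R\<close> over the configuration is nonzero, and that sum is measurable.\<close>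

lemma measurable_pred_ex_config:
  fixes T :: "'o \<Rightarrow> 'c::topological_space set"
  assumes T: "T \<in> N \<rightarrow>\<^sub>M config_algebra C" and C: "sigma_finite_configs C"
    and R: "Measurable.pred (N \<Otimes>\<^sub>M borel) (\<lambda>(y, p). R y p)"
  shows "Measurable.pred N (\<lambda>y. \<exists>p\<in>T y. R y p)"
proof -
  have [measurable]: "Measurable.pred (N \<Otimes>\<^sub>M borel) (\<lambda>yp. R (fst yp) (snd yp))"
    using R by (simp add: case_prod_beta')
  have *: "(\<exists>p\<in>T y. R y p) \<longleftrightarrow>
      (\<integral>\<^sup>+p. (\<lambda>yp. if R (fst yp) (snd yp) then 1 else 0) (y, p) \<partial>count_space (T y)) \<noteq> (0::ennreal)" for y
    by (subst nn_integral_0_iff_AE) (auto simp: AE_count_space)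
  have [measurable]: "(\<lambda>y. \<integral>\<^sup>+p. (\<lambda>yp. if R (fst yp) (snd yp) then 1 else 0) (y, p) \<partial>count_space (T y)) \<in>
      borel_measurable N"
    by (rule borel_measurable_nn_integral_count_space[OF T C]) measurable
  show ?thesis
    unfolding * by measurable
qed

section \<open>Configuration spaces\<close>

lemma ground_configs_iff:
  "(\<nu> :: 'a::euclidean_space set) \<in> ground_configs \<longleftrightarrow> (\<forall>r. finite (\<nu> \<inter> ball 0 r))"
proof
  assume "\<nu> \<in> ground_configs"
  then show "\<forall>r. finite (\<nu> \<inter> ball 0 r)"
    unfolding ground_configs_def by (auto simp: count_on_less_top_iff)
next
  assume *: "\<forall>r. finite (\<nu> \<inter> ball 0 r)"
  have "finite (\<nu> \<inter> B)" if "bounded B" for B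
  proof -
    obtain r where "B \<subseteq> ball 0 r" using \<open>bounded B\<close> bounded_subset_ballD by blast
    then show ?thesis
      by (intro finite_subset[of "\<nu> \<inter> B" "\<nu> \<inter> ball 0 r"] *[rule_format]) auto
  qed
  then show "\<nu> \<in> ground_configs"
    unfolding ground_configs_def by (auto simp: count_on_less_top_iff)
qed

lemma simple_config_iff:
  "simple_config (\<mu> :: ('a::euclidean_space \<times> real) set) \<longleftrightarrow>
    (\<forall>t s. (t, s) \<in> \<mu> \<longrightarrow> 0 < s) \<and> (\<forall>t s s'. (t, s) \<in> \<mu> \<longrightarrow> (t, s') \<in> \<mu> \<longrightarrow> s = s')"
  (is "_ \<longleftrightarrow> ?pos \<and> ?inj")
proof -
  have pos: "\<mu> \<subseteq> score_space \<longleftrightarrow> ?pos" by (auto simp: score_space_def)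
  have "(\<forall>t. count_on \<mu> ({t} \<times> {0<..}) \<le> 1) \<longleftrightarrow> ?inj" if "?pos"
  proof (intro iffI allI impI)
    fix t s s' assume le: "\<forall>t. count_on \<mu> ({t} \<times> {0<..}) \<le> 1" and "(t, s) \<in> \<mu>" "(t, s') \<in> \<mu>"
    show "s = s'"
    proof (rule ccontr)
      assume "s \<noteq> s'"
      then have "of_nat 2 \<le> count_on \<mu> ({t} \<times> {0<..})"
        unfolding of_nat_le_count_on_iff using that \<open>(t, s) \<in> \<mu>\<close> \<open>(t, s') \<in> \<mu>\<close>
        by (intro exI[of _ "{(t, s), (t, s')}"]) auto
      then have "of_nat 2 \<le> (of_nat 1 :: ennreal)" using le order_trans by fastforce
      then show False by (simp only: of_nat_le_iff)
    qed
  next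
    fix t assume inj: ?inj
    show "count_on \<mu> ({t} \<times> {0<..}) \<le> 1"
    proof (cases "\<mu> \<inter> ({t} \<times> {0<..}) = {}")
      case True
      then show ?thesis by (simp add: count_on_def)
    next
      case False
      then obtain s where "(t, s) \<in> \<mu>" "0 < s" by auto
      then have "\<mu> \<inter> ({t} \<times> {0<..}) = {(t, s)}" using inj by auto
      then show ?thesis by (simp add: count_on_def)
    qed
  qed
  then show ?thesis unfolding simple_config_def pos by blast
qed

lemma bounded_family_ball: "0 < \<epsilon> \<Longrightarrow> ball (0::'a::euclidean_space) r \<times> {\<epsilon><..} \<in> bounded_family"
  unfolding bounded_family_def by (auto intro!: borel_open open_Times exI[of _ "ball 0 r"])

lemma configs_iff:
  "(\<mu> :: ('a::euclidean_space \<times> real) set) \<in> configs \<longleftrightarrow>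
    simple_config \<mu> \<and> (\<forall>r \<epsilon>. 0 < \<epsilon> \<longrightarrow> finite (\<mu> \<inter> (ball 0 r \<times> {\<epsilon><..})))"
proof
  assume "\<mu> \<in> configs"
  then show "simple_config \<mu> \<and> (\<forall>r \<epsilon>. 0 < \<epsilon> \<longrightarrow> finite (\<mu> \<inter> (ball 0 r \<times> {\<epsilon><..})))"
    unfolding configs_def by (auto simp: bounded_family_ball simp flip: count_on_less_top_iff)
next
  assume *: "simple_config \<mu> \<and> (\<forall>r \<epsilon>. 0 < \<epsilon> \<longrightarrow> finite (\<mu> \<inter> (ball 0 r \<times> {\<epsilon><..})))"
  have "finite (\<mu> \<inter> A)" if "A \<in> bounded_family" for A
  proof -
    obtain B :: "'a set" and \<epsilon> where B: "bounded B" "0 < \<epsilon>" "A \<subseteq> B \<times> {\<epsilon><..}"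
      using \<open>A \<in> bounded_family\<close> unfolding bounded_family_def by auto
    obtain r where "B \<subseteq> ball 0 r" using \<open>bounded B\<close> bounded_subset_ballD by blast
    then have "\<mu> \<inter> A \<subseteq> \<mu> \<inter> (ball 0 r \<times> {\<epsilon><..})" using B by auto
    then show ?thesis
      by (rule finite_subset) (use * B in auto)
  qed
  then show "\<mu> \<in> configs"
    using * unfolding configs_def by (auto simp: count_on_less_top_iff)
qed

lemma configs10_iff:
  "(\<mu> :: ('a::euclidean_space \<times> real) set) \<in> configs10 \<longleftrightarrow>
    simple_config \<mu> \<and> (\<forall>r. finite (\<mu> \<inter> (ball 0 r \<times> UNIV)))"
proof
  assume \<mu>: "\<mu> \<in> configs10"
  then have s: "simple_config \<mu>" unfolding configs10_def configs_def by auto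
  have "finite (\<mu> \<inter> (ball 0 r \<times> {0<..}))" for r
    using \<mu> unfolding configs10_def by (auto simp flip: count_on_less_top_iff)
  moreover have "\<mu> \<inter> (ball 0 r \<times> UNIV) = \<mu> \<inter> (ball 0 r \<times> {0<..})" for r
    using s by (auto simp: simple_config_iff)
  ultimately show "simple_config \<mu> \<and> (\<forall>r. finite (\<mu> \<inter> (ball 0 r \<times> UNIV)))"
    using s by simp
next
  assume *: "simple_config \<mu> \<and> (\<forall>r. finite (\<mu> \<inter> (ball 0 r \<times> UNIV)))"
  have "finite (\<mu> \<inter> (B \<times> {0<..}))" if "bounded B" for B
  proof -
    obtain r where "B \<subseteq> ball 0 r" using \<open>bounded B\<close> bounded_subset_ballD by blast
    then have "\<mu> \<inter> (B \<times> {0<..}) \<subseteq> \<mu> \<inter> (ball 0 r \<times> UNIV)" by auto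
    then show ?thesis
      by (rule finite_subset) (use * in auto)
  qed
  moreover have "finite (\<mu> \<inter> (ball 0 r \<times> {e<..}))" for r e
    by (rule finite_subset[of _ "\<mu> \<inter> (ball 0 r \<times> UNIV)"]) (use * in auto)
  then have "\<mu> \<in> configs"
    using * unfolding configs_iff by blast
  ultimately show "\<mu> \<in> configs10"
    unfolding configs10_def by (auto simp: count_on_less_top_iff)
qed

lemma configs10_subset: "configs10 \<subseteq> configs"
  unfolding configs10_def by auto

lemma ball_cover: "(x :: 'a::real_normed_vector) \<in> (\<Union>n::nat. ball 0 (real n))"
  using reals_Archimedean2[of "norm x"] by auto

lemma sigma_finite_configs_configs:
  "sigma_finite_configs (configs :: ('a::euclidean_space \<times> real) set set)"
  unfolding sigma_finite_configs_def
proof (intro exI[of _ "\<lambda>n. ball 0 (real n) \<times> {inverse (real (Suc n))<..}"] conjI allI ballI)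
  fix \<mu> :: "('a \<times> real) set" assume \<mu>: "\<mu> \<in> configs"
  show "\<mu> \<subseteq> (\<Union>n. ball 0 (real n) \<times> {inverse (real (Suc n))<..})"
  proof safe
    fix t s assume "(t, s) \<in> \<mu>"
    then have "0 < s" using \<mu> by (auto simp: configs_iff simple_config_iff)
    then obtain n where n: "inverse (real (Suc n)) < s" using reals_Archimedean by auto
    obtain k :: nat where k: "norm t < real k" using reals_Archimedean2 by auto
    \<comment> \<open>A single index bounds both the position and the score, so the larger of the
      two indices is taken.\<close>
    have "inverse (real (Suc (max n k))) \<le> inverse (real (Suc n))" by (intro le_imp_inverse_le) auto
    then have "(t, s) \<in> ball 0 (real (max n k)) \<times> {inverse (real (Suc (max n k)))<..}"
      using order.strict_trans1[OF _ n, of "inverse (real (Suc (max n k)))"] k by auto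
    then show "(t, s) \<in> (\<Union>n. ball 0 (real n) \<times> {inverse (real (Suc n))<..})" by blast
  qed
  show "finite (\<mu> \<inter> (ball 0 (real n) \<times> {inverse (real (Suc n))<..}))" for n
    using \<mu> unfolding configs_iff by auto
qed (auto intro!: borel_open open_Times)

lemma sigma_finite_configs_subset: "sigma_finite_configs D \<Longrightarrow> C \<subseteq> D \<Longrightarrow> sigma_finite_configs C"
  unfolding sigma_finite_configs_def by (metis in_mono)

lemma sigma_finite_configs_configs10:
  "sigma_finite_configs (configs10 :: ('a::euclidean_space \<times> real) set set)"
  by (rule sigma_finite_configs_subset[OF sigma_finite_configs_configs configs10_subset])

lemma sigma_finite_configs_ground:
  "sigma_finite_configs (ground_configs :: 'a::euclidean_space set set)"
  unfolding sigma_finite_configs_def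
  by (rule exI[of _ "\<lambda>n. ball 0 (real n)"]) (use ball_cover in \<open>auto simp: ground_configs_iff\<close>)

text \<open>Scored points carry the Borel algebra of the product type; continuity of the projections
  makes both coordinates measurable without passing to the product algebra.\<close>

lemma borel_measurable_fst_pair [measurable (raw)]:
  fixes f :: "'o \<Rightarrow> 'a::second_countable_topology \<times> 'b::second_countable_topology"
  assumes "f \<in> borel_measurable N"
  shows "(\<lambda>y. fst (f y)) \<in> borel_measurable N" "(\<lambda>y. snd (f y)) \<in> borel_measurable N"
  using measurable_compose[OF assms borel_measurable_continuous_onI[OF continuous_on_fst[OF continuous_on_id]]]
    measurable_compose[OF assms borel_measurable_continuous_onI[OF continuous_on_snd[OF continuous_on_id]]]
  by simp_all

lemma measurable_config_algebra_subset:
  fixes T :: "'o \<Rightarrow> 'c::{second_countable_topology, metric_space} set"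
  assumes T: "T \<in> N \<rightarrow>\<^sub>M config_algebra C" and "C \<subseteq> D"
  shows "T \<in> N \<rightarrow>\<^sub>M config_algebra D"
proof (rule measurable_config_algebraI)
  show "T \<omega> \<in> D" if "\<omega> \<in> space N" for \<omega>
    using measurable_space[OF T that] assms(2) by auto
  show "{\<omega> \<in> space N. T \<omega> \<inter> B = {}} \<in> sets N" if "B \<in> sets borel" for B
  proof -
    have "{\<omega> \<in> space N. T \<omega> \<inter> B = {}} = T -` {\<mu> \<in> C. \<mu> \<inter> B = {}} \<inter> space N"
      using measurable_space[OF T] by auto
    then show ?thesis using measurable_sets[OF T sets_void[OF that]] by simp
  qed
qed

text \<open>Membership in \<open>configs10\<close> matters: a member of \<open>configs\<close> may
  have infinitely many small scores above a bounded set, and then its projection is not locally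
  finite.\<close>

lemma measurable_fst_image:
  fixes T :: "'o \<Rightarrow> ('a::euclidean_space \<times> real) set"
  assumes T: "T \<in> N \<rightarrow>\<^sub>M config_algebra configs10"
  shows "(\<lambda>y. fst ` T y) \<in> N \<rightarrow>\<^sub>M config_algebra ground_configs"
proof (rule measurable_config_algebraI)
  fix y assume "y \<in> space N"
  then have "T y \<in> configs10" using measurable_space[OF T] by simp
  then have "finite (fst ` (T y \<inter> (ball 0 r \<times> UNIV)))" for r by (simp add: configs10_iff)
  moreover have "fst ` T y \<inter> ball 0 r = fst ` (T y \<inter> (ball 0 r \<times> UNIV))" for r by force
  ultimately show "fst ` T y \<in> ground_configs" by (simp add: ground_configs_iff)
next
  fix B :: "'a set" assume [measurable]: "B \<in> sets borel"
  have "Measurable.pred N (\<lambda>y. \<exists>p\<in>T y. fst p \<in> B)"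
    by (rule measurable_pred_ex_config[OF T sigma_finite_configs_configs10]) measurable
  then have "{y \<in> space N. \<not> (\<exists>p\<in>T y. fst p \<in> B)} \<in> sets N"
    by (intro sets.sets_Collect_neg) (simp add: pred_def)
  moreover have "{y \<in> space N. \<not> (\<exists>p\<in>T y. fst p \<in> B)} = {y \<in> space N. fst ` T y \<inter> B = {}}" by auto
  ultimately show "{y \<in> space N. fst ` T y \<inter> B = {}} \<in> sets N" by simp
qed

text \<open>The guard on \<open>s\<close> makes \<open>ins\<close> a total map on configurations.\<close>

definition ins :: "'a \<Rightarrow> real \<Rightarrow> ('a \<times> real) set \<Rightarrow> ('a \<times> real) set" where
  "ins x s \<mu> = (if 0 < s then insert (x, s) {p \<in> \<mu>. fst p \<noteq> x} else \<mu>)"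

lemma add_origin_eq_ins: "0 < z \<Longrightarrow> add_origin \<mu> z = ins 0 z \<mu>"
  by (simp add: add_origin_def ins_def)

lemma ins_in_configs10: "\<mu> \<in> configs10 \<Longrightarrow> ins x s \<mu> \<in> configs10"
proof -
  assume \<mu>: "\<mu> \<in> configs10"
  have "finite (insert (x, s) {p \<in> \<mu>. fst p \<noteq> x} \<inter> (ball 0 r \<times> UNIV))" for r
    by (rule finite_subset[of _ "insert (x, s) (\<mu> \<inter> (ball 0 r \<times> UNIV))"])
      (use \<mu> in \<open>auto simp: configs10_iff\<close>)
  moreover have "simple_config (insert (x, s) {p \<in> \<mu>. fst p \<noteq> x})" if "0 < s"
    using \<mu> that unfolding configs10_iff simple_config_iff by auto
  ultimately have "insert (x, s) {p \<in> \<mu>. fst p \<noteq> x} \<in> configs10" if "0 < s"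
    using that unfolding configs10_iff by blast
  then show ?thesis using \<mu> by (simp add: ins_def)
qed

lemma measurable_ins:
  fixes T :: "'o \<Rightarrow> ('a::euclidean_space \<times> real) set"
  assumes [measurable]: "X \<in> borel_measurable N" "S \<in> borel_measurable N"
    and T: "T \<in> N \<rightarrow>\<^sub>M config_algebra configs10"
  shows "(\<lambda>y. ins (X y) (S y) (T y)) \<in> N \<rightarrow>\<^sub>M config_algebra configs10"
proof (rule measurable_config_algebraI)
  show "ins (X y) (S y) (T y) \<in> configs10" if "y \<in> space N" for y
    using measurable_space[OF T that] by (simp add: ins_in_configs10)
next
  fix B :: "('a \<times> real) set" assume [measurable]: "B \<in> sets borel"
  \<comment> \<open>The disjunction selects the old points that survive the insertion: those away
    from the new position, or all of them when the guard fails.\<close>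
  have [measurable]: "Measurable.pred N (\<lambda>y. \<exists>p\<in>T y. p \<in> B \<and> (fst p \<noteq> X y \<or> \<not> 0 < S y))"
    by (rule measurable_pred_ex_config[OF T sigma_finite_configs_configs10]) measurable
  have "Measurable.pred N (\<lambda>y. \<not> (0 < S y \<and> (X y, S y) \<in> B) \<and>
      \<not> (\<exists>p\<in>T y. p \<in> B \<and> (fst p \<noteq> X y \<or> \<not> 0 < S y)))"
    by measurable
  moreover have "(\<not> (0 < S y \<and> (X y, S y) \<in> B) \<and>
      \<not> (\<exists>p\<in>T y. p \<in> B \<and> (fst p \<noteq> X y \<or> \<not> 0 < S y))) \<longleftrightarrow> ins (X y) (S y) (T y) \<inter> B = {}" for y
    by (auto simp: ins_def)
  ultimately show "{y \<in> space N. ins (X y) (S y) (T y) \<inter> B = {}} \<in> sets N"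
    by (simp add: pred_def)
qed

section \<open>The Mecke equation\<close>

lemma measurable_count_on_compose:
  "T \<in> N \<rightarrow>\<^sub>M config_algebra C \<Longrightarrow> B \<in> sets borel \<Longrightarrow> (\<lambda>y. count_on (T y) B) \<in> borel_measurable N"
  by (rule measurable_compose[OF _ measurable_count_on])

lemma nn_integral_count_poisson:
  assumes "prob_space M" and P: "P \<in> M \<rightarrow>\<^sub>M config_algebra C"
    and pois: "poisson_process M P \<Lambda>" and \<Lambda>: "sets \<Lambda> = sets borel"
    and A: "A \<in> sets borel" and fin: "emeasure \<Lambda> A < \<infinity>"
  shows "(\<integral>\<^sup>+\<omega>. count_on (P \<omega>) A \<partial>M) = emeasure \<Lambda> A"
proof -
  interpret prob_space M by fact
  define l where "l = measure \<Lambda> A"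
  have l: "0 \<le> l" "emeasure \<Lambda> A = ennreal l"
    unfolding l_def using fin by (auto simp: emeasure_eq_ennreal_measure top.not_eq_extremum)
  define N where "N k = {\<omega> \<in> space M. count_on (P \<omega>) A = of_nat k}" for k :: nat
  have [measurable]: "(\<lambda>\<omega>. count_on (P \<omega>) A) \<in> borel_measurable M"
    using P A by (rule measurable_count_on_compose)
  have N [measurable]: "N k \<in> sets M" for k unfolding N_def by measurable
  have prob: "prob (N k) = exp (- l) * l ^ k / fact k" for k
    using pois A fin \<Lambda> unfolding poisson_process_def N_def l_def by auto
  have disj: "disjoint_family N" unfolding disjoint_family_on_def N_def by auto
  \<comment> \<open>The hypothesis prescribes the probabilities of finite values; that they sum to
    one excludes the value infinity almost surely.\<close>
  have "(\<lambda>k. exp (- l) * (l ^ k /\<^sub>R fact k)) sums (exp (- l) * exp l)"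
    by (intro sums_mult exp_converges)
  then have sums1: "(\<lambda>k. exp (- l) * l ^ k / fact k) sums 1"
    by (simp add: divide_inverse mult_ac exp_minus)
  have "(\<lambda>k. prob (N k)) sums prob (\<Union>k. N k)"
    by (rule finite_measure_UNION) (use disj in auto)
  then have "prob (\<Union>k. N k) = 1"
    using sums1 sums_unique2 unfolding prob by blast
  then have "AE \<omega> in M. \<omega> \<in> (\<Union>k. N k)"
    by (intro AE_prob_1) auto
  then have "AE \<omega> in M. count_on (P \<omega>) A = (\<Sum>k. of_nat k * indicator (N k) \<omega>)"
  proof eventually_elim
    case (elim \<omega>)
    then obtain k where k: "\<omega> \<in> N k" by auto
    then have nk: "\<omega> \<notin> N j" if "j \<noteq> k" for j using that by (simp add: N_def)
    have "(\<Sum>j. of_nat j * indicator (N j) \<omega>) = (\<Sum>j\<in>{k}. of_nat j * indicator (N j) \<omega> :: ennreal)"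
      by (rule suminf_finite) (simp_all add: nk)
    also have "\<dots> = of_nat k" using k by simp
    finally show ?case using k unfolding N_def by (metis (mono_tags, lifting) mem_Collect_eq)
  qed
  then have "(\<integral>\<^sup>+\<omega>. count_on (P \<omega>) A \<partial>M) = (\<integral>\<^sup>+\<omega>. (\<Sum>k. of_nat k * indicator (N k) \<omega>) \<partial>M)"
    by (rule nn_integral_cong_AE)
  also have "\<dots> = (\<Sum>k. \<integral>\<^sup>+\<omega>. of_nat k * indicator (N k) \<omega> \<partial>M)"
    by (rule nn_integral_suminf) measurable
  also have "\<dots> = (\<Sum>k. ennreal (real k * (exp (- l) * l ^ k / fact k)))"
    by (simp add: nn_integral_cmult_indicator emeasure_eq_measure prob ennreal_mult'' l
        ennreal_of_nat_eq_real_of_nat flip: ennreal_mult)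
  also have "\<dots> = ennreal l"
  proof (rule suminf_ennreal_eq)
    have "(\<lambda>k. l * (exp (- l) * l ^ k / fact k)) sums (l * 1)"
      by (intro sums_mult sums1)
    \<comment> \<open>The factor \<open>Suc k\<close> cancels against the factorial, so after a
      shift of the index the mean is \<open>l\<close> times the total mass; the term for index 0
      vanishes.\<close>
    moreover have "l * (exp (- l) * l ^ k / fact k) =
        real (Suc k) * (exp (- l) * l ^ Suc k / fact (Suc k))" for k
      by (simp add: field_simps del: of_nat_Suc)
    ultimately have "(\<lambda>k. real (Suc k) * (exp (- l) * l ^ Suc k / fact (Suc k))) sums l"
      by (simp only: mult_1_right)
    then show "(\<lambda>k. real k * (exp (- l) * l ^ k / fact k)) sums l"
      by (rule sums_Suc_imp[rotated]) simp
  qed (simp add: l)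
  finally show ?thesis by (simp add: l)
qed

text \<open>On the event that \<open>A\<close> is void, the points in \<open>B\<close> are those in
  \<open>B - A\<close>, and the counts on \<open>B - A\<close> and on \<open>A\<close> are
  independent. This evaluates one side of the Mecke equation for its simplest test
  functions.\<close>

lemma nn_integral_count_void_poisson:
  assumes "prob_space M" and P: "P \<in> M \<rightarrow>\<^sub>M config_algebra C"
    and pois: "poisson_process M P \<Lambda>" and \<Lambda>: "sets \<Lambda> = sets borel"
    and B: "B \<in> sets borel" "emeasure \<Lambda> B < \<infinity>" and A: "A \<in> sets borel"
  shows "(\<integral>\<^sup>+\<omega>. count_on (P \<omega>) B * indicator {\<omega>. P \<omega> \<inter> A = {}} \<omega> \<partial>M) =
    emeasure \<Lambda> (B - A) * emeasure M {\<omega> \<in> space M. P \<omega> \<inter> A = {}}"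
proof -
  interpret prob_space M by fact
  \<comment> \<open>Independence is assumed for indexed families of disjoint sets, so the two sets
    and the two functions of the counts are indexed by 0 and 1.\<close>
  define D where "D i = (if i = 0 then B - A else A)" for i :: nat
  define f where "f i = (if i = 0 then (\<lambda>x. x) else indicator {0 :: ennreal})" for i :: nat
  have f: "f i \<in> borel_measurable borel" for i by (simp add: f_def)
  have AB: "B - A \<in> sets borel" using A B(1) by simp
  have "indep_vars (\<lambda>_. borel) (\<lambda>i \<omega>. count_on (P \<omega>) (D i)) {..<2}"
  proof -
    have "(\<forall>i<2. D i \<in> sets \<Lambda>) \<and> disjoint_family_on D {..<2}"
      using A B(1) \<Lambda> by (auto simp: D_def disjoint_family_on_def)
    then show ?thesis using pois unfolding poisson_process_def by blast
  qed
  then have indep: "indep_vars (\<lambda>_. borel) (\<lambda>i \<omega>. f i (count_on (P \<omega>) (D i))) {..<2}"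
    by (rule indep_vars_compose2) (rule f)
  have "count_on (P \<omega>) B * indicator {\<omega>. P \<omega> \<inter> A = {}} \<omega> =
      (\<Prod>i<2. f i (count_on (P \<omega>) (D i)))" for \<omega>
  proof (cases "P \<omega> \<inter> A = {}")
    case True
    then have "P \<omega> \<inter> B = P \<omega> \<inter> (B - A)" by auto
    then have "count_on (P \<omega>) B = count_on (P \<omega>) (B - A)" unfolding count_on_def by simp
    then show ?thesis using True
      by (simp add: f_def D_def numeral_2_eq_2 count_on_eq_0_iff)
  next
    case False
    then show ?thesis by (simp add: f_def D_def numeral_2_eq_2 count_on_eq_0_iff)
  qed
  then have "(\<integral>\<^sup>+\<omega>. count_on (P \<omega>) B * indicator {\<omega>. P \<omega> \<inter> A = {}} \<omega> \<partial>M) =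
      (\<integral>\<^sup>+\<omega>. (\<Prod>i<2. f i (count_on (P \<omega>) (D i))) \<partial>M)" by simp
  also have "\<dots> = (\<Prod>i<2. \<integral>\<^sup>+\<omega>. f i (count_on (P \<omega>) (D i)) \<partial>M)"
    by (rule indep_vars_nn_integral[OF _ indep]) auto
  also have "\<dots> = (\<integral>\<^sup>+\<omega>. count_on (P \<omega>) (B - A) \<partial>M) *
      (\<integral>\<^sup>+\<omega>. indicator {0} (count_on (P \<omega>) A) \<partial>M)"
    by (simp add: f_def D_def numeral_2_eq_2)
  also have "(\<integral>\<^sup>+\<omega>. count_on (P \<omega>) (B - A) \<partial>M) = emeasure \<Lambda> (B - A)"
    using assms(1) P pois \<Lambda> AB
  proof (rule nn_integral_count_poisson)
    have "emeasure \<Lambda> (B - A) \<le> emeasure \<Lambda> B"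
      by (rule emeasure_mono) (use B \<Lambda> in auto)
    then show "emeasure \<Lambda> (B - A) < \<infinity>" using B(2) by (rule le_less_trans)
  qed
  also have "(\<integral>\<^sup>+\<omega>. indicator {0} (count_on (P \<omega>) A) \<partial>M) =
      (\<integral>\<^sup>+\<omega>. indicator {\<omega> \<in> space M. P \<omega> \<inter> A = {}} \<omega> \<partial>M)"
    by (rule nn_integral_cong) (auto simp: count_on_eq_0_iff split: split_indicator)
  also have "\<dots> = emeasure M {\<omega> \<in> space M. P \<omega> \<inter> A = {}}"
  proof (rule nn_integral_indicator)
    have [measurable]: "(\<lambda>\<omega>. count_on (P \<omega>) A) \<in> borel_measurable M"
      using P A by (rule measurable_count_on_compose)
    have "{\<omega> \<in> space M. count_on (P \<omega>) A = 0} \<in> sets M" by measurable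
    then show "{\<omega> \<in> space M. P \<omega> \<inter> A = {}} \<in> sets M" by (simp add: count_on_eq_0_iff)
  qed
  finally show ?thesis .
qed

lemma AE_poisson_no_point:
  assumes "prob_space M" and pois: "poisson_process M P \<Lambda>" and \<Lambda>: "sets \<Lambda> = sets borel"
    and P: "P \<in> M \<rightarrow>\<^sub>M config_algebra C"
    and A: "A \<in> sets borel" "emeasure \<Lambda> A = 0"
  shows "AE \<omega> in M. P \<omega> \<inter> A = {}"
proof -
  have "(\<integral>\<^sup>+\<omega>. count_on (P \<omega>) A \<partial>M) = 0"
    using nn_integral_count_poisson[OF assms(1) P pois \<Lambda>] A by simp
  then show ?thesis
    using measurable_count_on_compose[OF P A(1)]
    by (simp add: nn_integral_0_iff_AE count_on_eq_0_iff)
qed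

text \<open>The generator is chosen for comparing measures: its members are products with a single
  void event. Equality holds because both projections are measurable for the algebra that these
  rectangles generate.\<close>

lemma sets_pair_void:
  fixes C :: "'c::{second_countable_topology, metric_space} set set"
  shows "sets ((borel :: 'c measure) \<Otimes>\<^sub>M config_algebra C) =
    sigma_sets (UNIV \<times> C) {B \<times> {\<mu> \<in> C. \<mu> \<inter> A = {}} | B A. B \<in> sets borel \<and> A \<in> sets borel}"
    (is "?S = sigma_sets ?\<Omega> ?E")
proof
  have E: "?E \<subseteq> Pow ?\<Omega>" by auto
  have sp: "space (sigma ?\<Omega> ?E) = ?\<Omega>" by (rule space_measure_of[OF E])
  have st: "sets (sigma ?\<Omega> ?E) = sigma_sets ?\<Omega> ?E" by (rule sets_measure_of[OF E])
  have fst: "fst \<in> sigma ?\<Omega> ?E \<rightarrow>\<^sub>M (borel :: 'c measure)"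
  proof (rule measurableI)
    fix B :: "'c set" assume "B \<in> sets borel"
    then have "B \<times> {\<mu> \<in> C. \<mu> \<inter> {} = {}} \<in> sigma_sets ?\<Omega> ?E"
      by (intro sigma_sets.Basic) blast
    moreover have "fst -` B \<inter> ?\<Omega> = B \<times> {\<mu> \<in> C. \<mu> \<inter> {} = {}}" by auto
    ultimately show "fst -` B \<inter> space (sigma ?\<Omega> ?E) \<in> sets (sigma ?\<Omega> ?E)"
      by (simp only: sp st)
  qed simp
  have snd: "snd \<in> sigma ?\<Omega> ?E \<rightarrow>\<^sub>M config_algebra C"
  proof (rule measurable_config_algebraI)
    fix A :: "'c set" assume "A \<in> sets borel"
    then have "\<exists>B A'. (UNIV :: 'c set) \<times> {\<mu> \<in> C. \<mu> \<inter> A = {}} = B \<times> {\<mu> \<in> C. \<mu> \<inter> A' = {}} \<and>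
        B \<in> sets borel \<and> A' \<in> sets borel"
      by (intro exI[of _ UNIV] exI[of _ A]) simp
    then have "UNIV \<times> {\<mu> \<in> C. \<mu> \<inter> A = {}} \<in> sigma_sets ?\<Omega> ?E"
      by (rule sigma_sets.Basic[OF CollectI])
    moreover have "{x \<in> ?\<Omega>. snd x \<inter> A = {}} = UNIV \<times> {\<mu> \<in> C. \<mu> \<inter> A = {}}" by auto
    ultimately show "{x \<in> space (sigma ?\<Omega> ?E). snd x \<inter> A = {}} \<in> sets (sigma ?\<Omega> ?E)"
      by (simp only: sp st)
  qed (auto simp: sp)
  show "?S \<subseteq> sigma_sets ?\<Omega> ?E"
  proof
    fix X assume X: "X \<in> ?S"
    then have "X \<subseteq> ?\<Omega>" using sets.sets_into_space[OF X] by (simp add: space_pair_measure)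
    then have "(\<lambda>x. (fst x, snd x)) -` X \<inter> ?\<Omega> = X" by auto
    then show "X \<in> sigma_sets ?\<Omega> ?E"
      using measurable_sets[OF measurable_Pair[OF fst snd] X] by (simp only: sp st)
  qed
  have "sigma_sets (space ((borel :: 'c measure) \<Otimes>\<^sub>M config_algebra C)) ?E \<subseteq> ?S"
    by (rule sets.sigma_sets_subset) (auto intro!: pair_measureI sets_void)
  then show "sigma_sets ?\<Omega> ?E \<subseteq> ?S" by (simp add: space_pair_measure)
qed

text \<open>
  Testing with \<open>B \<times> {\<mu>. \<mu> \<inter> A = {}}\<close> suffices, and there it reduces to the
  independence of the counts on \<open>B - A\<close> and \<open>A\<close>.
\<close>

lemma mecke:
  fixes P :: "'o \<Rightarrow> ('a::euclidean_space \<times> real) set"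
  assumes "prob_space M" and P: "P \<in> M \<rightarrow>\<^sub>M config_algebra configs10"
    and m: "prob_space m" "sets m = sets borel" "AE s in m. 0 < s"
    and pois: "poisson_process M P (lborel \<Otimes>\<^sub>M m)"
    and F: "F \<in> borel_measurable (borel \<Otimes>\<^sub>M config_algebra configs10)"
  shows "(\<integral>\<^sup>+\<omega>. \<integral>\<^sup>+p. F (p, P \<omega>) \<partial>count_space (P \<omega>) \<partial>M) =
    (\<integral>\<^sup>+p. \<integral>\<^sup>+\<omega>. F (p, ins (fst p) (snd p) (P \<omega>)) \<partial>M \<partial>(lborel \<Otimes>\<^sub>M m))"
proof -
  interpret prob_space M by fact
  interpret m: prob_space m by fact
  let ?\<Lambda> = "lborel \<Otimes>\<^sub>M m :: ('a \<times> real) measure"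
  interpret L: pair_sigma_finite "lborel :: 'a measure" m ..
  let ?C = "configs10 :: ('a \<times> real) set set"
  let ?N = "(borel :: ('a \<times> real) measure) \<Otimes>\<^sub>M config_algebra ?C"
  have \<Lambda> [measurable_cong]: "sets ?\<Lambda> = sets (borel :: ('a \<times> real) measure)"
    unfolding borel_prod[symmetric] by (rule sets_pair_measure_cong) (simp_all add: m)
  note [measurable] = P
  have PC: "P \<omega> \<in> configs10" if "\<omega> \<in> space M" for \<omega>
    using measurable_space[OF P that] by simp
  have swap: "(\<lambda>(\<omega>, p). (p, P \<omega>)) \<in> M \<Otimes>\<^sub>M borel \<rightarrow>\<^sub>M ?N" by measurable
  have inner: "(\<lambda>\<omega>. \<integral>\<^sup>+p. f (p, P \<omega>) \<partial>count_space (P \<omega>)) \<in> borel_measurable M"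
    if "f \<in> borel_measurable ?N" for f
    using borel_measurable_nn_integral_count_space[OF P sigma_finite_configs_configs10
        measurable_compose[OF swap that]] by simp
  \<comment> \<open>\<open>R\<close> is the Campbell measure of the process; its integrals form the
    left-hand side.\<close>
  obtain R where R: "sets R = sets ?N" "\<And>f. f \<in> borel_measurable ?N \<Longrightarrow>
      (\<integral>\<^sup>+x. f x \<partial>R) = (\<integral>\<^sup>+\<omega>. \<integral>\<^sup>+p. f (p, P \<omega>) \<partial>count_space (P \<omega>) \<partial>M)"
  proof (rule nn_integral_functional[of ?N
        "\<lambda>f. \<integral>\<^sup>+\<omega>. \<integral>\<^sup>+p. f (p, P \<omega>) \<partial>count_space (P \<omega>) \<partial>M"])
    fix f g :: "('a \<times> real) \<times> ('a \<times> real) set \<Rightarrow> ennreal"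
    assume "\<And>x. x \<in> space ?N \<Longrightarrow> f x = g x"
    then show "(\<integral>\<^sup>+\<omega>. \<integral>\<^sup>+p. f (p, P \<omega>) \<partial>count_space (P \<omega>) \<partial>M) =
        (\<integral>\<^sup>+\<omega>. \<integral>\<^sup>+p. g (p, P \<omega>) \<partial>count_space (P \<omega>) \<partial>M)"
      by (intro nn_integral_cong) (auto simp: space_pair_measure PC)
  next
    fix f g :: "('a \<times> real) \<times> ('a \<times> real) set \<Rightarrow> ennreal"
    assume "f \<in> borel_measurable ?N" "g \<in> borel_measurable ?N"
    then show "(\<integral>\<^sup>+\<omega>. \<integral>\<^sup>+p. f (p, P \<omega>) + g (p, P \<omega>) \<partial>count_space (P \<omega>) \<partial>M) =
        (\<integral>\<^sup>+\<omega>. \<integral>\<^sup>+p. f (p, P \<omega>) \<partial>count_space (P \<omega>) \<partial>M) +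
        (\<integral>\<^sup>+\<omega>. \<integral>\<^sup>+p. g (p, P \<omega>) \<partial>count_space (P \<omega>) \<partial>M)"
      by (simp add: nn_integral_add inner)
  next
    fix f :: "('a \<times> real) \<times> ('a \<times> real) set \<Rightarrow> ennreal" and c
    assume "f \<in> borel_measurable ?N"
    then show "(\<integral>\<^sup>+\<omega>. \<integral>\<^sup>+p. c * f (p, P \<omega>) \<partial>count_space (P \<omega>) \<partial>M) =
        c * (\<integral>\<^sup>+\<omega>. \<integral>\<^sup>+p. f (p, P \<omega>) \<partial>count_space (P \<omega>) \<partial>M)"
      by (simp add: nn_integral_cmult inner)
  next
    fix f :: "nat \<Rightarrow> ('a \<times> real) \<times> ('a \<times> real) set \<Rightarrow> ennreal"
    assume f: "\<And>i. f i \<in> borel_measurable ?N" "incseq f"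
    then have "(\<integral>\<^sup>+p. (SUP i. f i (p, P \<omega>)) \<partial>count_space (P \<omega>)) =
        (SUP i. \<integral>\<^sup>+p. f i (p, P \<omega>) \<partial>count_space (P \<omega>))" for \<omega>
      by (intro nn_integral_monotone_convergence_SUP) (auto simp: incseq_def le_fun_def)
    moreover have "incseq (\<lambda>i \<omega>. \<integral>\<^sup>+p. f i (p, P \<omega>) \<partial>count_space (P \<omega>))"
      using f(2) by (auto simp: incseq_def le_fun_def intro!: nn_integral_mono)
    ultimately show "(\<integral>\<^sup>+\<omega>. \<integral>\<^sup>+p. (SUP i. f i (p, P \<omega>)) \<partial>count_space (P \<omega>) \<partial>M) =
        (SUP i. \<integral>\<^sup>+\<omega>. \<integral>\<^sup>+p. f i (p, P \<omega>) \<partial>count_space (P \<omega>) \<partial>M)"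
      using f(1) inner by (simp add: nn_integral_monotone_convergence_SUP)
  qed simp_all
  \<comment> \<open>\<open>Q\<close> is the image of intensity times probability under insertion of
    the extra point; its integrals form the right-hand side.\<close>
  define Q where "Q = distr (?\<Lambda> \<Otimes>\<^sub>M M) ?N (\<lambda>(p, \<omega>). (p, ins (fst p) (snd p) (P \<omega>)))"
  have [measurable]: "(\<lambda>y. ins (fst (fst y)) (snd (fst y)) (P (snd y))) \<in>
      ?\<Lambda> \<Otimes>\<^sub>M M \<rightarrow>\<^sub>M config_algebra configs10"
    by (rule measurable_ins) measurable
  have insm: "(\<lambda>(p, \<omega>). (p, ins (fst p) (snd p) (P \<omega>))) \<in> ?\<Lambda> \<Otimes>\<^sub>M M \<rightarrow>\<^sub>M ?N"
    unfolding case_prod_beta by measurable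
  have Q: "sets Q = sets ?N" "\<And>f. f \<in> borel_measurable ?N \<Longrightarrow>
      (\<integral>\<^sup>+x. f x \<partial>Q) = (\<integral>\<^sup>+p. \<integral>\<^sup>+\<omega>. f (p, ins (fst p) (snd p) (P \<omega>)) \<partial>M \<partial>?\<Lambda>)"
  proof -
    fix f :: "('a \<times> real) \<times> ('a \<times> real) set \<Rightarrow> ennreal"
    assume f: "f \<in> borel_measurable ?N"
    have "(\<integral>\<^sup>+x. f x \<partial>Q) = (\<integral>\<^sup>+y. f (case y of (p, \<omega>) \<Rightarrow> (p, ins (fst p) (snd p) (P \<omega>))) \<partial>(?\<Lambda> \<Otimes>\<^sub>M M))"
      unfolding Q_def by (rule nn_integral_distr[OF insm]) (use f in simp)
    also have "\<dots> = (\<integral>\<^sup>+p. \<integral>\<^sup>+\<omega>. f (p, ins (fst p) (snd p) (P \<omega>)) \<partial>M \<partial>?\<Lambda>)"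
      by (subst nn_integral_fst[symmetric]) (use measurable_compose[OF insm f] in simp_all)
    finally show "(\<integral>\<^sup>+x. f x \<partial>Q) = (\<integral>\<^sup>+p. \<integral>\<^sup>+\<omega>. f (p, ins (fst p) (snd p) (P \<omega>)) \<partial>M \<partial>?\<Lambda>)" .
  qed (simp add: Q_def)
  \<comment> \<open>Slabs over balls have finite intensity because the mark law is a probability
    measure. They cut a general \<open>B\<close> into pieces of finite intensity and witness
    sigma-finiteness of \<open>R\<close>.\<close>
  define K where "K n = ball (0::'a) (real n) \<times> (UNIV :: real set)" for n :: nat
  have K: "K n \<in> sets borel" "emeasure ?\<Lambda> (K n) < \<infinity>" for n
  proof -
    show "K n \<in> sets borel" unfolding K_def by (intro borel_open open_Times) auto
    show "emeasure ?\<Lambda> (K n) < \<infinity>"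
      unfolding K_def
      using m.emeasure_space_1 m.emeasure_pair_measure_Times[of "ball (0::'a) (real n)" lborel UNIV] m(2)
        emeasure_bounded_finite[OF bounded_ball, of "0::'a" "real n"]
      by (simp add: sets_eq_imp_space_eq[OF m(2)])
  qed
  let ?E = "{B \<times> {\<mu> \<in> ?C. \<mu> \<inter> A = {}} | B A. B \<in> sets (borel :: ('a \<times> real) measure) \<and> A \<in> sets borel}"
  have rect: "B \<times> {\<mu> \<in> ?C. \<mu> \<inter> A = {}} \<in> sets ?N" if "B \<in> sets borel" "A \<in> sets borel" for A B
    using that by (intro pair_measureI sets_void)
  have ind: "indicator (B \<times> {\<mu> \<in> ?C. \<mu> \<inter> A = {}}) (p, P \<omega>) =
      indicator B p * (indicator {\<omega>. P \<omega> \<inter> A = {}} \<omega> :: ennreal)"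
    if "\<omega> \<in> space M" for A B p \<omega>
    using PC[OF that] by (auto split: split_indicator)
  have RQ_fin: "emeasure R (B \<times> {\<mu> \<in> ?C. \<mu> \<inter> A = {}}) = emeasure Q (B \<times> {\<mu> \<in> ?C. \<mu> \<inter> A = {}})"
    if B: "B \<in> sets borel" "emeasure ?\<Lambda> B < \<infinity>" and A: "A \<in> sets borel" for A B
  proof -
    let ?X = "B \<times> {\<mu> \<in> ?C. \<mu> \<inter> A = {}}" and ?v = "emeasure M {\<omega> \<in> space M. P \<omega> \<inter> A = {}}"
    have X [measurable]: "?X \<in> sets ?N" using rect B A by simp
    have "emeasure R ?X = (\<integral>\<^sup>+x. indicator ?X x \<partial>R)"
      using X R(1) by simp
    also have "\<dots> = (\<integral>\<^sup>+\<omega>. \<integral>\<^sup>+p. indicator ?X (p, P \<omega>) \<partial>count_space (P \<omega>) \<partial>M)"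
      by (rule R(2)) measurable
    also have "\<dots> = (\<integral>\<^sup>+\<omega>. count_on (P \<omega>) B * indicator {\<omega>. P \<omega> \<inter> A = {}} \<omega> \<partial>M)"
      by (rule nn_integral_cong)
        (simp add: ind nn_integral_multc nn_integral_count_space_indicator_eq del: indicator_simps)
    also have "\<dots> = emeasure ?\<Lambda> (B - A) * ?v"
      by (rule nn_integral_count_void_poisson[OF assms(1) P pois \<Lambda> B A])
    also have "\<dots> = (\<integral>\<^sup>+p. indicator (B - A) p * ?v \<partial>?\<Lambda>)"
      using B A \<Lambda> by (subst nn_integral_multc) auto
    also have "\<dots> = (\<integral>\<^sup>+p. \<integral>\<^sup>+\<omega>. indicator ?X (p, ins (fst p) (snd p) (P \<omega>)) \<partial>M \<partial>?\<Lambda>)"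
    proof (rule nn_integral_cong_AE)
      have "AE p in ?\<Lambda>. 0 < snd p"
      proof (rule L.AE_pair_measure)
        have "{p \<in> space (borel :: ('a \<times> real) measure). 0 < snd p} \<in> sets borel" by measurable
        then show "{p \<in> space ?\<Lambda>. 0 < snd p} \<in> sets ?\<Lambda>"
          by (simp only: \<Lambda> sets_eq_imp_space_eq[OF \<Lambda>])
      qed (use m(3) in simp)
      then show "AE p in ?\<Lambda>. indicator (B - A) p * ?v =
          (\<integral>\<^sup>+\<omega>. indicator ?X (p, ins (fst p) (snd p) (P \<omega>)) \<partial>M)"
      proof eventually_elim
        case (elim p)
        \<comment> \<open>The process almost surely has no point above the position of
          \<open>p\<close>, so \<open>ins\<close> adds the point without deleting any other.\<close>
        have null: "emeasure ?\<Lambda> ({fst p} \<times> UNIV) = 0"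
          using m.emeasure_pair_measure_Times[of "{fst p}" lborel UNIV] m(2) by simp
        have "AE \<omega> in M. P \<omega> \<inter> ({fst p} \<times> UNIV) = {}"
          by (rule AE_poisson_no_point[OF assms(1) pois \<Lambda> P _ null]) (intro borel_closed closed_Times, auto)
        then have "AE \<omega> in M. indicator (B - A) p * indicator {\<omega>. P \<omega> \<inter> A = {}} \<omega> =
            (indicator ?X (p, ins (fst p) (snd p) (P \<omega>)) :: ennreal)"
          using AE_space
        proof eventually_elim
          fix \<omega> assume "P \<omega> \<inter> ({fst p} \<times> UNIV) = {}" "\<omega> \<in> space M"
          then have *: "ins (fst p) (snd p) (P \<omega>) = insert p (P \<omega>)"
            using elim by (auto simp: ins_def)
          have "ins (fst p) (snd p) (P \<omega>) \<in> ?C"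
            using \<open>\<omega> \<in> space M\<close> by (intro ins_in_configs10 PC)
          note * = * this
          show "indicator (B - A) p * indicator {\<omega>. P \<omega> \<inter> A = {}} \<omega> =
              (indicator ?X (p, ins (fst p) (snd p) (P \<omega>)) :: ennreal)"
            using * by (auto split: split_indicator)
        qed
        then have "(\<integral>\<^sup>+\<omega>. indicator ?X (p, ins (fst p) (snd p) (P \<omega>)) \<partial>M) =
            (\<integral>\<^sup>+\<omega>. indicator (B - A) p * indicator {\<omega>. P \<omega> \<inter> A = {}} \<omega> \<partial>M)"
          by (intro nn_integral_cong_AE) auto
        also have "\<dots> = (\<integral>\<^sup>+\<omega>. indicator (B - A) p * indicator {\<omega> \<in> space M. P \<omega> \<inter> A = {}} \<omega> \<partial>M)"
          by (rule nn_integral_cong) (auto split: split_indicator)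
        also have "\<dots> = indicator (B - A) p * ?v"
        proof (rule nn_integral_cmult_indicator)
          have "P -` {\<mu> \<in> ?C. \<mu> \<inter> A = {}} \<inter> space M \<in> sets M"
            by (rule measurable_sets[OF P sets_void[OF A]])
          moreover have "P -` {\<mu> \<in> ?C. \<mu> \<inter> A = {}} \<inter> space M = {\<omega> \<in> space M. P \<omega> \<inter> A = {}}"
            using PC by auto
          ultimately show "{\<omega> \<in> space M. P \<omega> \<inter> A = {}} \<in> sets M" by simp
        qed
        finally show ?case by simp
      qed
    qed
    also have "\<dots> = (\<integral>\<^sup>+x. indicator ?X x \<partial>Q)"
      by (rule Q(2)[symmetric]) measurable
    also have "\<dots> = emeasure Q ?X" using X Q(1) by simp
    finally show ?thesis .
  qed
  have RQ: "emeasure R X = emeasure Q X" if "X \<in> ?E" for X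
  proof -
    obtain B A where X: "X = B \<times> {\<mu> \<in> ?C. \<mu> \<inter> A = {}}" and BA: "B \<in> sets borel" "A \<in> sets borel"
      using \<open>X \<in> ?E\<close> by auto
    let ?Y = "\<lambda>n. (B \<inter> disjointed K n) \<times> {\<mu> \<in> ?C. \<mu> \<inter> A = {}}"
    have Kn: "disjointed K n \<in> sets borel" for n
      using sets.range_disjointed_sets[of K borel] K(1) by auto
    have Bn: "B \<inter> disjointed K n \<in> sets borel" for n using Kn BA by auto
    have fin: "emeasure ?\<Lambda> (B \<inter> disjointed K n) < \<infinity>" for n
    proof -
      have "emeasure ?\<Lambda> (B \<inter> disjointed K n) \<le> emeasure ?\<Lambda> (K n)"
        by (rule emeasure_mono) (use disjointed_subset[of K n] K(1) \<Lambda> in auto)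
      then show ?thesis using K(2) by (rule le_less_trans)
    qed
    have "(\<Union>n. disjointed K n) = UNIV"
      unfolding UN_disjointed_eq K_def using ball_cover[where 'a='a] by auto
    then have "B = (\<Union>n. B \<inter> disjointed K n)" by blast
    then have UN: "X = (\<Union>n. ?Y n)" unfolding X by blast
    have disj: "disjoint_family ?Y"
      using disjoint_family_disjointed[of K] by (auto simp: disjoint_family_on_def)
    have "emeasure R X = (\<Sum>n. emeasure R (?Y n))"
      unfolding UN by (rule suminf_emeasure[symmetric]) (use disj R(1) rect Bn BA in auto)
    also have "\<dots> = (\<Sum>n. emeasure Q (?Y n))"
      using RQ_fin[OF Bn fin BA(2)] by simp
    also have "\<dots> = emeasure Q X"
      unfolding UN by (rule suminf_emeasure) (use disj Q(1) rect Bn BA in auto)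
    finally show ?thesis .
  qed
  have "R = Q"
  proof (rule measure_eqI_generator_eq[of ?E "UNIV \<times> ?C" R Q "\<lambda>n. K n \<times> {\<mu> \<in> ?C. \<mu> \<inter> {} = {}}"])
    show "Int_stable ?E"
    proof (rule Int_stableI)
      fix X Y assume "X \<in> ?E" "Y \<in> ?E"
      then obtain B A B' A' where XY: "X = B \<times> {\<mu> \<in> ?C. \<mu> \<inter> A = {}}" "Y = B' \<times> {\<mu> \<in> ?C. \<mu> \<inter> A' = {}}"
        and s: "B \<in> sets borel" "A \<in> sets borel" "B' \<in> sets borel" "A' \<in> sets borel" by auto
      have XY': "X \<inter> Y = (B \<inter> B') \<times> {\<mu> \<in> ?C. \<mu> \<inter> (A \<union> A') = {}}" unfolding XY by auto
      show "X \<inter> Y \<in> ?E"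
        unfolding XY' by (intro CollectI exI conjI, rule refl) (use s in auto)
    qed
    show "sets R = sigma_sets (UNIV \<times> ?C) ?E" "sets Q = sigma_sets (UNIV \<times> ?C) ?E"
      using R(1) Q(1) sets_pair_void[of ?C] by simp_all
    show "range (\<lambda>n. K n \<times> {\<mu> \<in> ?C. \<mu> \<inter> {} = {}}) \<subseteq> ?E"
      by (rule image_subsetI, intro CollectI exI conjI, rule refl) (use K(1) in auto)
    show "(\<Union>n. K n \<times> {\<mu> \<in> ?C. \<mu> \<inter> {} = {}}) = UNIV \<times> ?C"
      using ball_cover[where 'a='a] by (auto simp: K_def)
    show "emeasure R (K n \<times> {\<mu> \<in> ?C. \<mu> \<inter> {} = {}}) \<noteq> \<infinity>" for n
    proof -
      have "emeasure R (K n \<times> {\<mu> \<in> ?C. \<mu> \<inter> {} = {}}) =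
          (\<integral>\<^sup>+x. indicator (K n \<times> {\<mu> \<in> ?C. \<mu> \<inter> {} = {}}) x \<partial>R)"
        using R(1) rect[OF K(1), of "{}"] by simp
      also have "\<dots> = (\<integral>\<^sup>+\<omega>. \<integral>\<^sup>+p. indicator (K n \<times> {\<mu> \<in> ?C. \<mu> \<inter> {} = {}}) (p, P \<omega>) \<partial>count_space (P \<omega>) \<partial>M)"
        by (rule R(2)) (use rect[OF K(1), of "{}"] in measurable)
      also have "\<dots> = (\<integral>\<^sup>+\<omega>. count_on (P \<omega>) (K n) \<partial>M)"
      proof (rule nn_integral_cong)
        fix \<omega> assume "\<omega> \<in> space M"
        then have "indicator (K n \<times> {\<mu> \<in> ?C. \<mu> \<inter> {} = {}}) (p, P \<omega>) = (indicator (K n) p :: ennreal)" for p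
          using PC by (auto split: split_indicator)
        then show "(\<integral>\<^sup>+p. indicator (K n \<times> {\<mu> \<in> ?C. \<mu> \<inter> {} = {}}) (p, P \<omega>) \<partial>count_space (P \<omega>)) =
            count_on (P \<omega>) (K n)"
          by (simp only: nn_integral_count_space_indicator_eq)
      qed
      also have "\<dots> = emeasure ?\<Lambda> (K n)"
        by (rule nn_integral_count_poisson[OF assms(1) P pois \<Lambda> K])
      finally show ?thesis using K(2)[of n] by simp
    qed
  qed (use RQ in auto)
  then show ?thesis using R(2)[OF F] Q(2)[OF F] by simp
qed

section \<open>The vague topology\<close>

text \<open>The zero function is a test function, so taking the whole line for \<open>U\<close> puts
  \<open>configs\<close> itself into the subbase.\<close>

lemma topspace_vague_topology: "topspace vague_topology = (configs :: ('a::euclidean_space \<times> real) set set)"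
proof -
  have test: "vague_test (\<lambda>_::'a \<times> real. 0)"
    unfolding vague_test_def
  proof (intro conjI bexI)
    show "{} \<in> (bounded_family :: ('a \<times> real) set set)"
      unfolding bounded_family_def by (auto intro: exI[of _ "1::real"] exI[of _ "{}"])
    show "bounded ((\<lambda>_::'a \<times> real. 0 :: real) ` score_space)"
      by (rule bounded_subset[of "{0}"]) auto
  qed auto
  let ?S = "{{\<mu> \<in> configs. (\<integral>p. f p \<partial>count_space \<mu>) \<in> U} | f U.
    vague_test (f :: 'a \<times> real \<Rightarrow> real) \<and> open U}"
  have "configs \<in> ?S"
    by (intro CollectI exI[of _ "\<lambda>_. 0"] exI[of _ UNIV]) (simp add: test)
  then have "configs \<subseteq> \<Union>?S" by (rule Union_upper)
  moreover have "\<Union>?S \<subseteq> configs" by auto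
  ultimately show ?thesis
    unfolding vague_topology_def topology_generated_by_topspace by (rule antisym[rotated])
qed

section \<open>Convergence criteria for the vague topology\<close>

lemma vague_testE:
  assumes "vague_test (g :: 'a::euclidean_space \<times> real \<Rightarrow> real)"
  obtains r \<epsilon> where "0 < \<epsilon>" "\<And>t s. 0 < s \<Longrightarrow> g (t, s) \<noteq> 0 \<Longrightarrow> t \<in> ball 0 r \<and> \<epsilon> < s"
    "\<And>t s. 0 < s \<Longrightarrow> isCont g (t, s)"
proof -
  obtain A where A: "A \<in> bounded_family" "{p \<in> score_space. g p \<noteq> 0} \<subseteq> A"
    and cont: "continuous_on score_space g"
    using assms unfolding vague_test_def by auto
  obtain B :: "'a set" and \<epsilon> where B: "bounded B" "0 < \<epsilon>" "A \<subseteq> B \<times> {\<epsilon><..}"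
    using A(1) unfolding bounded_family_def by auto
  obtain r where r: "B \<subseteq> ball 0 r" using B(1) bounded_subset_ballD by blast
  have "open (score_space :: ('a \<times> real) set)"
    unfolding score_space_def by (intro open_Times) auto
  then have "isCont g (t, s)" if "0 < s" for t s
    using cont that by (auto simp: continuous_on_eq_continuous_at score_space_def)
  moreover have "t \<in> ball 0 r \<and> \<epsilon> < s" if "0 < s" "g (t, s) \<noteq> 0" for t s
  proof -
    have "(t, s) \<in> A" using A(2) that by (auto simp: score_space_def)
    then show ?thesis using B(3) r by auto
  qed
  ultimately show thesis using that B(2) by blast
qed

text \<open>Induction over the generation of an open set from the subbase: intersections and unions
  preserve eventual membership, and the subbasic sets are covered by the assumed limits of
  integrals.\<close>

lemma limitin_vague_topologyI:
  fixes \<mu>0 :: "('a::euclidean_space \<times> real) set"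
  assumes "\<mu>0 \<in> configs" and ev: "\<forall>\<^sub>F i in F. \<mu> i \<in> configs"
    and lim: "\<And>g. vague_test g \<Longrightarrow>
      ((\<lambda>i. \<integral>p. g p \<partial>count_space (\<mu> i)) \<longlongrightarrow> (\<integral>p. g p \<partial>count_space \<mu>0)) F"
  shows "limitin vague_topology \<mu> \<mu>0 F"
  unfolding limitin_def topspace_vague_topology
proof (intro conjI allI impI assms(1))
  fix U :: "('a \<times> real) set set" assume U: "openin vague_topology U \<and> \<mu>0 \<in> U"
  let ?S = "{{\<mu> \<in> configs. (\<integral>p. f p \<partial>count_space \<mu>) \<in> U} | f U.
    vague_test (f :: 'a \<times> real \<Rightarrow> real) \<and> open U}"
  have "generate_topology_on ?S U"
    using U unfolding vague_topology_def by (simp add: openin_topology_generated_by)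
  then have "\<mu>0 \<in> U \<longrightarrow> (\<forall>\<^sub>F i in F. \<mu> i \<in> U)"
  proof induct
    case (Int a b)
    then show ?case by (auto intro: eventually_conj)
  next
    case (UN K)
    show ?case
    proof
      assume "\<mu>0 \<in> \<Union>K"
      then obtain k where k: "k \<in> K" "\<mu>0 \<in> k" by auto
      then have "\<forall>\<^sub>F i in F. \<mu> i \<in> k" using UN(2) by blast
      then show "\<forall>\<^sub>F i in F. \<mu> i \<in> \<Union>K" by (rule eventually_mono) (use k in auto)
    qed
  next
    case (Basis s)
    then obtain g V where s: "s = {\<mu> \<in> configs. (\<integral>p. g p \<partial>count_space \<mu>) \<in> V}"
      and g: "vague_test g" "open V" by blast
    show ?case
    proof
      assume "\<mu>0 \<in> s"
      then have "\<forall>\<^sub>F i in F. (\<integral>p. g p \<partial>count_space (\<mu> i)) \<in> V"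
        using lim[OF g(1)] g(2) s by (auto intro: topological_tendstoD)
      with ev show "\<forall>\<^sub>F i in F. \<mu> i \<in> s"
        by eventually_elim (simp add: s)
    qed
  qed simp
  then show "\<forall>\<^sub>F i in F. \<mu> i \<in> U" using U by blast
qed

lemma continuous_map_vague_tendsto:
  assumes "continuous_map vague_topology euclideanreal f" "limitin vague_topology \<mu> \<mu>0 F"
  shows "((\<lambda>i. f (\<mu> i)) \<longlongrightarrow> f \<mu>0) F"
  using continuous_map_limit[OF assms(1,2)] by (simp add: o_def)

lemma continuous_map_vague_integral:
  assumes "vague_test g"
  shows "continuous_map vague_topology euclideanreal (\<lambda>\<mu>. \<integral>p. g p \<partial>count_space \<mu>)"
  unfolding continuous_map_def
proof (intro conjI allI impI)
  fix U :: "real set" assume "openin euclideanreal U"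
  show "openin vague_topology {\<mu> \<in> topspace vague_topology. (\<integral>p. g p \<partial>count_space \<mu>) \<in> U}"
    unfolding topspace_vague_topology unfolding vague_topology_def
    by (rule topology_generated_by_Basis, intro CollectI exI conjI, rule refl)
      (use assms \<open>openin euclideanreal U\<close> in auto)
qed simp

lemma integral_count_space_support:
  fixes g :: "'b \<Rightarrow> real"
  assumes "finite F" "F \<subseteq> \<mu>" "\<And>p. p \<in> \<mu> \<Longrightarrow> p \<notin> F \<Longrightarrow> g p = 0"
  shows "(\<integral>p. g p \<partial>count_space \<mu>) = (\<Sum>p\<in>F. g p)"
proof -
  have sub: "{p \<in> \<mu>. g p \<noteq> 0} \<subseteq> F" using assms(3) by auto
  have "(\<integral>p. g p \<partial>count_space \<mu>) = (\<Sum>p | p \<in> \<mu> \<and> g p \<noteq> 0. g p)"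
    by (rule lebesgue_integral_count_space_finite_support) (rule finite_subset[OF sub assms(1)])
  also have "\<dots> = (\<Sum>p\<in>F. g p)"
    by (rule sum.mono_neutral_left) (use assms sub in auto)
  finally show ?thesis .
qed

text \<open>The configurations compared in a limit share their positions and differ in their scores;
  as graphs over a fixed set they converge as soon as the scores do. Positions whose score is not
  positive are dropped, in line with the convention for spectral configurations.\<close>

definition graph_config :: "'a set \<Rightarrow> ('a \<Rightarrow> real) \<Rightarrow> ('a \<times> real) set" where
  "graph_config I \<phi> = {(t, \<phi> t) | t. t \<in> I \<and> 0 < \<phi> t}"

lemma graph_config_in_configs10:
  "I \<in> ground_configs \<Longrightarrow> graph_config I \<phi> \<in> configs10"
proof -
  assume I: "I \<in> ground_configs"
  have "finite ((\<lambda>t. (t, \<phi> t)) ` (I \<inter> ball 0 r))" for r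
    using I by (simp add: ground_configs_iff)
  moreover have "graph_config I \<phi> \<inter> (ball 0 r \<times> UNIV) \<subseteq> (\<lambda>t. (t, \<phi> t)) ` (I \<inter> ball 0 r)" for r
    by (auto simp: graph_config_def)
  ultimately have "finite (graph_config I \<phi> \<inter> (ball 0 r \<times> UNIV))" for r
    by (meson finite_subset)
  then show ?thesis by (simp add: configs10_iff simple_config_iff graph_config_def)
qed

lemma graph_config_in_configs: "I \<in> ground_configs \<Longrightarrow> graph_config I \<phi> \<in> configs"
  using graph_config_in_configs10 configs10_subset by blast

text \<open>A test function sees only the finitely many positions in one ball, so its integral is a
  finite sum and convergence of each score suffices. A score whose limit is not positive eventually
  falls below the level under which the test function vanishes.\<close>

lemma limitin_graph_config:
  fixes I :: "'a::euclidean_space set"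
  assumes I: "I \<in> ground_configs"
    and lim: "\<And>t. t \<in> I \<Longrightarrow> ((\<lambda>i. \<psi> i t) \<longlongrightarrow> \<phi> t) F"
  shows "limitin vague_topology (\<lambda>i. graph_config I (\<psi> i)) (graph_config I \<phi>) F"
proof (rule limitin_vague_topologyI)
  fix g :: "'a \<times> real \<Rightarrow> real" assume "vague_test g"
  then obtain r \<epsilon> where g: "0 < \<epsilon>" "\<And>t s. 0 < s \<Longrightarrow> g (t, s) \<noteq> 0 \<Longrightarrow> t \<in> ball 0 r \<and> \<epsilon> < s"
    "\<And>t s. 0 < s \<Longrightarrow> isCont g (t, s)" by (rule vague_testE) blast
  have fin: "finite (I \<inter> ball 0 r)" using I by (simp add: ground_configs_iff)
  have int: "(\<integral>p. g p \<partial>count_space (graph_config I \<rho>)) =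
      (\<Sum>t\<in>I \<inter> ball 0 r. if 0 < \<rho> t then g (t, \<rho> t) else 0)" for \<rho>
  proof -
    let ?J = "{t \<in> I \<inter> ball 0 r. 0 < \<rho> t}"
    have "(\<integral>p. g p \<partial>count_space (graph_config I \<rho>)) = (\<Sum>p\<in>(\<lambda>t. (t, \<rho> t)) ` ?J. g p)"
    proof (rule integral_count_space_support)
      show "finite ((\<lambda>t. (t, \<rho> t)) ` ?J)"
        by (rule finite_imageI, rule finite_subset[OF _ fin]) auto
    qed (use g(2) in \<open>auto simp: graph_config_def\<close>)
    also have "\<dots> = (\<Sum>t\<in>?J. g (t, \<rho> t))"
      by (subst sum.reindex) (auto simp: inj_on_def)
    also have "\<dots> = (\<Sum>t\<in>I \<inter> ball 0 r. if 0 < \<rho> t then g (t, \<rho> t) else 0)"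
      using fin by (rule sum.inter_filter)
    finally show ?thesis .
  qed
  have "((\<lambda>i. if 0 < \<psi> i t then g (t, \<psi> i t) else 0) \<longlongrightarrow> (if 0 < \<phi> t then g (t, \<phi> t) else 0)) F"
    if t: "t \<in> I" for t
  proof (cases "0 < \<phi> t")
    case True
    have "\<forall>\<^sub>F i in F. 0 < \<psi> i t" by (rule order_tendstoD(1)[OF lim[OF t] True])
    then have "\<forall>\<^sub>F i in F. g (t, \<psi> i t) = (if 0 < \<psi> i t then g (t, \<psi> i t) else 0)"
      by eventually_elim simp
    moreover have "((\<lambda>i. g (t, \<psi> i t)) \<longlongrightarrow> g (t, \<phi> t)) F"
      by (rule isCont_tendsto_compose[OF g(3)[OF True]]) (intro tendsto_Pair tendsto_const lim t)
    ultimately show ?thesis using True by (simp add: Lim_transform_eventually)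
  next
    case False
    then have "\<phi> t < \<epsilon>" using g(1) by linarith
    then have "\<forall>\<^sub>F i in F. \<psi> i t < \<epsilon>" by (rule order_tendstoD(2)[OF lim[OF t]])
    then have "\<forall>\<^sub>F i in F. 0 = (if 0 < \<psi> i t then g (t, \<psi> i t) else 0)"
      by eventually_elim (use g(2) in force)
    then show ?thesis using False by (auto intro: Lim_transform_eventually[OF tendsto_const])
  qed
  then show "((\<lambda>i. \<integral>p. g p \<partial>count_space (graph_config I (\<psi> i))) \<longlongrightarrow>
      (\<integral>p. g p \<partial>count_space (graph_config I \<phi>))) F"
    unfolding int by (intro tendsto_sum) auto
qed (simp_all add: graph_config_in_configs[OF I])

section \<open>Approximation of configurations and measurability of vaguely continuous
  functions\<close>

definition exhaust :: "nat \<Rightarrow> ('a::euclidean_space \<times> real) set" where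
  "exhaust k = ball 0 (real k) \<times> {inverse (real (Suc k))<..}"

lemma open_exhaust: "open (exhaust k)"
  unfolding exhaust_def by (intro open_Times) auto

lemma eventually_exhaust:
  assumes "0 < \<epsilon>"
  shows "\<forall>\<^sub>F k in sequentially. ball 0 r \<times> {\<epsilon><..} \<subseteq> (exhaust k :: ('a::euclidean_space \<times> real) set)"
proof -
  have "(\<lambda>k. inverse (real (Suc k))) \<longlonglongrightarrow> 0" by (rule LIMSEQ_inverse_real_of_nat)
  then have "\<forall>\<^sub>F k in sequentially. inverse (real (Suc k)) < \<epsilon>"
    by (rule order_tendstoD(2)) (rule assms)
  moreover have "\<forall>\<^sub>F k in sequentially. r \<le> real k"
    using filterlim_real_sequentially by (simp add: filterlim_at_top)
  ultimately show ?thesis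
  proof eventually_elim
    case (elim k)
    then show ?case
      unfolding exhaust_def
      by (intro Sigma_mono subset_ball) auto
  qed
qed

lemma finite_exhaust: "\<mu> \<in> configs \<Longrightarrow> finite (\<mu> \<inter> exhaust k)"
  by (auto simp: configs_iff exhaust_def)

lemma UN_exhaust:
  assumes "\<mu> \<in> configs"
  shows "\<mu> \<subseteq> (\<Union>k. exhaust k)"
proof
  fix p assume p: "p \<in> \<mu>"
  obtain t s where ts: "p = (t, s)" by (cases p)
  have s: "0 < s" using assms p ts by (auto simp: configs_iff simple_config_iff)
  obtain k where k: "ball (0::'a) (norm t + 1) \<times> {s / 2<..} \<subseteq> exhaust k"
    using eventually_exhaust[of "s/2" "norm t + 1"] s by (auto simp: eventually_sequentially)
  have "p \<in> ball 0 (norm t + 1) \<times> {s / 2<..}" using s by (simp add: ts)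
  then have "p \<in> exhaust k" by (rule subsetD[OF k])
  then show "p \<in> (\<Union>k. exhaust k)" by (rule UN_I[OF UNIV_I])
qed

lemma configs_subset: "\<mu> \<in> configs \<Longrightarrow> \<nu> \<subseteq> \<mu> \<Longrightarrow> \<nu> \<in> configs"
proof -
  assume \<mu>: "\<mu> \<in> configs" and sub: "\<nu> \<subseteq> \<mu>"
  have "finite (\<nu> \<inter> (ball 0 r \<times> {\<epsilon><..}))" if "0 < \<epsilon>" for r \<epsilon>
  proof -
    have "finite (\<mu> \<inter> (ball 0 r \<times> {\<epsilon><..}))" using \<mu> that by (simp add: configs_iff)
    then show ?thesis by (rule rev_finite_subset) (use sub in auto)
  qed
  moreover have "simple_config \<nu>"
    using \<mu> sub unfolding configs_iff simple_config_iff by (meson subsetD)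
  ultimately show ?thesis by (simp add: configs_iff)
qed

text \<open>The integral of a fixed test function is eventually constant, since the region where it
  is nonzero is eventually contained in \<open>exhaust k\<close>.\<close>

lemma limitin_exhaust:
  assumes \<mu>: "\<mu> \<in> configs"
  shows "limitin vague_topology (\<lambda>k. \<mu> \<inter> exhaust k) \<mu> sequentially"
proof (rule limitin_vague_topologyI)
  fix g :: "'a \<times> real \<Rightarrow> real" assume "vague_test g"
  then obtain r \<epsilon> where g: "0 < \<epsilon>" "\<And>t s. 0 < s \<Longrightarrow> g (t, s) \<noteq> 0 \<Longrightarrow> t \<in> ball 0 r \<and> \<epsilon> < s"
    by (rule vague_testE) blast
  let ?F = "\<mu> \<inter> (ball 0 r \<times> {\<epsilon><..})"
  have F: "finite ?F" using \<mu> g(1) by (simp add: configs_iff)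
  have pos: "0 < s" if "(t, s) \<in> \<mu>" for t s
    using \<mu> that by (auto simp: configs_iff simple_config_iff)
  have zero: "g p = 0" if "p \<in> \<mu>" "p \<notin> ?F" for p
    using that pos g(2) by (cases p) auto
  have ex: "\<forall>\<^sub>F k in sequentially. ball (0::'a) r \<times> {\<epsilon><..} \<subseteq> exhaust k"
    by (rule eventually_exhaust[OF g(1)])
  have "\<forall>\<^sub>F k in sequentially. (\<integral>p. g p \<partial>count_space \<mu>) = (\<integral>p. g p \<partial>count_space (\<mu> \<inter> exhaust k))"
    using ex
  proof eventually_elim
    case (elim k)
    have "(\<integral>p. g p \<partial>count_space \<mu>) = (\<Sum>p\<in>?F. g p)"
      by (rule integral_count_space_support[OF F]) (use zero in auto)
    also have "\<dots> = (\<integral>p. g p \<partial>count_space (\<mu> \<inter> exhaust k))"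
      by (rule integral_count_space_support[OF F, symmetric]) (use elim zero in auto)
    finally show ?case .
  qed
  then show "(\<lambda>k. \<integral>p. g p \<partial>count_space (\<mu> \<inter> exhaust k)) \<longlonglongrightarrow> (\<integral>p. g p \<partial>count_space \<mu>)"
    by (rule Lim_transform_eventually[OF tendsto_const])
qed (use configs_subset[OF \<mu>] \<mu> in auto)

text \<open>Finitely many points are displaced by vanishing amounts: eventually scores stay positive
  and distinct positions stay distinct, so the images are configurations and sums over them converge
  by continuity.\<close>

lemma limitin_image_config:
  fixes \<mu> :: "('a::euclidean_space \<times> real) set"
  assumes \<mu>: "\<mu> \<in> configs" "finite \<mu>" and G: "\<And>p. p \<in> \<mu> \<Longrightarrow> (\<lambda>n. G n p) \<longlonglongrightarrow> p"
  shows "\<forall>\<^sub>F n in sequentially. G n ` \<mu> \<in> configs"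
    and "limitin vague_topology (\<lambda>n. G n ` \<mu>) \<mu> sequentially"
proof -
  have pos: "0 < snd p" if "p \<in> \<mu>" for p
    using \<mu> that by (cases p) (auto simp: configs_iff simple_config_iff)
  have ne: "fst p \<noteq> fst q" if "p \<in> \<mu>" "q \<in> \<mu>" "p \<noteq> q" for p q
    using \<mu> that by (cases p, cases q) (auto simp: configs_iff simple_config_iff)
  have "\<forall>\<^sub>F n in sequentially. 0 < snd (G n p)" if "p \<in> \<mu>" for p
    by (rule order_tendstoD(1)[OF tendsto_snd[OF G[OF that]] pos[OF that]])
  then have e1: "\<forall>\<^sub>F n in sequentially. \<forall>p\<in>\<mu>. 0 < snd (G n p)"
    using \<mu>(2) by (simp add: eventually_ball_finite)
  have "\<forall>\<^sub>F n in sequentially. p \<noteq> q \<longrightarrow> fst (G n p) \<noteq> fst (G n q)" if pq: "p \<in> \<mu>" "q \<in> \<mu>" for p q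
  proof (cases "p = q")
    case False
    have "(\<lambda>n. fst (G n p) - fst (G n q)) \<longlonglongrightarrow> fst p - fst q"
      by (intro tendsto_diff tendsto_fst G pq)
    then have "\<forall>\<^sub>F n in sequentially. fst (G n p) - fst (G n q) \<noteq> 0"
      by (rule tendsto_imp_eventually_ne) (use ne[OF pq False] in simp)
    then show ?thesis by eventually_elim auto
  qed simp
  then have e2: "\<forall>\<^sub>F n in sequentially. \<forall>p\<in>\<mu>. \<forall>q\<in>\<mu>. p \<noteq> q \<longrightarrow> fst (G n p) \<noteq> fst (G n q)"
    using \<mu>(2) by (simp add: eventually_ball_finite)
  show ev: "\<forall>\<^sub>F n in sequentially. G n ` \<mu> \<in> configs"
    using e1 e2
  proof eventually_elim
    case (elim n)
    have "simple_config (G n ` \<mu>)"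
      unfolding simple_config_iff
    proof (intro conjI allI impI)
      fix t s assume "(t, s) \<in> G n ` \<mu>"
      then obtain p where "p \<in> \<mu>" "(t, s) = G n p" by auto
      then show "0 < s" using elim(1) by (metis snd_conv)
    next
      fix t s s' assume "(t, s) \<in> G n ` \<mu>" "(t, s') \<in> G n ` \<mu>"
      then obtain p q where pq: "p \<in> \<mu>" "q \<in> \<mu>" "(t, s) = G n p" "(t, s') = G n q" by auto
      then have "fst (G n p) = fst (G n q)" by (metis fst_conv)
      then have "p = q" using elim(2) pq by auto
      then show "s = s'" using pq by (metis prod.inject)
    qed
    then show ?case using \<mu>(2) by (simp add: configs_iff)
  qed
  show "limitin vague_topology (\<lambda>n. G n ` \<mu>) \<mu> sequentially"
  proof (rule limitin_vague_topologyI[OF \<mu>(1) ev])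
    fix g :: "'a \<times> real \<Rightarrow> real" assume "vague_test g"
    then obtain r \<epsilon> where g: "\<And>t s. 0 < s \<Longrightarrow> isCont g (t, s)" by (rule vague_testE) blast
    have "\<forall>\<^sub>F n in sequentially. (\<Sum>p\<in>\<mu>. g (G n p)) = (\<integral>p. g p \<partial>count_space (G n ` \<mu>))"
      using e2
    proof eventually_elim
      case (elim n)
      then have "inj_on (G n) \<mu>" by (metis inj_onI)
      then have "(\<Sum>p\<in>\<mu>. g (G n p)) = (\<Sum>p\<in>G n ` \<mu>. g p)" by (simp add: sum.reindex)
      also have "\<dots> = (\<integral>p. g p \<partial>count_space (G n ` \<mu>))"
        by (rule integral_count_space_support[symmetric]) (use \<mu> in auto)
      finally show ?case .
    qed
    moreover have "(\<lambda>n. \<Sum>p\<in>\<mu>. g (G n p)) \<longlonglongrightarrow> (\<Sum>p\<in>\<mu>. g p)"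
    proof (intro tendsto_sum)
      fix p assume p: "p \<in> \<mu>"
      then have "isCont g p" using g[of "snd p" "fst p"] pos by simp
      then show "(\<lambda>n. g (G n p)) \<longlonglongrightarrow> g p" by (rule isCont_tendsto_compose) (rule G[OF p])
    qed
    moreover have "(\<Sum>p\<in>\<mu>. g p) = (\<integral>p. g p \<partial>count_space \<mu>)"
      by (rule integral_count_space_support[symmetric]) (use \<mu> in auto)
    ultimately show "(\<lambda>n. \<integral>p. g p \<partial>count_space (G n ` \<mu>)) \<longlonglongrightarrow> (\<integral>p. g p \<partial>count_space \<mu>)"
      by (simp add: Lim_transform_eventually)
  qed
qed

text \<open>
  The vague topology enters only through convergent sequences: a configuration is the iterated
  limit of restrictions and of discretisations taking finitely many values.
\<close>

lemma borel_measurable_vague_continuous: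
  fixes f :: "('a::euclidean_space \<times> real) set \<Rightarrow> real"
  assumes f: "continuous_map vague_topology euclideanreal f"
  shows "f \<in> borel_measurable (config_algebra configs)"
proof -
  have "\<exists>G. (\<forall>n. simple_function (borel :: ('a \<times> real) measure) (G n)) \<and>
      (\<forall>p\<in>space borel. (\<lambda>n. G n p) \<longlonglongrightarrow> p) \<and> (\<forall>n. \<forall>p\<in>space borel. dist (G n p) 0 \<le> 2 * dist p 0)"
    by (rule borel_measurable_implies_sequence_metric) simp
  then obtain G :: "nat \<Rightarrow> 'a \<times> real \<Rightarrow> 'a \<times> real" where
    G: "\<And>n. simple_function borel (G n)" "\<And>p. (\<lambda>n. G n p) \<longlonglongrightarrow> p"
    by auto
  \<comment> \<open>A coarse discretisation may merge positions or produce scores that are not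
    positive; such values are replaced by the empty set, which does not affect the limit.\<close>
  define \<Psi> where "\<Psi> S = f (if S \<in> configs then S else {})" for S
  have step: "(\<lambda>\<mu>. \<Psi> (G n ` (\<mu> \<inter> exhaust k))) \<in> borel_measurable (config_algebra configs)" for n k
  proof -
    let ?R = "range (G n)"
    have R: "finite ?R" using simple_functionD(1)[OF G(1)] by simp
    have pre: "G n -` {q} \<in> sets borel" for q
      using simple_functionD(2)[OF G(1), of n "{q}"] by simp
    \<comment> \<open>The discretised set takes finitely many values, so it is enough to know the
      events that a given value occurs, and these are described by void events.\<close>
    have "(\<lambda>\<mu>. G n ` (\<mu> \<inter> exhaust k)) \<in> config_algebra configs \<rightarrow>\<^sub>M count_space (Pow ?R)"
      unfolding measurable_count_space_eq2[OF finite_Pow_iff[THEN iffD2, OF R]]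
    proof (intro conjI ballI)
      fix S assume S: "S \<in> Pow ?R"
      have "{\<mu> \<in> configs. \<mu> \<inter> (exhaust k \<inter> G n -` {q}) = {}} \<in> sets (config_algebra configs)" for q
        by (rule sets_void) (intro sets.Int pre borel_open open_exhaust)
      then have [measurable]: "Measurable.pred (config_algebra configs)
          (\<lambda>\<mu>. \<mu> \<inter> (exhaust k \<inter> G n -` {q}) = {})" for q
        by (simp add: pred_def)
      have "Measurable.pred (config_algebra configs)
          (\<lambda>\<mu>. \<forall>q\<in>?R. q \<in> S \<longleftrightarrow> \<mu> \<inter> (exhaust k \<inter> G n -` {q}) \<noteq> {})"
        using R by measurable
      moreover have mem: "q \<in> G n ` (\<mu> \<inter> exhaust k) \<longleftrightarrow> \<mu> \<inter> (exhaust k \<inter> G n -` {q}) \<noteq> {}" for q \<mu>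
        unfolding image_iff by blast
      have "G n ` (\<mu> \<inter> exhaust k) = S \<longleftrightarrow>
          (\<forall>q\<in>?R. q \<in> S \<longleftrightarrow> \<mu> \<inter> (exhaust k \<inter> G n -` {q}) \<noteq> {})" for \<mu>
        unfolding mem[symmetric] using S by blast
      ultimately show "(\<lambda>\<mu>. G n ` (\<mu> \<inter> exhaust k)) -` {S} \<inter> space (config_algebra configs)
          \<in> sets (config_algebra configs)"
        by (simp add: pred_def vimage_def Int_def conj_commute)
    qed auto
    then show ?thesis
      by (rule measurable_compose[where g=\<Psi>]) simp
  qed
  have lim1: "(\<lambda>n. \<Psi> (G n ` (\<mu> \<inter> exhaust k))) \<longlonglongrightarrow> f (\<mu> \<inter> exhaust k)" if \<mu>: "\<mu> \<in> configs" for \<mu> k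
  proof -
    have "\<mu> \<inter> exhaust k \<in> configs" using configs_subset[OF \<mu>] by auto
    note lim = limitin_image_config[OF this finite_exhaust[OF \<mu>] G(2)]
    have "\<forall>\<^sub>F n in sequentially. f (G n ` (\<mu> \<inter> exhaust k)) = \<Psi> (G n ` (\<mu> \<inter> exhaust k))"
      using lim(1) by eventually_elim (simp add: \<Psi>_def)
    then show ?thesis
      by (rule Lim_transform_eventually[OF continuous_map_vague_tendsto[OF f lim(2)]])
  qed
  have "(\<lambda>\<mu>. f (\<mu> \<inter> exhaust k)) \<in> borel_measurable (config_algebra configs)" for k
    by (rule borel_measurable_LIMSEQ_real[OF _ step[of _ k]]) (use lim1 in auto)
  then show ?thesis
    by (rule borel_measurable_LIMSEQ_real[rotated])
      (use continuous_map_vague_tendsto[OF f limitin_exhaust] in auto)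
qed

text \<open>The indicator of an open set is the pointwise limit of truncated multiples of the
  distance to its complement; intersecting with \<open>exhaust k\<close> turns these functions into
  test functions.\<close>

lemma count_on_exhaust_eq_lim:
  fixes U :: "('a::euclidean_space \<times> real) set"
  assumes U: "open U"
  obtains g where "\<And>n. vague_test (g n)"
    "\<And>\<mu>. \<mu> \<in> configs \<Longrightarrow>
      (\<lambda>n. \<integral>p. g n p \<partial>count_space \<mu>) \<longlonglongrightarrow> real (card (\<mu> \<inter> (exhaust k \<inter> U)))"
proof -
  define W where "W = exhaust k \<inter> U"
  have W: "open W" unfolding W_def by (intro open_Int open_exhaust U)
  \<comment> \<open>The distance \<open>infdist\<close> to the empty set is 0 by convention, so the
    complement of \<open>W\<close> must be shown to be nonempty; the origin with score 0 is in
    it.\<close>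
  have "(0, 0) \<notin> W" by (simp add: W_def exhaust_def)
  then have ne: "- W \<noteq> {}" by auto
  define g where "g n p = min 1 (real n * infdist p (- W))" for n p
  have g0: "p \<in> W" if "g n p \<noteq> 0" for n p
  proof (rule ccontr)
    assume "p \<notin> W"
    then have "infdist p (- W) = 0" by simp
    then show False using that by (simp add: g_def)
  qed
  have lim: "(\<lambda>n. g n p) \<longlonglongrightarrow> indicator W p" for p
  proof (cases "p \<in> W")
    case True
    have "infdist p (- W) > 0"
      using True W ne by (simp add: infdist_pos_not_in_closed closed_Compl)
    then have "\<forall>\<^sub>F n in sequentially. 1 / infdist p (- W) \<le> real n"
      using filterlim_real_sequentially by (simp add: filterlim_at_top)
    then have "\<forall>\<^sub>F n in sequentially. 1 = g n p"
      by eventually_elim (use \<open>infdist p (- W) > 0\<close> in \<open>simp add: g_def field_simps\<close>)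
    then show ?thesis using True by (simp add: Lim_transform_eventually[OF tendsto_const])
  next
    case False
    then have "g n p = 0" for n using g0 by blast
    then show ?thesis using False by simp
  qed
  show thesis
  proof (rule that[of g])
    fix n
    show "vague_test (g n)"
      unfolding vague_test_def
    proof (intro conjI bexI)
      show "continuous_on score_space (g n)"
        unfolding g_def by (intro continuous_intros)
      have "0 \<le> g n p" "g n p \<le> 1" for p by (auto simp: g_def infdist_nonneg)
      then show "bounded (g n ` score_space)"
        by (intro bounded_subset[OF bounded_closed_interval[of 0 1]]) auto
      show "{p \<in> score_space. g n p \<noteq> 0} \<subseteq> exhaust k"
        using g0 by (auto simp: W_def)
      show "exhaust k \<in> bounded_family"
        unfolding exhaust_def by (rule bounded_family_ball) simp
    qed
  next
    fix \<mu> :: "('a \<times> real) set" assume \<mu>: "\<mu> \<in> configs"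
    have fin: "finite (\<mu> \<inter> exhaust k)" by (rule finite_exhaust[OF \<mu>])
    have "(\<integral>p. g n p \<partial>count_space \<mu>) = (\<Sum>p\<in>\<mu> \<inter> exhaust k. g n p)" for n
      by (rule integral_count_space_support[OF fin]) (use g0 in \<open>auto simp: W_def\<close>)
    moreover have "(\<lambda>n. \<Sum>p\<in>\<mu> \<inter> exhaust k. g n p) \<longlonglongrightarrow> (\<Sum>p\<in>\<mu> \<inter> exhaust k. indicator W p)"
      by (intro tendsto_sum lim)
    moreover have "(\<Sum>p\<in>\<mu> \<inter> exhaust k. indicator W p :: real) = real (card (\<mu> \<inter> (exhaust k \<inter> U)))"
    proof -
      have "(\<Sum>p\<in>\<mu> \<inter> exhaust k. indicator W p :: real) = real (card ((\<mu> \<inter> exhaust k) \<inter> W))"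
        using sum.inter_restrict[OF fin, of "\<lambda>_. 1::real" W]
        by (simp add: indicator_def of_bool_def)
      then show ?thesis by (simp add: W_def Int_assoc[symmetric] Int_absorb2)
    qed
    ultimately show "(\<lambda>n. \<integral>p. g n p \<partial>count_space \<mu>) \<longlonglongrightarrow> real (card (\<mu> \<inter> (exhaust k \<inter> U)))"
      by simp
  qed
qed

text \<open>Open sets form an intersection-stable generator of the Borel sets; finite counts on
  \<open>exhaust k\<close> allow the subtraction in the complement step.\<close>

lemma count_on_measurable_if_open:
  fixes N :: "('a::euclidean_space \<times> real) set measure"
  assumes sp: "space N = configs"
    and U: "\<And>U. open U \<Longrightarrow> (\<lambda>\<mu>. count_on \<mu> (exhaust k \<inter> U)) \<in> borel_measurable N"
    and B: "B \<in> sets borel"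
  shows "(\<lambda>\<mu>. count_on \<mu> (exhaust k \<inter> B)) \<in> borel_measurable N"
proof -
  have B': "B \<in> sigma_sets UNIV {S. open S}" using B by (simp add: borel_def)
  have int: "Int_stable {S :: ('a \<times> real) set. open S}" by (auto simp: Int_stable_def)
  have sub: "{S :: ('a \<times> real) set. open S} \<subseteq> Pow UNIV" by simp
  from int sub B' show ?thesis
  proof (induct rule: sigma_sets_induct_disjoint)
    case (basic A)
    then show ?case using U by simp
  next
    case empty
    then show ?case by (simp add: count_on_def)
  next
    case (compl A)
    have "count_on \<mu> (exhaust k \<inter> (UNIV - A)) =
        count_on \<mu> (exhaust k \<inter> UNIV) - count_on \<mu> (exhaust k \<inter> A)" if \<mu>: "\<mu> \<in> configs" for \<mu>
    proof -
      have fin: "finite (\<mu> \<inter> (exhaust k \<inter> A))"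
        by (rule finite_subset[OF _ finite_exhaust[OF \<mu>, of k]]) auto
      have "\<mu> \<inter> (exhaust k \<inter> (UNIV - A)) = (\<mu> \<inter> (exhaust k \<inter> UNIV)) - (\<mu> \<inter> (exhaust k \<inter> A))" by auto
      then show ?thesis
        unfolding count_on_def by (simp only:) (rule emeasure_Diff, use fin in auto)
    qed
    then have "(\<lambda>\<mu>. count_on \<mu> (exhaust k \<inter> (UNIV - A))) \<in> borel_measurable N \<longleftrightarrow>
        (\<lambda>\<mu>. count_on \<mu> (exhaust k \<inter> UNIV) - count_on \<mu> (exhaust k \<inter> A)) \<in> borel_measurable N"
      by (intro measurable_cong) (simp add: sp)
    then show ?case using U[OF open_UNIV] compl by (simp only:) (rule borel_measurable_minus_ennreal)
  next
    case (union A)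
    have "count_on \<mu> (exhaust k \<inter> (\<Union>i. A i)) = (\<Sum>i. count_on \<mu> (exhaust k \<inter> A i))" for \<mu>
    proof -
      have "(\<Sum>i. count_on \<mu> (exhaust k \<inter> A i)) =
          emeasure (count_space UNIV) (\<Union>i. \<mu> \<inter> (exhaust k \<inter> A i))"
        unfolding count_on_def
        by (rule suminf_emeasure) (use union(1) in \<open>auto simp: disjoint_family_on_def\<close>)
      also have "(\<Union>i. \<mu> \<inter> (exhaust k \<inter> A i)) = \<mu> \<inter> (exhaust k \<inter> (\<Union>i. A i))" by auto
      finally show ?thesis by (simp add: count_on_def)
    qed
    then show ?case using union by simp
  qed
qed

text \<open>Links topology and measure on \<open>configs\<close>: counts on open sets are limits of
  integrals of test functions, and these integrals are measurable in turn. Finite families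
  \<open>J\<close> make the generator stable under intersection.\<close>

lemma sets_config_algebra_vague:
  "sets (config_algebra configs) = sigma_sets configs
    {{\<mu> \<in> configs. \<forall>(g, a)\<in>J. a < (\<integral>p. g p \<partial>count_space \<mu>)} | J.
      finite J \<and> (\<forall>(g, a)\<in>J. vague_test (g :: 'a::euclidean_space \<times> real \<Rightarrow> real))}"
  (is "?S = sigma_sets configs ?E")
proof
  have E: "?E \<subseteq> Pow configs" by auto
  let ?N = "sigma configs ?E"
  have sp: "space ?N = configs" by (rule space_measure_of[OF E])
  have st: "sets ?N = sigma_sets configs ?E" by (rule sets_measure_of[OF E])
  have int: "(\<lambda>\<mu>. \<integral>p. g p \<partial>count_space \<mu>) \<in> borel_measurable ?N"
    if g: "vague_test g" for g :: "'a \<times> real \<Rightarrow> real"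
    unfolding borel_measurable_iff_greater
  proof
    fix a
    have "{\<mu> \<in> configs. \<forall>(g, a)\<in>{(g, a)}. a < (\<integral>p. g p \<partial>count_space \<mu>)} \<in> ?E"
      by (rule CollectI, rule exI[of _ "{(g, a)}"]) (use g in simp)
    then show "{\<mu> \<in> space ?N. a < (\<integral>p. g p \<partial>count_space \<mu>)} \<in> sets ?N"
      unfolding sp st by (auto intro: sigma_sets.Basic)
  qed
  have open_meas: "(\<lambda>\<mu>. count_on \<mu> (exhaust k \<inter> U)) \<in> borel_measurable ?N"
    if U: "open U" for U :: "('a \<times> real) set" and k
  proof -
    obtain g where g: "\<And>n. vague_test (g n)" "\<And>\<mu>. \<mu> \<in> configs \<Longrightarrow>
        (\<lambda>n. \<integral>p. g n p \<partial>count_space \<mu>) \<longlonglongrightarrow> real (card (\<mu> \<inter> (exhaust k \<inter> U)))"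
      using count_on_exhaust_eq_lim[OF U] by blast
    have "(\<lambda>\<mu>. real (card (\<mu> \<inter> (exhaust k \<inter> U)))) \<in> borel_measurable ?N"
      by (rule borel_measurable_LIMSEQ_real[OF g(2) int[OF g(1)]]) (simp only: sp)
    then have "(\<lambda>\<mu>. ennreal (real (card (\<mu> \<inter> (exhaust k \<inter> U))))) \<in> borel_measurable ?N"
      by (rule measurable_compose[OF _ measurable_ennreal])
    moreover have "count_on \<mu> (exhaust k \<inter> U) = ennreal (real (card (\<mu> \<inter> (exhaust k \<inter> U))))"
      if \<mu>: "\<mu> \<in> configs" for \<mu>
    proof -
      have "finite (\<mu> \<inter> (exhaust k \<inter> U))"
        by (rule finite_subset[OF _ finite_exhaust[OF \<mu>, of k]]) auto
      then show ?thesis by (simp add: count_on_finite ennreal_of_nat_eq_real_of_nat)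
    qed
    ultimately show ?thesis
      by (subst measurable_cong) (auto simp only: sp)
  qed
  \<comment> \<open>Measurability of the identity between the two algebras is the inclusion of one
    in the other.\<close>
  have "(\<lambda>\<mu>. \<mu>) \<in> ?N \<rightarrow>\<^sub>M config_algebra configs"
  proof (rule measurable_config_algebraI)
    fix B :: "('a \<times> real) set" assume B: "B \<in> sets borel"
    have [measurable]: "(\<lambda>\<mu>. count_on \<mu> (exhaust k \<inter> B)) \<in> borel_measurable ?N" for k
      by (rule count_on_measurable_if_open[OF sp open_meas B])
    have "{\<mu> \<in> space ?N. \<forall>k. count_on \<mu> (exhaust k \<inter> B) = 0} \<in> sets ?N" by measurable
    moreover have "(\<forall>k. count_on \<mu> (exhaust k \<inter> B) = 0) \<longleftrightarrow> \<mu> \<inter> B = {}" if "\<mu> \<in> space ?N" for \<mu>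
      unfolding count_on_eq_0_iff using UN_exhaust[of \<mu>] that unfolding sp by blast
    ultimately show "{\<mu> \<in> space ?N. \<mu> \<inter> B = {}} \<in> sets ?N"
      by (simp cong: conj_cong)
  qed (simp only: sp)
  note id = this
  show "?S \<subseteq> sigma_sets configs ?E"
  proof
    fix X assume X: "X \<in> ?S"
    then have "(\<lambda>\<mu>. \<mu>) -` X \<inter> configs = X" using sets.sets_into_space[OF X] by auto
    then show "X \<in> sigma_sets configs ?E"
      using measurable_sets[OF id X] by (simp only: sp st)
  qed
  have "sigma_sets (space (config_algebra configs)) ?E \<subseteq> ?S"
  proof (rule sets.sigma_sets_subset, safe)
    fix J :: "(('a \<times> real \<Rightarrow> real) \<times> real) set"
    assume J: "finite J" "\<forall>(g, a)\<in>J. vague_test g"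
    have "(\<Inter>j\<in>J. {\<mu> \<in> space (config_algebra configs). snd j < (\<integral>p. fst j p \<partial>count_space \<mu>)})
        \<inter> configs \<in> sets (config_algebra configs)"
    proof (cases "J = {}")
      case True
      then show ?thesis using sets.top[of "config_algebra configs"] by simp
    next
      case False
      have "{\<mu> \<in> space (config_algebra configs). snd j < (\<integral>p. fst j p \<partial>count_space \<mu>)}
          \<in> sets (config_algebra configs)" if "j \<in> J" for j
      proof -
        have "vague_test (fst j)" using J(2) that by auto
        from borel_measurable_vague_continuous[OF continuous_map_vague_integral[OF this]]
        show ?thesis by measurable
      qed
      then show ?thesis using sets.top[of "config_algebra configs"] J(1) False
        by (intro sets.Int sets.finite_INT) auto
    qed
    moreover have "(\<Inter>j\<in>J. {\<mu> \<in> space (config_algebra configs). snd j < (\<integral>p. fst j p \<partial>count_space \<mu>)})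
        \<inter> configs = {\<mu> \<in> configs. \<forall>(g, a)\<in>J. a < (\<integral>p. g p \<partial>count_space \<mu>)}"
      by (auto simp: case_prod_beta')
    ultimately show "{\<mu> \<in> configs. \<forall>(g, a)\<in>J. a < (\<integral>p. g p \<partial>count_space \<mu>)}
        \<in> sets (config_algebra configs)" by simp
  qed
  then show "sigma_sets configs ?E \<subseteq> ?S" by simp
qed

text \<open>Indicators of the generating sets are limits of bounded vaguely continuous functions,
  namely products of the ramps \<open>min 1 (max 0 (n * (x - a)))\<close> applied to integrals
  \<open>x\<close> of test functions. This takes the place of the usual approximation of closed sets
  by means of a metric.\<close>

lemma measure_eqI_vague:
  fixes Q R :: "('a::euclidean_space \<times> real) set measure"
  assumes "prob_space Q" "prob_space R"
    and sets: "sets Q = sets (config_algebra configs)" "sets R = sets (config_algebra configs)"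
    and eq: "\<And>f. continuous_map vague_topology euclideanreal f \<Longrightarrow> bounded (f ` configs) \<Longrightarrow>
      (\<integral>\<mu>. f \<mu> \<partial>Q) = (\<integral>\<mu>. f \<mu> \<partial>R)"
  shows "Q = R"
proof -
  interpret Q: prob_space Q by fact
  interpret R: prob_space R by fact
  let ?E = "{{\<mu> \<in> configs. \<forall>(g, a)\<in>J. a < (\<integral>p. g p \<partial>count_space \<mu>)} | J.
      finite J \<and> (\<forall>(g, a)\<in>J. vague_test (g :: 'a \<times> real \<Rightarrow> real))}"
  show ?thesis
  proof (rule measure_eqI_generator_eq[of ?E configs Q R "\<lambda>_. configs"])
    show "Int_stable ?E"
    proof (rule Int_stableI)
      fix X Y assume "X \<in> ?E" "Y \<in> ?E"
      then obtain J K where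
        X: "X = {\<mu> \<in> configs. \<forall>(g, a)\<in>J. a < (\<integral>p. g p \<partial>count_space \<mu>)}"
        and Y: "Y = {\<mu> \<in> configs. \<forall>(g, a)\<in>K. a < (\<integral>p. g p \<partial>count_space \<mu>)}"
        and JK: "finite J" "\<forall>(g, a)\<in>J. vague_test g" "finite K" "\<forall>(g, a)\<in>K. vague_test g"
        by auto
      have 1: "X \<inter> Y = {\<mu> \<in> configs. \<forall>(g, a)\<in>J \<union> K. a < (\<integral>p. g p \<partial>count_space \<mu>)}"
        unfolding X Y by blast
      have 2: "finite (J \<union> K) \<and> (\<forall>(g, a)\<in>J \<union> K. vague_test g)" using JK by blast
      show "X \<inter> Y \<in> ?E"
        by (rule CollectI, rule exI[of _ "J \<union> K"], rule conjI[OF 1 2])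
    qed
    show "sets Q = sigma_sets configs ?E" "sets R = sigma_sets configs ?E"
      using sets sets_config_algebra_vague by simp_all
    have "configs = {\<mu> \<in> configs. \<forall>(g, a)\<in>{}. a < (\<integral>p. g p \<partial>count_space \<mu>)}" by simp
    then have "configs \<in> ?E" by (intro CollectI exI[of _ "{}"] conjI) auto
    then show "range (\<lambda>_. configs) \<subseteq> ?E" by auto
    show "emeasure Q configs \<noteq> \<infinity>" for i :: nat using Q.emeasure_finite[of configs] by simp
  next
    fix X assume "X \<in> ?E"
    then obtain J where
      X: "X = {\<mu> \<in> configs. \<forall>(g, a)\<in>J. a < (\<integral>p. g p \<partial>count_space \<mu>)}"
      and J: "finite J" "\<forall>(g, a)\<in>J. vague_test g" by auto
    have "X \<in> sets (config_algebra configs)"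
      unfolding sets_config_algebra_vague using \<open>X \<in> ?E\<close> by (rule sigma_sets.Basic)
    then have XQ: "X \<in> sets Q" and XR: "X \<in> sets R" using sets by simp_all
    define f where "f n \<mu> = (\<Prod>j\<in>J. min 1 (max 0 (real n * ((\<integral>p. fst j p \<partial>count_space \<mu>) - snd j))))"
      for n :: nat and \<mu>
    have vt: "vague_test (fst j)" if "j \<in> J" for j using J(2) that by auto
    have cont: "continuous_map vague_topology euclideanreal (f n)" for n
    proof -
      have "continuous_map vague_topology euclideanreal
          ((\<lambda>x. min 1 (max 0 (real n * (x - snd j)))) \<circ> (\<lambda>\<mu>. \<integral>p. fst j p \<partial>count_space \<mu>))"
        if "j \<in> J" for j
        by (rule continuous_map_compose[OF continuous_map_vague_integral[OF vt[OF that]]])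
          (simp, intro continuous_intros)
      then show ?thesis unfolding f_def o_def by (intro continuous_map_prod J(1))
    qed
    have f01: "0 \<le> f n \<mu>" "f n \<mu> \<le> 1" for n \<mu>
      unfolding f_def by (auto intro!: prod_nonneg prod_le_1)
    have bdd: "bounded (f n ` configs)" for n
      by (rule bounded_subset[OF bounded_closed_interval[of 0 1]]) (use f01 in auto)
    have lim: "(\<lambda>n. f n \<mu>) \<longlonglongrightarrow> indicator X \<mu>" if \<mu>: "\<mu> \<in> configs" for \<mu>
    proof -
      have "(\<lambda>n. min 1 (max 0 (real n * c))) \<longlonglongrightarrow> (if 0 < c then 1 else 0)" for c :: real
      proof (cases "0 < c")
        case True
        have "\<forall>\<^sub>F n in sequentially. 1 / c \<le> real n"
          using filterlim_real_sequentially by (simp add: filterlim_at_top)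
        then have "\<forall>\<^sub>F n in sequentially. 1 = min 1 (max 0 (real n * c))"
          by eventually_elim (use True in \<open>simp add: field_simps\<close>)
        then show ?thesis using True by (simp add: Lim_transform_eventually[OF tendsto_const])
      next
        case False
        then have "min 1 (max 0 (real n * c)) = 0" for n
          by (simp add: mult_nonneg_nonpos max_absorb1)
        then show ?thesis using False by simp
      qed
      then have "(\<lambda>n. f n \<mu>) \<longlonglongrightarrow>
          (\<Prod>j\<in>J. if 0 < (\<integral>p. fst j p \<partial>count_space \<mu>) - snd j then 1 else 0)"
        unfolding f_def by (intro tendsto_prod)
      also have "(\<Prod>j\<in>J. if 0 < (\<integral>p. fst j p \<partial>count_space \<mu>) - snd j then 1 else 0) =
          (indicator X \<mu> :: real)"
      proof (cases "\<mu> \<in> X")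
        case True
        then have "0 < (\<integral>p. fst j p \<partial>count_space \<mu>) - snd j" if "j \<in> J" for j
          using that unfolding X by auto
        then show ?thesis using True by simp
      next
        case False
        then obtain j where "j \<in> J" "\<not> 0 < (\<integral>p. fst j p \<partial>count_space \<mu>) - snd j"
          using \<mu> unfolding X by auto
        then have "(\<Prod>j\<in>J. if 0 < (\<integral>p. fst j p \<partial>count_space \<mu>) - snd j then 1 else 0) = (0::real)"
          by (intro prod_zero[OF J(1)]) auto
        then show ?thesis using False by simp
      qed
      finally show ?thesis .
    qed
    have meas: "f n \<in> borel_measurable (config_algebra configs)" for n
      by (rule borel_measurable_vague_continuous[OF cont])
    have conv: "(\<lambda>n. \<integral>\<mu>. f n \<mu> \<partial>S) \<longlonglongrightarrow> (\<integral>\<mu>. indicator X \<mu> \<partial>S)"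
      if S: "prob_space S" "sets S = sets (config_algebra configs)" "X \<in> sets S" for S
    proof -
      interpret S: prob_space S by fact
      have "space S = configs" using sets_eq_imp_space_eq[OF S(2)] by simp
      then show ?thesis
        using meas S(2,3) f01 lim
        by (intro integral_dominated_convergence[where w="\<lambda>_. 1"])
          (auto cong: measurable_cong_sets)
    qed
    have "(\<integral>\<mu>. indicator X \<mu> \<partial>Q) = (\<integral>\<mu>. indicator X \<mu> \<partial>R :: real)"
      using LIMSEQ_unique[OF conv[OF assms(1) sets(1) XQ]] conv[OF assms(2) sets(2) XR]
      unfolding eq[OF cont bdd] by blast
    then have "measure Q X = measure R X" using XQ XR by simp
    then show "emeasure Q X = emeasure R X"
      by (simp add: Q.emeasure_eq_measure R.emeasure_eq_measure)
  qed auto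
qed

section \<open>Regular variation\<close>

text \<open>The Pareto law with tail \<open>y powr (- \<alpha>)\<close> for
  \<open>y \<ge> 1\<close>, obtained from a uniform variable by inverting the tail. It is the limit
  law of \<open>\<zeta> / u\<close> given \<open>\<zeta> > u\<close> and becomes the law of the
  score of the tail configuration at the origin.\<close>

definition pareto :: "real \<Rightarrow> real measure" where
  "pareto \<alpha> = distr (uniform_measure lborel {0<..<1}) borel (\<lambda>v. v powr (- 1 / \<alpha>))"

lemma prob_space_uniform_unit: "prob_space (uniform_measure lborel {0<..<1::real})"
  by (rule prob_space_uniform_measure) auto

lemma prob_space_pareto: "prob_space (pareto \<alpha>)"
  unfolding pareto_def by (rule prob_space.prob_space_distr[OF prob_space_uniform_unit]) simp

lemma sets_pareto [measurable_cong, simp]: "sets (pareto \<alpha>) = sets borel"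
  by (simp add: pareto_def)

lemma space_pareto [simp]: "space (pareto \<alpha>) = UNIV"
  by (simp add: pareto_def)

lemma AE_pareto_gt_1:
  assumes "0 < \<alpha>"
  shows "AE \<eta> in pareto \<alpha>. 1 < \<eta>"
proof -
  have "1 < v powr (- 1 / \<alpha>)" if "0 < v" "v < 1" for v :: real
    using that assms by (simp add: powr_def zero_less_mult_iff divide_neg_pos ln_less_zero mult_neg_neg)
  then have "AE v in uniform_measure lborel {0<..<1}. 1 < v powr (- 1 / \<alpha>)"
    by (intro AE_uniform_measureI) auto
  then show ?thesis
    unfolding pareto_def by (subst AE_distr_iff) auto
qed

lemma measure_pareto_atMost:
  assumes "0 < \<alpha>" "1 \<le> y"
  shows "measure (pareto \<alpha>) {..y} = 1 - y powr (- \<alpha>)"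
proof -
  have y: "0 < y powr (- \<alpha>)" "y powr (- \<alpha>) \<le> 1"
    using assms by (auto simp: powr_le_one_le powr_minus inverse_le_1_iff ge_one_powr_ge_zero)
  have iff: "v powr (- 1 / \<alpha>) \<le> y \<longleftrightarrow> y powr (- \<alpha>) \<le> v" if "0 < v" for v
  proof -
    have "v powr (- 1 / \<alpha>) \<le> y \<longleftrightarrow> ln (v powr (- 1 / \<alpha>)) \<le> ln y"
      using that assms by (subst ln_le_cancel_iff) auto
    also have "\<dots> \<longleftrightarrow> - \<alpha> * ln y \<le> ln v"
      using that assms by (auto simp: ln_powr field_simps)
    also have "\<dots> \<longleftrightarrow> ln (y powr (- \<alpha>)) \<le> ln v"
      using assms by (simp add: ln_powr)
    also have "\<dots> \<longleftrightarrow> y powr (- \<alpha>) \<le> v"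
      using that assms by (subst ln_le_cancel_iff) auto
    finally show ?thesis .
  qed
  have "emeasure (pareto \<alpha>) {..y} =
      emeasure (uniform_measure lborel {0<..<1}) ((\<lambda>v. v powr (- 1 / \<alpha>)) -` {..y})"
    unfolding pareto_def by (subst emeasure_distr) auto
  also have "\<dots> = emeasure lborel ({0<..<1} \<inter> ((\<lambda>v. v powr (- 1 / \<alpha>)) -` {..y})) /
      emeasure lborel {0<..<1::real}"
  proof (rule emeasure_uniform_measure)
    have "(\<lambda>v::real. v powr (- 1 / \<alpha>)) \<in> borel_measurable borel" by measurable
    then have "(\<lambda>v::real. v powr (- 1 / \<alpha>)) -` {..y} \<inter> space borel \<in> sets borel"
      by (rule measurable_sets) simp
    then show "(\<lambda>v::real. v powr (- 1 / \<alpha>)) -` {..y} \<in> sets lborel" by simp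
  qed simp
  also have "{0<..<1} \<inter> ((\<lambda>v. v powr (- 1 / \<alpha>)) -` {..y}) = {y powr (- \<alpha>)..<1}"
  proof (rule set_eqI)
    fix v
    show "v \<in> {0<..<1} \<inter> (\<lambda>v. v powr (- 1 / \<alpha>)) -` {..y} \<longleftrightarrow> v \<in> {y powr (- \<alpha>)..<1}"
    proof (cases "0 < v")
      case True
      then show ?thesis using iff[OF True] by (simp only: Int_iff vimage_eq atMost_iff greaterThanLessThan_iff atLeastLessThan_iff) auto
    next
      case False
      then have "\<not> y powr (- \<alpha>) \<le> v" using y by linarith
      then show ?thesis using False by simp
    qed
  qed
  also have "emeasure lborel {y powr (- \<alpha>)..<1} / emeasure lborel {0<..<1::real} =
      ennreal (1 - y powr (- \<alpha>))"
    using y by (simp add: divide_ennreal_def)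
  finally show ?thesis
    using y by (simp add: measure_def)
qed

text \<open>
  Regular variation says that the law of \<open>\<zeta> / u\<close> given \<open>\<zeta> > a u\<close> converges to that of \<open>a \<eta>\<close>; a
  Skorohod coupling handles integrands varying with \<open>u\<close>.
\<close>

lemma regularly_varying_integral_limit:
  fixes m :: "real measure" and u :: "nat \<Rightarrow> real" and h :: "nat \<Rightarrow> real \<Rightarrow> real"
  assumes "prob_space m" and m: "sets m = sets borel" and \<alpha>: "0 < \<alpha>"
    and rv: "\<And>y. 0 < y \<Longrightarrow> ((\<lambda>u. measure m {u * y<..} / measure m {u<..}) \<longlongrightarrow> y powr (- \<alpha>)) at_top"
    and pos: "\<And>u. 0 < measure m {u<..}"
    and u: "filterlim u at_top sequentially" and a: "0 < a"
    and [measurable]: "\<And>n. h n \<in> borel_measurable borel" "H \<in> borel_measurable borel"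
    and bd: "\<And>n s. 0 \<le> h n s" "\<And>n s. h n s \<le> C"
    and lim: "\<And>s s'. \<forall>\<^sub>F n in sequentially. a < s n \<Longrightarrow> s \<longlonglongrightarrow> s' \<Longrightarrow> 0 < s' \<Longrightarrow>
      (\<lambda>n. h n (s n)) \<longlonglongrightarrow> H s'"
  shows "(\<lambda>n. (\<integral>\<^sup>+s. ennreal (h n (s / u n)) * indicator {a * u n<..} s \<partial>m) / ennreal (measure m {u n<..}))
    \<longlonglongrightarrow> ennreal (a powr (- \<alpha>)) * (\<integral>\<^sup>+\<eta>. ennreal (H (a * \<eta>)) \<partial>pareto \<alpha>)"
proof -
  interpret m: prob_space m by fact
  interpret pareto: prob_space "pareto \<alpha>" by (rule prob_space_pareto)
  note m [measurable_cong]
  \<comment> \<open>\<open>U n\<close> is the mark law conditioned to exceed \<open>a * u n\<close>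
    and \<open>\<mu> n\<close> the law of the scaled mark under it; the limit \<open>\<nu>\<close>
    is the law of \<open>a\<close> times a Pareto variable.\<close>
  define U where "U n = uniform_measure m {a * u n<..}" for n
  define \<mu> where "\<mu> n = distr (U n) borel (\<lambda>s. s / u n)" for n
  define \<nu> where "\<nu> = distr (pareto \<alpha>) borel (\<lambda>\<eta>. a * \<eta>)"
  have U [measurable_cong]: "sets (U n) = sets borel" for n by (simp add: U_def m)
  have tail: "emeasure m {x<..} \<noteq> 0" "emeasure m {x<..} \<noteq> \<infinity>" for x
    using pos[of x] by (auto simp: m.emeasure_eq_measure)
  have prU: "prob_space (U n)" for n
    unfolding U_def by (rule prob_space_uniform_measure) (use tail in auto)
  have rd: "real_distribution (\<mu> n)" for n
  proof -
    interpret U: prob_space "U n" by (rule prU)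
    show ?thesis unfolding \<mu>_def
      by (rule U.real_distribution_distr) (simp cong: measurable_cong_sets add: U)
  qed
  have rd\<nu>: "real_distribution \<nu>"
    unfolding \<nu>_def by (rule pareto.real_distribution_distr) simp
  have ev_u: "\<forall>\<^sub>F n in sequentially. 0 < u n"
    using u by (simp add: filterlim_at_top_dense)
  have ratio: "(\<lambda>n. measure m {y * u n<..} / measure m {u n<..}) \<longlonglongrightarrow> y powr (- \<alpha>)" if "0 < y" for y
    using filterlim_compose[OF rv[OF that] u] by (simp add: mult.commute)
  have cdf_\<mu>: "cdf (\<mu> n) y =
      measure m ({a * u n<..} \<inter> (\<lambda>s. s / u n) -` {..y}) / measure m {a * u n<..}" for n y
  proof -
    have "(\<lambda>s. s / u n) \<in> borel_measurable borel" by measurable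
    from measurable_sets[OF this, of "{..y}"] have v: "(\<lambda>s. s / u n) -` {..y} \<in> sets borel" by simp
    have "cdf (\<mu> n) y = measure (U n) ((\<lambda>s. s / u n) -` {..y} \<inter> space (U n))"
      unfolding cdf_def \<mu>_def by (rule measure_distr) (auto simp: U cong: measurable_cong_sets)
    also have "space (U n) = UNIV" using sets_eq_imp_space_eq[OF U] by simp
    finally show ?thesis
      unfolding U_def using v tail by (simp add: measure_uniform_measure m)
  qed
  have conv: "weak_conv_m \<mu> \<nu>"
    unfolding weak_conv_m_def weak_conv_def
  proof (intro allI impI)
    fix y
    show "(\<lambda>n. cdf (\<mu> n) y) \<longlonglongrightarrow> cdf \<nu> y"
    proof (cases "y < a")
      case True
      have "cdf (\<mu> n) y = 0" if "0 < u n" for n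
      proof -
        have "(\<lambda>s. s / u n) -` {..y} \<inter> {a * u n<..} = {}"
        proof -
          have False if "s / u n \<le> y" "a * u n < s" for s
            using mult_strict_right_mono[OF True \<open>0 < u n\<close>] that \<open>0 < u n\<close>
            unfolding pos_divide_le_eq[OF \<open>0 < u n\<close>] by linarith
          then show ?thesis by auto
        qed
        then show ?thesis
          by (simp only: cdf_\<mu> Int_commute measure_empty div_0)
      qed
      then have "\<forall>\<^sub>F n in sequentially. 0 = cdf (\<mu> n) y"
        using ev_u by (auto elim!: eventually_mono)
      moreover have "cdf \<nu> y = 0"
      proof -
        have "AE \<eta> in pareto \<alpha>. \<eta> \<notin> (\<lambda>\<eta>. a * \<eta>) -` {..y}"
          using AE_pareto_gt_1[OF \<alpha>]
        proof eventually_elim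
          case (elim \<eta>)
          have "y < a * 1" using True by simp
          also have "a * 1 < a * \<eta>" using elim a by (intro mult_strict_left_mono)
          finally show ?case by simp
        qed
        moreover have "(\<lambda>\<eta>. a * \<eta>) \<in> borel_measurable borel" by measurable
        from measurable_sets[OF this, of "{..y}"] have "(\<lambda>\<eta>. a * \<eta>) -` {..y} \<in> pareto.events"
          by simp
        ultimately have "pareto.prob ((\<lambda>\<eta>. a * \<eta>) -` {..y}) = 0"
          using pareto.prob_eq_0 by blast
        then show ?thesis unfolding cdf_def \<nu>_def
          by (subst measure_distr) auto
      qed
      ultimately show ?thesis by (simp add: Lim_transform_eventually[OF tendsto_const])
    next
      case False
      then have y: "a \<le> y" "0 < y" using a by auto
      \<comment> \<open>The conditional tail is written as a quotient of two tail ratios with the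
        common reference \<open>measure m {u n<..}\<close>, so that regular variation applies to
        both.\<close>
      have "cdf (\<mu> n) y = 1 - (measure m {y * u n<..} / measure m {u n<..}) / (measure m {a * u n<..} / measure m {u n<..})"
        if un: "0 < u n" for n
      proof -
        have au: "a * u n \<le> y * u n" using y un by simp
        have "(\<lambda>s. s / u n) -` {..y} = {..y * u n}" using un by (auto simp: field_simps)
        then have "cdf (\<mu> n) y = measure m ({a * u n<..} \<inter> {..y * u n}) / measure m {a * u n<..}"
          by (simp only: cdf_\<mu>)
        also have "{a * u n<..} \<inter> {..y * u n} = {a * u n<..} - {y * u n<..}" by auto
        also have "measure m ({a * u n<..} - {y * u n<..}) = measure m {a * u n<..} - measure m {y * u n<..}"
          by (rule m.finite_measure_Diff) (use au in \<open>auto simp: m\<close>)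
        finally show ?thesis using pos[of "a * u n"] pos[of "u n"] by (simp add: diff_divide_distrib)
      qed
      then have "\<forall>\<^sub>F n in sequentially. 1 - (measure m {y * u n<..} / measure m {u n<..}) / (measure m {a * u n<..} / measure m {u n<..})
          = cdf (\<mu> n) y"
        using ev_u by (auto elim!: eventually_mono)
      moreover have "(\<lambda>n. 1 - (measure m {y * u n<..} / measure m {u n<..}) / (measure m {a * u n<..} / measure m {u n<..}))
          \<longlonglongrightarrow> 1 - y powr (- \<alpha>) / a powr (- \<alpha>)"
        using a y by (intro tendsto_intros ratio) auto
      moreover have "cdf \<nu> y = 1 - y powr (- \<alpha>) / a powr (- \<alpha>)"
      proof -
        have "(\<lambda>\<eta>. a * \<eta>) -` {..y} = {..y / a}" using a by (auto simp: field_simps)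
        then have "cdf \<nu> y = 1 - (y / a) powr (- \<alpha>)"
          unfolding cdf_def \<nu>_def using a y measure_pareto_atMost[OF \<alpha>, of "y / a"]
          by (subst measure_distr) auto
        then show ?thesis using a y by (simp add: powr_divide)
      qed
      ultimately show ?thesis by (simp add: Lim_transform_eventually)
    qed
  qed
  obtain \<Omega> :: "real measure" and S S' where *: "prob_space \<Omega> \<and>
      (\<forall>n. S n \<in> measurable \<Omega> borel) \<and> (\<forall>n. distr \<Omega> borel (S n) = \<mu> n) \<and>
      S' \<in> measurable \<Omega> lborel \<and> distr \<Omega> borel S' = \<nu> \<and>
      (\<forall>x \<in> space \<Omega>. (\<lambda>n. S n x) \<longlonglongrightarrow> S' x)"
    using Skorohod[OF rd rd\<nu> conv] by (elim exE) (rule that)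
  have "prob_space \<Omega>"
    and S [measurable]: "S n \<in> borel_measurable \<Omega>" and dS: "distr \<Omega> borel (S n) = \<mu> n"
    and S' [measurable]: "S' \<in> borel_measurable \<Omega>" and dS': "distr \<Omega> borel S' = \<nu>"
    and SS': "x \<in> space \<Omega> \<Longrightarrow> (\<lambda>n. S n x) \<longlonglongrightarrow> S' x" for n x
    using * by simp_all
  interpret \<Omega>: prob_space \<Omega> by fact
  have "AE x in \<Omega>. 0 < u n \<longrightarrow> a < S n x" for n
  proof (cases "0 < u n")
    case True
    have "AE s in U n. a < s / u n"
      unfolding U_def by (rule AE_uniform_measureI) (use True in \<open>auto simp: m field_simps\<close>)
    then have "AE s in \<mu> n. a < s"
      unfolding \<mu>_def by (subst AE_distr_iff) (auto simp: U cong: measurable_cong_sets)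
    then show ?thesis
      unfolding dS[symmetric] by (subst (asm) AE_distr_iff) auto
  qed simp
  \<comment> \<open>The hypothesis on \<open>h\<close> asks for arguments above \<open>a\<close>.
    The coupled variables satisfy this almost surely because they have the laws of the conditioned
    marks.\<close>
  then have AE1: "AE x in \<Omega>. \<forall>n. 0 < u n \<longrightarrow> a < S n x"
    by (simp add: AE_all_countable)
  have ae: "AE x in \<Omega>. (\<lambda>n. ennreal (h n (S n x))) \<longlonglongrightarrow> ennreal (H (S' x))"
    using AE1 AE_space
  proof eventually_elim
    case (elim x)
    have ev: "\<forall>\<^sub>F n in sequentially. a < S n x"
      using ev_u by eventually_elim (use elim in auto)
    have "a \<le> S' x"
      by (rule tendsto_lowerbound[OF SS'[OF elim(2)]]) (use ev in \<open>auto elim: eventually_mono\<close>)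
    then have "(\<lambda>n. h n (S n x)) \<longlonglongrightarrow> H (S' x)"
      using a by (intro lim[OF ev SS'[OF elim(2)]]) auto
    then show ?case by (rule tendsto_ennrealI)
  qed
  have lim1: "(\<lambda>n. \<integral>\<^sup>+x. ennreal (h n (S n x)) \<partial>\<Omega>) \<longlonglongrightarrow> (\<integral>\<^sup>+x. ennreal (H (S' x)) \<partial>\<Omega>)"
  proof (rule nn_integral_dominated_convergence[where w="\<lambda>_. ennreal C"])
    show "AE x in \<Omega>. ennreal (h n (S n x)) \<le> ennreal C" for n
      using bd by (auto intro!: ennreal_leI)
  qed (use ae in \<open>auto simp: \<Omega>.emeasure_space_1\<close>)
  have "(\<integral>\<^sup>+x. ennreal (H (S' x)) \<partial>\<Omega>) = (\<integral>\<^sup>+s. ennreal (H s) \<partial>\<nu>)"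
    unfolding dS'[symmetric] by (subst nn_integral_distr) auto
  also have "\<dots> = (\<integral>\<^sup>+\<eta>. ennreal (H (a * \<eta>)) \<partial>pareto \<alpha>)"
    unfolding \<nu>_def by (subst nn_integral_distr) auto
  finally have I': "(\<integral>\<^sup>+x. ennreal (H (S' x)) \<partial>\<Omega>) = (\<integral>\<^sup>+\<eta>. ennreal (H (a * \<eta>)) \<partial>pareto \<alpha>)" .
  have I: "(\<integral>\<^sup>+x. ennreal (h n (S n x)) \<partial>\<Omega>) =
      (\<integral>\<^sup>+s. ennreal (h n (s / u n)) * indicator {a * u n<..} s \<partial>m) / emeasure m {a * u n<..}" for n
  proof -
    have "(\<integral>\<^sup>+x. ennreal (h n (S n x)) \<partial>\<Omega>) = (\<integral>\<^sup>+s. ennreal (h n s) \<partial>\<mu> n)"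
      unfolding dS[symmetric] by (subst nn_integral_distr) auto
    also have "\<dots> = (\<integral>\<^sup>+s. ennreal (h n (s / u n)) \<partial>U n)"
      unfolding \<mu>_def by (subst nn_integral_distr) (auto simp: U cong: measurable_cong_sets)
    also have "\<dots> = (\<integral>\<^sup>+s. ennreal (h n (s / u n)) * indicator {a * u n<..} s \<partial>m) / emeasure m {a * u n<..}"
      unfolding U_def by (rule nn_integral_uniform_measure) (auto cong: measurable_cong_sets simp: m)
    finally show ?thesis .
  qed
  \<comment> \<open>Undoing the conditioning multiplies by the tail ratio between
    \<open>a * u n\<close> and \<open>u n\<close>, which contributes the factor
    \<open>a powr (- \<alpha>)\<close> in the limit.\<close>
  have eq: "(\<integral>\<^sup>+x. ennreal (h n (S n x)) \<partial>\<Omega>) * ennreal (measure m {a * u n<..} / measure m {u n<..}) =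
      (\<integral>\<^sup>+s. ennreal (h n (s / u n)) * indicator {a * u n<..} s \<partial>m) / ennreal (measure m {u n<..})" for n
  proof -
    have "x / ennreal b * ennreal (b / c) = x / ennreal c" if "0 < b" "0 < c" for x b c
      using that by (simp add: divide_ennreal[symmetric] ennreal_divide_times
          ennreal_times_divide mult.commute mult_divide_eq_ennreal)
    then show ?thesis unfolding I using pos by (simp add: m.emeasure_eq_measure)
  qed
  have "(\<lambda>n. (\<integral>\<^sup>+x. ennreal (h n (S n x)) \<partial>\<Omega>) * ennreal (measure m {a * u n<..} / measure m {u n<..}))
      \<longlonglongrightarrow> (\<integral>\<^sup>+x. ennreal (H (S' x)) \<partial>\<Omega>) * ennreal (a powr (- \<alpha>))"
    by (rule tendsto_mult_ennreal[OF lim1 tendsto_ennrealI[OF ratio[OF a]]]) (use a in auto)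
  then show ?thesis
    unfolding eq I' by (simp add: mult.commute)
qed

section \<open>Measurability of the moving maxima\<close>

lemma neighbourhood_mapD:
  assumes "neighbourhood_map \<Phi>" "\<nu> \<in> ground_configs" "t \<in> \<nu>"
  shows "finite (\<Phi> t \<nu>)" "\<Phi> t \<nu> \<subseteq> \<nu>" "t \<in> \<Phi> t \<nu>"
  using assms unfolding neighbourhood_map_def by auto

lemma measurable_neighbourhood:
  assumes "neighbourhood_map \<Phi>" "X \<in> borel_measurable N" "T \<in> N \<rightarrow>\<^sub>M config_algebra ground_configs"
  shows "(\<lambda>y. \<Phi> (X y) (T y)) \<in> N \<rightarrow>\<^sub>M config_algebra ground_configs"
proof -
  have "case_prod \<Phi> \<in> borel \<Otimes>\<^sub>M config_algebra ground_configs \<rightarrow>\<^sub>M config_algebra ground_configs"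
    using assms(1) unfolding neighbourhood_map_def by blast
  from measurable_compose[OF measurable_Pair[OF assms(2,3)] this] show ?thesis by simp
qed

lemma measurable_pred_mem_config:
  fixes X :: "'o \<Rightarrow> 'c::{second_countable_topology, t2_space}"
  assumes T: "T \<in> N \<rightarrow>\<^sub>M config_algebra C" and C: "sigma_finite_configs C"
    and [measurable]: "X \<in> borel_measurable N"
  shows "Measurable.pred N (\<lambda>y. X y \<in> T y)"
proof -
  have "Measurable.pred N (\<lambda>y. \<exists>p\<in>T y. p = X y)"
    by (rule measurable_pred_ex_config[OF T C]) measurable
  then show ?thesis by simp
qed

lemma measurable_pred_mem_neighbourhood:
  fixes \<Phi> :: "'a::euclidean_space \<Rightarrow> 'a set \<Rightarrow> 'a set"
  assumes "neighbourhood_map \<Phi>" "X \<in> borel_measurable N" "T \<in> N \<rightarrow>\<^sub>M config_algebra ground_configs"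
    "Y \<in> borel_measurable N"
  shows "Measurable.pred N (\<lambda>y. Y y \<in> \<Phi> (X y) (T y))"
  by (rule measurable_pred_mem_config[OF measurable_neighbourhood[OF assms(1-3)]
        sigma_finite_configs_ground assms(4)])

lemma fst_image_configs10: "\<mu> \<in> configs10 \<Longrightarrow> fst ` \<mu> \<in> ground_configs"
  using measurable_space[OF measurable_fst_image[OF measurable_id], of \<mu>] by (simp add: id_def)

lemma score_at_eq: "\<mu> \<in> configs \<Longrightarrow> (t, s) \<in> \<mu> \<Longrightarrow> score_at \<mu> t = s"
  unfolding score_at_def by (rule the_equality) (auto simp: configs_iff simple_config_iff)

lemma score_at_mem: "\<mu> \<in> configs \<Longrightarrow> t \<in> fst ` \<mu> \<Longrightarrow> (t, score_at \<mu> t) \<in> \<mu>"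
  by (auto simp: score_at_eq)

lemma score_at_pos: "\<mu> \<in> configs \<Longrightarrow> t \<in> fst ` \<mu> \<Longrightarrow> 0 < score_at \<mu> t"
  using score_at_mem[of \<mu> t] by (auto simp: configs_iff simple_config_iff)

text \<open>A jointly measurable version of \<open>scoring\<close>, avoiding \<open>Max\<close> and \<open>THE\<close>.\<close>

definition sup_score ::
  "('a::euclidean_space \<Rightarrow> 'a set \<Rightarrow> 'a set) \<Rightarrow> ('a \<Rightarrow> real) \<Rightarrow> 'a \<Rightarrow> ('a \<times> real) set \<Rightarrow> ennreal" where
  "sup_score \<Phi> w t \<mu> =
     (SUP p\<in>\<mu>. if fst p \<in> \<Phi> t (fst ` \<mu>) then ennreal (w (fst p - t) * snd p) else 0)"

text \<open>A supremum exceeds a level exactly when some point does, which is an existence event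
  over the configuration.\<close>

lemma borel_measurable_sup_score:
  fixes \<Phi> :: "'a::euclidean_space \<Rightarrow> 'a set \<Rightarrow> 'a set"
  assumes \<Phi>: "neighbourhood_map \<Phi>" and w [measurable]: "w \<in> borel_measurable borel"
    and X [measurable]: "X \<in> borel_measurable N" and T: "T \<in> N \<rightarrow>\<^sub>M config_algebra configs10"
  shows "(\<lambda>y. sup_score \<Phi> w (X y) (T y)) \<in> borel_measurable N"
proof (rule borel_measurableI_greater)
  fix a :: ennreal
  have [measurable]: "(\<lambda>yp. fst ` T (fst yp)) \<in> N \<Otimes>\<^sub>M (borel :: ('a \<times> real) measure) \<rightarrow>\<^sub>M config_algebra ground_configs"
    by (rule measurable_compose[OF measurable_fst measurable_fst_image[OF T]])
  have [measurable]: "Measurable.pred (N \<Otimes>\<^sub>M (borel :: ('a \<times> real) measure))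
      (\<lambda>yp. fst (snd yp) \<in> \<Phi> (X (fst yp)) (fst ` T (fst yp)))"
    by (rule measurable_pred_mem_neighbourhood[OF \<Phi>]) measurable
  have "Measurable.pred N (\<lambda>y. \<exists>p\<in>T y.
      a < (if fst p \<in> \<Phi> (X y) (fst ` T y) then ennreal (w (fst p - X y) * snd p) else 0))"
    by (rule measurable_pred_ex_config[OF T sigma_finite_configs_configs10])
      (simp only: case_prod_beta', measurable)
  then show "{y \<in> space N. a < sup_score \<Phi> w (X y) (T y)} \<in> sets N"
    unfolding sup_score_def less_SUP_iff by (simp only: pred_def)
qed

text \<open>Points outside the neighbourhood enter the supremum with the value 0, which is harmless
  as weights are nonnegative and marks positive.\<close>

lemma scoring_eq_sup_score:
  fixes \<Phi> :: "'a::euclidean_space \<Rightarrow> 'a set \<Rightarrow> 'a set"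
  assumes \<Phi>: "neighbourhood_map \<Phi>" and w: "\<And>x. 0 \<le> w x"
    and \<mu>: "\<mu> \<in> configs10" and t: "t \<in> fst ` \<mu>"
  shows "ennreal (scoring \<Phi> w t \<mu>) = sup_score \<Phi> w t \<mu>"
proof -
  let ?A = "\<Phi> t (fst ` \<mu>)" and ?f = "\<lambda>x. w (x - t) * score_at \<mu> x"
  note A = neighbourhood_mapD[OF \<Phi> fst_image_configs10[OF \<mu>] t]
  have \<mu>': "\<mu> \<in> configs" using \<mu> configs10_subset by blast
  have fin: "finite (?f ` ?A)" and ne: "?f ` ?A \<noteq> {}" using A by auto
  have "Max (?f ` ?A) \<in> ?f ` ?A" by (rule Max_in[OF fin ne])
  then obtain x where x: "x \<in> ?A" "scoring \<Phi> w t \<mu> = ?f x" unfolding scoring_def by auto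
  have "(x, score_at \<mu> x) \<in> \<mu>" using score_at_mem[OF \<mu>'] A(2) x(1) by blast
  then have "ennreal (scoring \<Phi> w t \<mu>) \<le> sup_score \<Phi> w t \<mu>"
    unfolding sup_score_def by (rule SUP_upper2) (simp add: x)
  moreover have "sup_score \<Phi> w t \<mu> \<le> ennreal (scoring \<Phi> w t \<mu>)"
    unfolding sup_score_def
  proof (rule SUP_least)
    fix p assume p: "p \<in> \<mu>"
    show "(if fst p \<in> ?A then ennreal (w (fst p - t) * snd p) else 0) \<le> ennreal (scoring \<Phi> w t \<mu>)"
    proof (cases "fst p \<in> ?A")
      case True
      have "score_at \<mu> (fst p) = snd p" using p by (intro score_at_eq[OF \<mu>']) simp
      then have "w (fst p - t) * snd p \<le> scoring \<Phi> w t \<mu>"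
        unfolding scoring_def using True by (intro Max_ge[OF fin]) force
      then show ?thesis using True by (simp add: ennreal_leI)
    qed simp
  qed
  ultimately show ?thesis by (rule antisym)
qed

lemma scoring_bounds:
  fixes \<Phi> :: "'a::euclidean_space \<Rightarrow> 'a set \<Rightarrow> 'a set"
  assumes \<Phi>: "neighbourhood_map \<Phi>" and \<mu>: "\<mu> \<in> configs10" and t: "t \<in> fst ` \<mu>"
  shows less_scoring_iff: "u < scoring \<Phi> w t \<mu> \<longleftrightarrow> (\<exists>x\<in>\<Phi> t (fst ` \<mu>). u < w (x - t) * score_at \<mu> x)"
    and scoring_ge: "x \<in> \<Phi> t (fst ` \<mu>) \<Longrightarrow> w (x - t) * score_at \<mu> x \<le> scoring \<Phi> w t \<mu>"
    and scoring_le_iff: "scoring \<Phi> w t \<mu> \<le> u \<longleftrightarrow> (\<forall>x\<in>\<Phi> t (fst ` \<mu>). w (x - t) * score_at \<mu> x \<le> u)"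
proof -
  let ?A = "\<Phi> t (fst ` \<mu>)" and ?f = "\<lambda>x. w (x - t) * score_at \<mu> x"
  note A = neighbourhood_mapD[OF \<Phi> fst_image_configs10[OF \<mu>] t]
  have fin: "finite (?f ` ?A)" and ne: "?f ` ?A \<noteq> {}" using A by auto
  show "u < scoring \<Phi> w t \<mu> \<longleftrightarrow> (\<exists>x\<in>?A. u < ?f x)"
    unfolding scoring_def by (subst Max_gr_iff[OF fin ne]) auto
  show "x \<in> ?A \<Longrightarrow> ?f x \<le> scoring \<Phi> w t \<mu>"
    unfolding scoring_def by (rule Max_ge[OF fin]) auto
  show "scoring \<Phi> w t \<mu> \<le> u \<longleftrightarrow> (\<forall>x\<in>?A. ?f x \<le> u)"
    unfolding scoring_def by (subst Max_le_iff[OF fin ne]) auto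
qed

text \<open>Each point lies in its own neighbourhood with weight \<open>w 0 = 1\<close>, so its own
  mark is a positive competitor in the maximum. Hence \<open>graph_config\<close> loses no point of
  the process.\<close>

lemma scoring_pos:
  fixes \<Phi> :: "'a::euclidean_space \<Rightarrow> 'a set \<Rightarrow> 'a set"
  assumes \<Phi>: "neighbourhood_map \<Phi>" and \<mu>: "\<mu> \<in> configs10" and t: "t \<in> fst ` \<mu>" and w: "w 0 = 1"
  shows "0 < scoring \<Phi> w t \<mu>"
proof -
  have "0 < score_at \<mu> t" using \<mu> t configs10_subset by (intro score_at_pos) auto
  then show ?thesis
    unfolding less_scoring_iff[OF \<Phi> \<mu> t]
    using neighbourhood_mapD(3)[OF \<Phi> fst_image_configs10[OF \<mu>] t] w by (intro bexI[of _ t]) auto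
qed

lemma graph_config_cong:
  "(\<And>t. t \<in> I \<Longrightarrow> \<phi> t = \<psi> t) \<Longrightarrow> graph_config I \<phi> = graph_config I \<psi>"
  unfolding graph_config_def by auto

lemma measurable_graph_config:
  fixes T :: "'o \<Rightarrow> 'a::euclidean_space set"
  assumes T: "T \<in> N \<rightarrow>\<^sub>M config_algebra ground_configs"
    and \<phi> [measurable]: "(\<lambda>yt. \<phi> (fst yt) (snd yt)) \<in> borel_measurable (N \<Otimes>\<^sub>M borel)"
  shows "(\<lambda>y. graph_config (T y) (\<phi> y)) \<in> N \<rightarrow>\<^sub>M config_algebra configs10"
proof (rule measurable_config_algebraI)
  show "graph_config (T y) (\<phi> y) \<in> configs10" if "y \<in> space N" for y
    using measurable_space[OF T that] by (simp add: graph_config_in_configs10)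
next
  fix B :: "('a \<times> real) set" assume [measurable]: "B \<in> sets borel"
  have "Measurable.pred N (\<lambda>y. \<exists>t\<in>T y. 0 < \<phi> y t \<and> (t, \<phi> y t) \<in> B)"
    by (rule measurable_pred_ex_config[OF T sigma_finite_configs_ground])
      (simp only: case_prod_beta', measurable)
  then have "Measurable.pred N (\<lambda>y. \<not> (\<exists>t\<in>T y. 0 < \<phi> y t \<and> (t, \<phi> y t) \<in> B))" by measurable
  moreover have "(\<not> (\<exists>t\<in>T y. 0 < \<phi> y t \<and> (t, \<phi> y t) \<in> B)) \<longleftrightarrow> graph_config (T y) (\<phi> y) \<inter> B = {}" for y
    by (auto simp: graph_config_def)
  ultimately show "{y \<in> space N. graph_config (T y) (\<phi> y) \<inter> B = {}} \<in> sets N"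
    by (simp add: pred_def)
qed

lemma moving_maxima_eq_graph:
  fixes \<Phi> :: "'a::euclidean_space \<Rightarrow> 'a set \<Rightarrow> 'a set"
  assumes "neighbourhood_map \<Phi>" "\<mu> \<in> configs10" "w 0 = 1"
  shows "moving_maxima \<Phi> w \<mu> = graph_config (fst ` \<mu>) (\<lambda>t. scoring \<Phi> w t \<mu>)"
  unfolding moving_maxima_def graph_config_def
  using scoring_pos[where w=w, OF assms(1,2) _ assms(3)] by auto

lemma scaling_graph_config:
  assumes "0 < u"
  shows "scaling 1 u (graph_config I \<phi>) = graph_config I (\<lambda>t. \<phi> t / u)"
proof -
  have "graph_config I \<rho> = (\<lambda>t. (t, \<rho> t)) ` {t \<in> I. 0 < \<rho> t}" for \<rho>
    by (auto simp: graph_config_def)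
  then show ?thesis using assms by (simp add: scaling_def image_image zero_less_divide_iff)
qed

lemma score_at_graph_config: "t \<in> I \<Longrightarrow> 0 < \<phi> t \<Longrightarrow> score_at (graph_config I \<phi>) t = \<phi> t"
  unfolding score_at_def graph_config_def by (rule the_equality) auto

lemma score_at_moving_maxima:
  fixes \<Phi> :: "'a::euclidean_space \<Rightarrow> 'a set \<Rightarrow> 'a set"
  assumes "neighbourhood_map \<Phi>" "\<mu> \<in> configs10" "w 0 = 1" "t \<in> fst ` \<mu>"
  shows "score_at (moving_maxima \<Phi> w \<mu>) t = scoring \<Phi> w t \<mu>"
  unfolding moving_maxima_eq_graph[where w=w, OF assms(1-3)]
  using assms scoring_pos[where w=w, OF assms(1,2,4,3)] by (intro score_at_graph_config)

lemma measurable_scaled_moving_maxima: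
  fixes \<Phi> :: "'a::euclidean_space \<Rightarrow> 'a set \<Rightarrow> 'a set"
  assumes \<Phi>: "neighbourhood_map \<Phi>" and w [measurable]: "w \<in> borel_measurable borel"
    and w0: "\<And>x. 0 \<le> w x" "w 0 = 1" and T: "T \<in> N \<rightarrow>\<^sub>M config_algebra configs10" and u: "0 < u"
  shows "(\<lambda>y. scaling 1 u (moving_maxima \<Phi> w (T y))) \<in> N \<rightarrow>\<^sub>M config_algebra configs"
proof -
  have [measurable]: "(\<lambda>yt. sup_score \<Phi> w (snd yt) (T (fst yt))) \<in> borel_measurable (N \<Otimes>\<^sub>M borel)"
    by (rule borel_measurable_sup_score[OF \<Phi> w]) (use T in measurable)
  have "(\<lambda>y. graph_config (fst ` T y) (\<lambda>t. enn2real (sup_score \<Phi> w t (T y)) / u))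
      \<in> N \<rightarrow>\<^sub>M config_algebra configs10"
    by (rule measurable_graph_config[OF measurable_fst_image[OF T]]) measurable
  then have "(\<lambda>y. graph_config (fst ` T y) (\<lambda>t. enn2real (sup_score \<Phi> w t (T y)) / u))
      \<in> N \<rightarrow>\<^sub>M config_algebra configs"
    by (rule measurable_config_algebra_subset) (rule configs10_subset)
  moreover have "scaling 1 u (moving_maxima \<Phi> w (T y)) =
      graph_config (fst ` T y) (\<lambda>t. enn2real (sup_score \<Phi> w t (T y)) / u)" if y: "y \<in> space N" for y
  proof -
    have Ty: "T y \<in> configs10" using measurable_space[OF T y] by simp
    show ?thesis
      unfolding moving_maxima_eq_graph[where w=w, OF \<Phi> Ty w0(2)] scaling_graph_config[OF u]
    proof (rule graph_config_cong)
      fix t assume t: "t \<in> fst ` T y"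
      then show "scoring \<Phi> w t (T y) / u = enn2real (sup_score \<Phi> w t (T y)) / u"
        using scoring_pos[where w=w, OF \<Phi> Ty t w0(2)]
        by (simp flip: scoring_eq_sup_score[OF \<Phi> w0(1) Ty t])
    qed
  qed
  ultimately show ?thesis by (subst measurable_cong) auto
qed

text \<open>\<open>cluster_config \<Phi> w \<nu> x \<eta>\<close> is the spectral configuration with all scores multiplied by \<open>\<eta>\<close>.\<close>

definition cluster_config ::
  "('a::euclidean_space \<Rightarrow> 'a set \<Rightarrow> 'a set) \<Rightarrow> ('a \<Rightarrow> real) \<Rightarrow> 'a set \<Rightarrow> 'a \<Rightarrow> real \<Rightarrow>
     ('a \<times> real) set" where
  "cluster_config \<Phi> w \<nu> x \<eta> =
     graph_config \<nu> (\<lambda>t. if x \<in> \<Phi> t \<nu> then w (x - t) / w x * \<eta> else 0)"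

lemma spectral_config_eq_cluster: "spectral_config \<Phi> w \<nu> x = cluster_config \<Phi> w \<nu> x 1"
  unfolding spectral_config_def cluster_config_def graph_config_def score_space_def by auto

lemma scaling_cluster_config:
  "0 < u \<Longrightarrow> scaling 1 u (cluster_config \<Phi> w \<nu> x \<eta>) = cluster_config \<Phi> w \<nu> x (\<eta> / u)"
  unfolding cluster_config_def
  by (subst scaling_graph_config) (auto intro!: arg_cong2[where f=graph_config])

lemma measurable_cluster_config:
  fixes \<Phi> :: "'a::euclidean_space \<Rightarrow> 'a set \<Rightarrow> 'a set"
  assumes \<Phi>: "neighbourhood_map \<Phi>" and w [measurable]: "w \<in> borel_measurable borel"
    and T: "T \<in> N \<rightarrow>\<^sub>M config_algebra ground_configs"
    and [measurable]: "X \<in> borel_measurable N" "E \<in> borel_measurable N"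
  shows "(\<lambda>y. cluster_config \<Phi> w (T y) (X y) (E y)) \<in> N \<rightarrow>\<^sub>M config_algebra configs"
proof -
  have [measurable]: "Measurable.pred (N \<Otimes>\<^sub>M borel) (\<lambda>yt. X (fst yt) \<in> \<Phi> (snd yt) (T (fst yt)))"
    by (rule measurable_pred_mem_neighbourhood[OF \<Phi>]) (use T in measurable)
  have "(\<lambda>y. cluster_config \<Phi> w (T y) (X y) (E y)) \<in> N \<rightarrow>\<^sub>M config_algebra configs10"
    unfolding cluster_config_def by (rule measurable_graph_config[OF T]) measurable
  then show ?thesis by (rule measurable_config_algebra_subset) (rule configs10_subset)
qed

lemma cluster_config_in_configs: "\<nu> \<in> ground_configs \<Longrightarrow> cluster_config \<Phi> w \<nu> x \<eta> \<in> configs"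
  unfolding cluster_config_def by (rule graph_config_in_configs)

text \<open>Positions determine the points of a simple configuration, so \<open>fst\<close> is a
  bijection and sums over points become sums over positions.\<close>

lemma nn_integral_count_space_fst:
  assumes \<mu>: "\<mu> \<in> configs" and A: "finite A" "A \<subseteq> fst ` \<mu>"
  shows "(\<integral>\<^sup>+p. (if fst p \<in> A then G (fst p) else 0) \<partial>count_space \<mu>) = (\<Sum>x\<in>A. G x)"
proof -
  have "inj_on fst \<mu>"
    using \<mu> by (intro inj_onI) (auto simp: configs_iff simple_config_iff)
  then have "bij_betw fst \<mu> (fst ` \<mu>)" by (simp add: bij_betw_def)
  then have "(\<integral>\<^sup>+p. (if fst p \<in> A then G (fst p) else 0) \<partial>count_space \<mu>) =
      (\<integral>\<^sup>+x. (if x \<in> A then G x else 0) \<partial>count_space (fst ` \<mu>))"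
    by (rule nn_integral_bij_count_space)
  also have "\<dots> = (\<Sum>x\<in>A. if x \<in> A then G x else 0)"
    by (rule nn_integral_count_space') (use A in auto)
  finally show ?thesis by simp
qed

section \<open>The Palm version\<close>

lemma nn_integral_count_space_insert:
  assumes "a \<notin> A"
  shows "(\<integral>\<^sup>+p. f p \<partial>count_space (insert a A)) = f a + (\<integral>\<^sup>+p. f p \<partial>count_space A)"
proof -
  have "(\<integral>\<^sup>+p. f p \<partial>count_space (insert a A)) =
      (\<integral>\<^sup>+p. f p * indicator (insert a A) p \<partial>count_space UNIV)"
    by (rule nn_integral_count_space_indicator) simp
  also have "\<dots> = (\<integral>\<^sup>+p. f p * indicator {a} p + f p * indicator A p \<partial>count_space UNIV)"
    by (rule nn_integral_cong) (use assms in \<open>auto split: split_indicator\<close>)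
  also have "\<dots> = (\<integral>\<^sup>+p. f p * indicator {a} p \<partial>count_space UNIV) +
      (\<integral>\<^sup>+p. f p * indicator A p \<partial>count_space UNIV)"
    by (rule nn_integral_add) auto
  also have "(\<integral>\<^sup>+p. f p * indicator {a} p \<partial>count_space UNIV) = f a"
    by (simp add: nn_integral_indicator_singleton')
  also have "(\<integral>\<^sup>+p. f p * indicator A p \<partial>count_space UNIV) = (\<integral>\<^sup>+p. f p \<partial>count_space A)"
    by (rule nn_integral_count_space_indicator[symmetric]) simp
  finally show ?thesis .
qed

lemma nn_integral_count_space_filter:
  "(\<integral>\<^sup>+p. f p \<partial>count_space {p \<in> A. Q p}) = (\<integral>\<^sup>+p. (if Q p then f p else 0) \<partial>count_space A)"
proof -
  have "(\<integral>\<^sup>+p. f p \<partial>count_space {p \<in> A. Q p}) =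
      (\<integral>\<^sup>+p. f p * indicator {p \<in> A. Q p} p \<partial>count_space UNIV)"
    by (rule nn_integral_count_space_indicator) simp
  also have "\<dots> = (\<integral>\<^sup>+p. (if Q p then f p else 0) * indicator A p \<partial>count_space UNIV)"
    by (rule nn_integral_cong) (auto split: split_indicator)
  also have "\<dots> = (\<integral>\<^sup>+p. (if Q p then f p else 0) \<partial>count_space A)"
    by (rule nn_integral_count_space_indicator[symmetric]) simp
  finally show ?thesis .
qed

lemma ins_commute: "x \<noteq> y \<Longrightarrow> ins x s (ins y z \<mu>) = ins y z (ins x s \<mu>)"
  unfolding ins_def by auto

lemma ins_overwrite: "0 < z \<Longrightarrow> ins x z (ins x s \<mu>) = ins x z \<mu>"
  unfolding ins_def by auto

text \<open>Independence of the generated algebras makes the joint law a product, and Fubini freezes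
  the value of \<open>Y\<close>. In this way the mark of the origin is conditioned on.\<close>

lemma nn_integral_indep_pair:
  assumes "prob_space M" and X [measurable]: "X \<in> M \<rightarrow>\<^sub>M A" and Y [measurable]: "Y \<in> M \<rightarrow>\<^sub>M B"
    and indep: "prob_space.indep_set M (sets (vimage_algebra (space M) X A))
      (sets (vimage_algebra (space M) Y B))"
    and G [measurable]: "G \<in> borel_measurable (B \<Otimes>\<^sub>M A)"
  shows "(\<integral>\<^sup>+\<omega>. G (Y \<omega>, X \<omega>) \<partial>M) = (\<integral>\<^sup>+y. \<integral>\<^sup>+\<omega>. G (y, X \<omega>) \<partial>M \<partial>distr M B Y)"
proof -
  interpret prob_space M by fact
  interpret DY: prob_space "distr M B Y" by (rule prob_space_distr) simp
  interpret DX: prob_space "distr M A X" by (rule prob_space_distr) simp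
  have joint: "distr M B Y \<Otimes>\<^sub>M distr M A X = distr M (B \<Otimes>\<^sub>M A) (\<lambda>\<omega>. (Y \<omega>, X \<omega>))"
  proof (rule pair_measure_eqI)
    fix b a assume "b \<in> sets (distr M B Y)" "a \<in> sets (distr M A X)"
    then have ab [measurable]: "b \<in> sets B" "a \<in> sets A" by simp_all
    have "X -` a \<inter> space M \<in> sets (vimage_algebra (space M) X A)"
      "Y -` b \<inter> space M \<in> sets (vimage_algebra (space M) Y B)"
      using ab by (auto intro: in_vimage_algebra)
    then have "prob ((X -` a \<inter> space M) \<inter> (Y -` b \<inter> space M)) =
        prob (X -` a \<inter> space M) * prob (Y -` b \<inter> space M)"
      by (rule indep_setD[OF indep])
    moreover have "(\<lambda>\<omega>. (Y \<omega>, X \<omega>)) -` (b \<times> a) \<inter> space M =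
        (X -` a \<inter> space M) \<inter> (Y -` b \<inter> space M)" by auto
    ultimately show "emeasure (distr M B Y) b * emeasure (distr M A X) a =
        emeasure (distr M (B \<Otimes>\<^sub>M A) (\<lambda>\<omega>. (Y \<omega>, X \<omega>))) (b \<times> a)"
      by (simp add: emeasure_distr emeasure_eq_measure mult.commute flip: ennreal_mult)
  qed (unfold_locales, simp)
  have "(\<integral>\<^sup>+\<omega>. G (Y \<omega>, X \<omega>) \<partial>M) = (\<integral>\<^sup>+yx. G yx \<partial>(distr M B Y \<Otimes>\<^sub>M distr M A X))"
    unfolding joint by (subst nn_integral_distr) auto
  also have "\<dots> = (\<integral>\<^sup>+y. \<integral>\<^sup>+x. G (y, x) \<partial>distr M A X \<partial>distr M B Y)"
    by (subst DX.nn_integral_fst[symmetric]) auto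
  also have "\<dots> = (\<integral>\<^sup>+y. \<integral>\<^sup>+\<omega>. G (y, X \<omega>) \<partial>M \<partial>distr M B Y)"
    by (rule nn_integral_cong, subst nn_integral_distr) auto
  finally show ?thesis .
qed

text \<open>The origin is split off, and the Mecke equation is applied to the remaining points with
  the mark of the origin held fixed. Both contributions have the same form, so they combine into one
  integral over the position with respect to \<open>L\<close>, which is Lebesgue measure plus a unit
  mass at 0.\<close>

lemma palm_mecke:
  fixes P :: "'o \<Rightarrow> ('a::euclidean_space \<times> real) set"
  assumes "prob_space M" and P: "P \<in> M \<rightarrow>\<^sub>M config_algebra configs10"
    and m: "prob_space m" "sets m = sets borel" "AE s in m. 0 < s"
    and pois: "poisson_process M P (lborel \<Otimes>\<^sub>M m)"
    and Z: "Z \<in> borel_measurable M" "\<And>\<omega>. \<omega> \<in> space M \<Longrightarrow> 0 < Z \<omega>" "distr M borel Z = m"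
    and indep: "prob_space.indep_set M
      (sets (vimage_algebra (space M) P (config_algebra configs10)))
      (sets (vimage_algebra (space M) Z borel))"
  obtains L :: "'a measure" where "sigma_finite_measure L" "sets L = sets borel"
    "\<And>F. F \<in> borel_measurable (borel \<Otimes>\<^sub>M config_algebra configs10) \<Longrightarrow>
      (\<integral>\<^sup>+\<omega>. \<integral>\<^sup>+p. F (p, add_origin (P \<omega>) (Z \<omega>)) \<partial>count_space (add_origin (P \<omega>) (Z \<omega>)) \<partial>M) =
      (\<integral>\<^sup>+x. \<integral>\<^sup>+s. \<integral>\<^sup>+\<omega>. F ((x, s), ins x s (add_origin (P \<omega>) (Z \<omega>))) \<partial>M \<partial>m \<partial>L)"
proof -
  interpret prob_space M by fact
  interpret m: prob_space m by fact
  interpret Lm: pair_sigma_finite "lborel :: 'a measure" m ..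
  let ?\<Lambda> = "lborel \<Otimes>\<^sub>M m :: ('a \<times> real) measure"
  interpret m\<Lambda>: pair_sigma_finite m ?\<Lambda> ..
  let ?C = "configs10 :: ('a \<times> real) set set"
  have \<Lambda> [measurable_cong]: "sets ?\<Lambda> = sets (borel :: ('a \<times> real) measure)"
    unfolding borel_prod[symmetric] by (rule sets_pair_measure_cong) (simp_all add: m)
  note m(2) [measurable_cong]
  note P [measurable] Z(1) [measurable]
  obtain L :: "'a measure" where L: "sets L = sets borel"
    and nn_L: "\<And>f. f \<in> borel_measurable borel \<Longrightarrow> (\<integral>\<^sup>+x. f x \<partial>L) = f 0 + (\<integral>\<^sup>+x. f x \<partial>lborel)"
  proof (rule nn_integral_functional[of borel "\<lambda>f. f 0 + (\<integral>\<^sup>+x. f x \<partial>lborel)"])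
    fix f g :: "'a \<Rightarrow> ennreal"
    assume fg: "f \<in> borel_measurable borel" "g \<in> borel_measurable borel"
    show "f 0 + g 0 + (\<integral>\<^sup>+x. f x + g x \<partial>lborel) =
        f 0 + (\<integral>\<^sup>+x. f x \<partial>lborel) + (g 0 + (\<integral>\<^sup>+x. g x \<partial>lborel))"
      using fg by (subst nn_integral_add) (auto simp: ac_simps)
    assume "\<And>x. x \<in> space borel \<Longrightarrow> f x = g x"
    then show "f 0 + (\<integral>\<^sup>+x. f x \<partial>lborel) = g 0 + (\<integral>\<^sup>+x. g x \<partial>lborel)" by simp
  next
    fix f :: "'a \<Rightarrow> ennreal" and c
    assume "f \<in> borel_measurable borel"
    then show "c * f 0 + (\<integral>\<^sup>+x. c * f x \<partial>lborel) = c * (f 0 + (\<integral>\<^sup>+x. f x \<partial>lborel))"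
      by (simp add: nn_integral_cmult distrib_left)
  next
    fix F :: "nat \<Rightarrow> 'a \<Rightarrow> ennreal"
    assume F: "\<And>i. F i \<in> borel_measurable borel" "incseq F"
    have "(\<integral>\<^sup>+x. (SUP i. F i x) \<partial>lborel) = (SUP i. \<integral>\<^sup>+x. F i x \<partial>lborel)"
      by (rule nn_integral_monotone_convergence_SUP) (use F in auto)
    moreover have "incseq (\<lambda>i. F i 0)" "incseq (\<lambda>i. \<integral>\<^sup>+x. F i x \<partial>lborel)"
      using F(2) by (auto simp: incseq_def le_fun_def intro!: nn_integral_mono)
    ultimately show "(SUP i. F i 0) + (\<integral>\<^sup>+x. (SUP i. F i x) \<partial>lborel) =
        (SUP i. F i 0 + (\<integral>\<^sup>+x. F i x \<partial>lborel))"
      by (simp add: ennreal_SUP_add)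
  qed auto
  have "sigma_finite_measure L"
  proof
    show "\<exists>A. countable A \<and> A \<subseteq> sets L \<and> \<Union> A = space L \<and> (\<forall>a\<in>A. emeasure L a \<noteq> \<infinity>)"
    proof (intro exI[of _ "range (\<lambda>n::nat. ball 0 (real n))"] conjI ballI)
      show "\<Union> (range (\<lambda>n::nat. ball (0::'a) (real n))) = space L"
        using ball_cover[where 'a='a] sets_eq_imp_space_eq[OF L] by auto
      fix a assume "a \<in> range (\<lambda>n::nat. ball (0::'a) (real n))"
      then obtain n where a: "a = ball 0 (real n)" by auto
      have "emeasure L a = (\<integral>\<^sup>+x. indicator a x \<partial>L)" by (simp add: a L)
      also have "\<dots> = indicator a 0 + emeasure lborel a"
        using nn_L[of "indicator a"] by (simp add: a borel_measurable_indicator)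
      finally show "emeasure L a \<noteq> \<infinity>"
        using emeasure_bounded_finite[OF bounded_ball, of "0::'a" "real n"]
        by (auto simp: a split: split_indicator)
    qed (auto simp: L)
  qed
  moreover note L
  moreover have "(\<integral>\<^sup>+\<omega>. \<integral>\<^sup>+p. F (p, add_origin (P \<omega>) (Z \<omega>)) \<partial>count_space (add_origin (P \<omega>) (Z \<omega>)) \<partial>M) =
      (\<integral>\<^sup>+x. \<integral>\<^sup>+s. \<integral>\<^sup>+\<omega>. F ((x, s), ins x s (add_origin (P \<omega>) (Z \<omega>))) \<partial>M \<partial>m \<partial>L)"
    if F [measurable]: "F \<in> borel_measurable (borel \<Otimes>\<^sub>M config_algebra configs10)" for F
  proof -
    have Pt [measurable]: "(\<lambda>\<omega>. add_origin (P \<omega>) (Z \<omega>)) \<in> M \<rightarrow>\<^sub>M config_algebra ?C"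
    proof -
      have "(\<lambda>\<omega>. ins 0 (Z \<omega>) (P \<omega>)) \<in> M \<rightarrow>\<^sub>M config_algebra ?C" by (rule measurable_ins) measurable
      then show ?thesis by (subst measurable_cong) (auto simp: add_origin_eq_ins Z(2))
    qed
    let ?Q = "\<lambda>\<omega>. add_origin (P \<omega>) (Z \<omega>)"
    \<comment> \<open>The guard mirrors the deletion of points located at the origin in
      \<open>add_origin\<close>.\<close>
    let ?G = "\<lambda>z \<mu>. \<integral>\<^sup>+p. (if fst p \<noteq> 0 then F (p, ins 0 z \<mu>) else 0) \<partial>count_space \<mu>"
    have ins1 [measurable]: "(\<lambda>y. ins 0 (fst y) (snd y)) \<in> borel \<Otimes>\<^sub>M config_algebra ?C \<rightarrow>\<^sub>M config_algebra ?C"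
      by (rule measurable_ins) measurable
    have ins2 [measurable]: "(\<lambda>y. ins 0 (fst (fst y)) (snd (fst y))) \<in>
        (borel \<Otimes>\<^sub>M config_algebra ?C) \<Otimes>\<^sub>M (borel :: ('a \<times> real) measure) \<rightarrow>\<^sub>M config_algebra ?C"
      by (rule measurable_ins) measurable
    have G [measurable]: "(\<lambda>y. ?G (fst y) (snd y)) \<in> borel_measurable (borel \<Otimes>\<^sub>M config_algebra ?C)"
    proof -
      have "(\<lambda>yp. if fst (snd yp) \<noteq> 0 then F (snd yp, ins 0 (fst (fst yp)) (snd (fst yp))) else 0) \<in>
          borel_measurable ((borel \<Otimes>\<^sub>M config_algebra ?C) \<Otimes>\<^sub>M (borel :: ('a \<times> real) measure))"
        by measurable
      from borel_measurable_nn_integral_count_space[OF measurable_snd sigma_finite_configs_configs10 this]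
      show ?thesis by (simp cong: if_cong)
    qed
    have "(\<integral>\<^sup>+\<omega>. \<integral>\<^sup>+p. F (p, ?Q \<omega>) \<partial>count_space (?Q \<omega>) \<partial>M) =
        (\<integral>\<^sup>+\<omega>. F ((0, Z \<omega>), ins 0 (Z \<omega>) (P \<omega>)) + ?G (Z \<omega>) (P \<omega>) \<partial>M)"
    proof (rule nn_integral_cong)
      fix \<omega> assume "\<omega> \<in> space M"
      then have "0 < Z \<omega>" by (rule Z(2))
      have "(\<integral>\<^sup>+p. F (p, ?Q \<omega>) \<partial>count_space (?Q \<omega>)) =
          F ((0, Z \<omega>), ?Q \<omega>) + (\<integral>\<^sup>+p. F (p, ?Q \<omega>) \<partial>count_space {p \<in> P \<omega>. fst p \<noteq> 0})"
        unfolding add_origin_def by (rule nn_integral_count_space_insert) simp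
      then show "(\<integral>\<^sup>+p. F (p, ?Q \<omega>) \<partial>count_space (?Q \<omega>)) =
          F ((0, Z \<omega>), ins 0 (Z \<omega>) (P \<omega>)) + ?G (Z \<omega>) (P \<omega>)"
        unfolding nn_integral_count_space_filter add_origin_eq_ins[OF \<open>0 < Z \<omega>\<close>] .
    qed
    also have "\<dots> = (\<integral>\<^sup>+\<omega>. F ((0, Z \<omega>), ins 0 (Z \<omega>) (P \<omega>)) \<partial>M) + (\<integral>\<^sup>+\<omega>. ?G (Z \<omega>) (P \<omega>) \<partial>M)"
    proof (rule nn_integral_add)
      have "(\<lambda>\<omega>. ins 0 (Z \<omega>) (P \<omega>)) \<in> M \<rightarrow>\<^sub>M config_algebra ?C" by (rule measurable_ins) measurable
      then show "(\<lambda>\<omega>. F ((0, Z \<omega>), ins 0 (Z \<omega>) (P \<omega>))) \<in> borel_measurable M" by measurable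
      have "(\<lambda>\<omega>. (Z \<omega>, P \<omega>)) \<in> M \<rightarrow>\<^sub>M borel \<Otimes>\<^sub>M config_algebra ?C" by measurable
      from measurable_compose[OF this G] show "(\<lambda>\<omega>. ?G (Z \<omega>) (P \<omega>)) \<in> borel_measurable M"
        by (simp cong: if_cong)
    qed
    also have "(\<integral>\<^sup>+\<omega>. F ((0, Z \<omega>), ins 0 (Z \<omega>) (P \<omega>)) \<partial>M) =
        (\<integral>\<^sup>+s. \<integral>\<^sup>+\<omega>. F ((0, s), ins 0 s (?Q \<omega>)) \<partial>M \<partial>m)"
    proof -
      have "(\<lambda>y. F ((0, fst y), ins 0 (fst y) (snd y))) \<in> borel_measurable (borel \<Otimes>\<^sub>M config_algebra ?C)"
        by measurable
      from nn_integral_indep_pair[OF assms(1) P Z(1) indep this]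
      have "(\<integral>\<^sup>+\<omega>. F ((0, Z \<omega>), ins 0 (Z \<omega>) (P \<omega>)) \<partial>M) =
          (\<integral>\<^sup>+s. \<integral>\<^sup>+\<omega>. F ((0, s), ins 0 s (P \<omega>)) \<partial>M \<partial>m)" by (simp add: Z(3))
      \<comment> \<open>The mark \<open>s\<close> inserted at 0 overwrites the mark of the origin,
        so \<open>P\<close> may be replaced by the Palm version inside \<open>ins\<close>.\<close>
      also have "\<dots> = (\<integral>\<^sup>+s. \<integral>\<^sup>+\<omega>. F ((0, s), ins 0 s (?Q \<omega>)) \<partial>M \<partial>m)"
      proof (rule nn_integral_cong_AE, use m(3) in eventually_elim)
        fix s :: real assume "0 < s"
        then show "(\<integral>\<^sup>+\<omega>. F ((0, s), ins 0 s (P \<omega>)) \<partial>M) = (\<integral>\<^sup>+\<omega>. F ((0, s), ins 0 s (?Q \<omega>)) \<partial>M)"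
          by (intro nn_integral_cong) (simp add: add_origin_eq_ins Z(2) ins_overwrite)
      qed
      finally show ?thesis .
    qed
    also have "(\<integral>\<^sup>+\<omega>. ?G (Z \<omega>) (P \<omega>) \<partial>M) =
        (\<integral>\<^sup>+x. \<integral>\<^sup>+s. \<integral>\<^sup>+\<omega>. F ((x, s), ins x s (?Q \<omega>)) \<partial>M \<partial>m \<partial>lborel)"
    proof -
      let ?H = "\<lambda>p z \<mu>. F (p, ins (fst p) (snd p) (ins 0 z \<mu>))"
      have H: "(\<lambda>y. ?H (snd (fst y)) (fst (fst y)) (P (snd y))) \<in> borel_measurable ((m \<Otimes>\<^sub>M ?\<Lambda>) \<Otimes>\<^sub>M M)"
      proof -
        have [measurable]: "(\<lambda>y. ins 0 (fst (fst y)) (P (snd y))) \<in> (m \<Otimes>\<^sub>M ?\<Lambda>) \<Otimes>\<^sub>M M \<rightarrow>\<^sub>M config_algebra ?C"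
          by (rule measurable_ins) measurable
        have [measurable]: "(\<lambda>y. ins (fst (snd (fst y))) (snd (snd (fst y))) (ins 0 (fst (fst y)) (P (snd y)))) \<in>
            (m \<Otimes>\<^sub>M ?\<Lambda>) \<Otimes>\<^sub>M M \<rightarrow>\<^sub>M config_algebra ?C"
          by (rule measurable_ins) measurable
        show ?thesis by measurable
      qed
      have "(\<integral>\<^sup>+\<omega>. ?G (Z \<omega>) (P \<omega>) \<partial>M) = (\<integral>\<^sup>+z. \<integral>\<^sup>+\<omega>. ?G z (P \<omega>) \<partial>M \<partial>m)"
        using nn_integral_indep_pair[OF assms(1) P Z(1) indep G] by (simp add: Z(3) cong: if_cong)
      also have "\<dots> = (\<integral>\<^sup>+z. \<integral>\<^sup>+p. \<integral>\<^sup>+\<omega>. ?H p z (P \<omega>) \<partial>M \<partial>?\<Lambda> \<partial>m)"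
      proof (rule nn_integral_cong_AE, use m(3) in eventually_elim)
        fix z :: real assume z: "0 < z"
        have "(\<lambda>y. if fst (fst y) \<noteq> 0 then F (fst y, ins 0 z (snd y)) else 0) \<in>
            borel_measurable ((borel :: ('a \<times> real) measure) \<Otimes>\<^sub>M config_algebra ?C)"
        proof -
          have [measurable]: "(\<lambda>y. ins 0 z (snd y)) \<in> (borel :: ('a \<times> real) measure) \<Otimes>\<^sub>M config_algebra ?C \<rightarrow>\<^sub>M config_algebra ?C"
            by (rule measurable_ins) measurable
          show ?thesis by measurable
        qed
        from mecke[OF assms(1) P m pois this]
        have "(\<integral>\<^sup>+\<omega>. ?G z (P \<omega>) \<partial>M) = (\<integral>\<^sup>+p. \<integral>\<^sup>+\<omega>. (if fst p \<noteq> 0 then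
            F (p, ins 0 z (ins (fst p) (snd p) (P \<omega>))) else 0) \<partial>M \<partial>?\<Lambda>)"
          by (simp cong: if_cong)
        also have "\<dots> = (\<integral>\<^sup>+p. \<integral>\<^sup>+\<omega>. ?H p z (P \<omega>) \<partial>M \<partial>?\<Lambda>)"
        proof (rule nn_integral_cong_AE)
          \<comment> \<open>Insertions at 0 and at another position commute, and the single position
            0 is null for Lebesgue measure.\<close>
          have "AE x in (lborel :: 'a measure). x \<noteq> 0" by (rule AE_lborel_singleton)
          then have "AE p in ?\<Lambda>. fst p \<noteq> 0"
          proof (intro Lm.AE_pair_measure)
            have "{p \<in> space (borel :: ('a \<times> real) measure). fst p \<noteq> 0} \<in> sets borel" by measurable
            then show "{p \<in> space ?\<Lambda>. fst p \<noteq> 0} \<in> sets ?\<Lambda>"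
              by (simp only: \<Lambda> sets_eq_imp_space_eq[OF \<Lambda>])
          qed simp
          then show "AE p in ?\<Lambda>. (\<integral>\<^sup>+\<omega>. (if fst p \<noteq> 0 then
              F (p, ins 0 z (ins (fst p) (snd p) (P \<omega>))) else 0) \<partial>M) = (\<integral>\<^sup>+\<omega>. ?H p z (P \<omega>) \<partial>M)"
            by eventually_elim (simp add: ins_commute)
        qed
        finally show "(\<integral>\<^sup>+\<omega>. ?G z (P \<omega>) \<partial>M) = (\<integral>\<^sup>+p. \<integral>\<^sup>+\<omega>. ?H p z (P \<omega>) \<partial>M \<partial>?\<Lambda>)" .
      qed
      also have "\<dots> = (\<integral>\<^sup>+p. \<integral>\<^sup>+z. \<integral>\<^sup>+\<omega>. ?H p z (P \<omega>) \<partial>M \<partial>m \<partial>?\<Lambda>)"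
        using borel_measurable_nn_integral_fst[OF H]
        by (intro m\<Lambda>.Fubini'[symmetric]) (simp add: case_prod_beta')
      also have "\<dots> = (\<integral>\<^sup>+p. \<integral>\<^sup>+\<omega>. F (p, ins (fst p) (snd p) (?Q \<omega>)) \<partial>M \<partial>?\<Lambda>)"
      proof (rule nn_integral_cong)
        fix p
        have "(\<lambda>y. ?H p (fst y) (snd y)) \<in> borel_measurable (borel \<Otimes>\<^sub>M config_algebra ?C)"
        proof -
          have [measurable]: "(\<lambda>y. ins (fst p) (snd p) (ins 0 (fst y) (snd y))) \<in>
              borel \<Otimes>\<^sub>M config_algebra ?C \<rightarrow>\<^sub>M config_algebra ?C"
            by (rule measurable_ins) measurable
          show ?thesis by measurable
        qed
        from nn_integral_indep_pair[OF assms(1) P Z(1) indep this]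
        have "(\<integral>\<^sup>+z. \<integral>\<^sup>+\<omega>. ?H p z (P \<omega>) \<partial>M \<partial>m) = (\<integral>\<^sup>+\<omega>. ?H p (Z \<omega>) (P \<omega>) \<partial>M)" by (simp add: Z(3))
        also have "\<dots> = (\<integral>\<^sup>+\<omega>. F (p, ins (fst p) (snd p) (?Q \<omega>)) \<partial>M)"
          by (rule nn_integral_cong) (simp add: add_origin_eq_ins Z(2))
        finally show "(\<integral>\<^sup>+z. \<integral>\<^sup>+\<omega>. ?H p z (P \<omega>) \<partial>M \<partial>m) =
            (\<integral>\<^sup>+\<omega>. F (p, ins (fst p) (snd p) (?Q \<omega>)) \<partial>M)" .
      qed
      also have "\<dots> = (\<integral>\<^sup>+x. \<integral>\<^sup>+s. \<integral>\<^sup>+\<omega>. F ((x, s), ins x s (?Q \<omega>)) \<partial>M \<partial>m \<partial>lborel)"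
      proof -
        have [measurable]: "(\<lambda>y. ins (fst (fst y)) (snd (fst y)) (?Q (snd y))) \<in> ?\<Lambda> \<Otimes>\<^sub>M M \<rightarrow>\<^sub>M config_algebra ?C"
          by (rule measurable_ins) measurable
        have "(\<lambda>y. F (fst y, ins (fst (fst y)) (snd (fst y)) (?Q (snd y)))) \<in> borel_measurable (?\<Lambda> \<Otimes>\<^sub>M M)"
          by measurable
        from borel_measurable_nn_integral_fst[OF this]
        show ?thesis by (subst m.nn_integral_fst[symmetric]) simp_all
      qed
      finally show ?thesis .
    qed
    also have "(\<integral>\<^sup>+s. \<integral>\<^sup>+\<omega>. F ((0, s), ins 0 s (?Q \<omega>)) \<partial>M \<partial>m) +
        (\<integral>\<^sup>+x. \<integral>\<^sup>+s. \<integral>\<^sup>+\<omega>. F ((x, s), ins x s (?Q \<omega>)) \<partial>M \<partial>m \<partial>lborel) =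
        (\<integral>\<^sup>+x. \<integral>\<^sup>+s. \<integral>\<^sup>+\<omega>. F ((x, s), ins x s (?Q \<omega>)) \<partial>M \<partial>m \<partial>L)"
    proof (rule nn_L[symmetric])
      have bm [measurable_cong]: "sets ((borel :: 'a measure) \<Otimes>\<^sub>M m) = sets (borel :: ('a \<times> real) measure)"
        unfolding borel_prod[symmetric] by (rule sets_pair_measure_cong) (simp_all add: m)
      have [measurable]: "(\<lambda>y. ins (fst (fst y)) (snd (fst y)) (?Q (snd y))) \<in>
          ((borel :: 'a measure) \<Otimes>\<^sub>M m) \<Otimes>\<^sub>M M \<rightarrow>\<^sub>M config_algebra ?C"
        by (rule measurable_ins) measurable
      have "(\<lambda>y. F (fst y, ins (fst (fst y)) (snd (fst y)) (?Q (snd y)))) \<in>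
          borel_measurable (((borel :: 'a measure) \<Otimes>\<^sub>M m) \<Otimes>\<^sub>M M)"
        by measurable
      from m.borel_measurable_nn_integral_fst[OF borel_measurable_nn_integral_fst[OF this]]
      show "(\<lambda>x. \<integral>\<^sup>+s. \<integral>\<^sup>+\<omega>. F ((x, s), ins x s (?Q \<omega>)) \<partial>M \<partial>m) \<in> borel_measurable borel" by simp
    qed
    finally show ?thesis .
  qed
  ultimately show thesis by (rule that)
qed

section \<open>A single large score\<close>

lemma fst_image_ins: "0 < s \<Longrightarrow> fst ` ins x s \<nu> = insert x (fst ` \<nu>)"
  unfolding ins_def by (auto simp: image_iff)

lemma score_at_ins:
  fixes \<nu> :: "('a::euclidean_space \<times> real) set"
  assumes \<nu>: "\<nu> \<in> configs10" and s: "0 < s" and y: "y \<in> insert x (fst ` \<nu>)"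
  shows "score_at (ins x s \<nu>) y = (if y = x then s else score_at \<nu> y)"
proof (rule score_at_eq)
  show "ins x s \<nu> \<in> configs" using ins_in_configs10[OF \<nu>] configs10_subset by blast
  have "(y, score_at \<nu> y) \<in> \<nu>" if "y \<noteq> x"
    using score_at_mem[of \<nu> y] \<nu> configs10_subset that y by blast
  then show "(y, if y = x then s else score_at \<nu> y) \<in> ins x s \<nu>"
    using s by (auto simp: ins_def)
qed

text \<open>The inserted mark is of order \<open>u\<close> while all others are fixed and contribute
  at most a constant, which vanishes after division by \<open>u\<close>. The positions, and with
  them the neighbourhoods, do not change with \<open>n\<close>.\<close>

lemma scoring_single_large_limit:
  fixes \<Phi> :: "'a::euclidean_space \<Rightarrow> 'a set \<Rightarrow> 'a set"
  assumes \<Phi>: "neighbourhood_map \<Phi>" and w: "\<And>x. 0 \<le> w x" and \<nu>: "\<nu> \<in> configs10"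
    and t: "t \<in> insert x (fst ` \<nu>)"
    and u: "filterlim u at_top sequentially" "\<And>n. 0 < u n"
    and s: "\<forall>\<^sub>F n in sequentially. 0 < s n" "s \<longlonglongrightarrow> s'"
  shows "(\<lambda>n. scoring \<Phi> w t (ins x (u n * s n) \<nu>) / u n) \<longlonglongrightarrow>
    (if x \<in> \<Phi> t (insert x (fst ` \<nu>)) then w (x - t) * s' else 0)"
proof -
  let ?I = "insert x (fst ` \<nu>)"
  let ?b = "\<lambda>r. if x \<in> \<Phi> t ?I then w (x - t) * r else 0"
  have \<nu>': "\<nu> \<in> configs" using \<nu> configs10_subset by blast
  have "?I \<in> ground_configs"
    using fst_image_configs10[OF ins_in_configs10[OF \<nu>, of x 1]] by (simp add: fst_image_ins)
  note A = neighbourhood_mapD[OF \<Phi> this t]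
  \<comment> \<open>The sum is a crude bound for the maximum over the other points of the
    neighbourhood.\<close>
  define D where "D = (\<Sum>y\<in>\<Phi> t ?I - {x}. w (y - t) * score_at \<nu> y)"
  have pos: "0 \<le> w (y - t) * score_at \<nu> y" if "y \<in> \<Phi> t ?I - {x}" for y
  proof -
    have "y \<in> fst ` \<nu>" using that A(2) by auto
    then show ?thesis using score_at_pos[OF \<nu>', of y] w[of "y - t"] by simp
  qed
  have sandwich: "?b (s n) \<le> scoring \<Phi> w t (ins x (u n * s n) \<nu>) / u n \<and>
      scoring \<Phi> w t (ins x (u n * s n) \<nu>) / u n \<le> ?b (s n) + D / u n" if sn: "0 < s n" for n
  proof -
    let ?\<mu> = "ins x (u n * s n) \<nu>"
    have us: "0 < u n * s n" using u(2) sn by simp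
    have I: "fst ` ?\<mu> = ?I" by (rule fst_image_ins[OF us])
    have \<mu>: "?\<mu> \<in> configs10" by (rule ins_in_configs10[OF \<nu>])
    have t': "t \<in> fst ` ?\<mu>" using t I by simp
    have sc: "score_at ?\<mu> y = (if y = x then u n * s n else score_at \<nu> y)" if "y \<in> \<Phi> t ?I" for y
      using A(2) that by (intro score_at_ins[OF \<nu> us]) auto
    have "u n * ?b (s n) \<le> scoring \<Phi> w t ?\<mu>"
    proof (cases "x \<in> \<Phi> t ?I")
      case True
      then have "w (x - t) * score_at ?\<mu> x \<le> scoring \<Phi> w t ?\<mu>"
        by (intro scoring_ge[OF \<Phi> \<mu> t']) (simp only: I)
      then show ?thesis
        using sc[OF True] True by (simp add: mult.left_commute)
    next
      case False
      have "0 \<le> w (t - t) * score_at ?\<mu> t"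
        using score_at_pos[of ?\<mu> t] \<mu> configs10_subset t' w by (intro mult_nonneg_nonneg) auto
      also have "\<dots> \<le> scoring \<Phi> w t ?\<mu>"
        by (rule scoring_ge[OF \<Phi> \<mu> t']) (use A(3) I in simp)
      finally show ?thesis using False by simp
    qed
    moreover have "scoring \<Phi> w t ?\<mu> \<le> u n * ?b (s n) + D"
      unfolding scoring_le_iff[OF \<Phi> \<mu> t'] I
    proof
      fix y assume y: "y \<in> \<Phi> t ?I"
      have D0: "0 \<le> D" unfolding D_def by (rule sum_nonneg) (rule pos)
      have b0: "0 \<le> u n * ?b (s n)" using u(2)[of n] sn w[of "x - t"] by auto
      show "w (y - t) * score_at ?\<mu> y \<le> u n * ?b (s n) + D"
      proof (cases "y = x")
        case True
        then show ?thesis using y D0 sc[OF y] by (simp add: mult_ac)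
      next
        case False
        then have "w (y - t) * score_at \<nu> y \<le> D"
          unfolding D_def using y A(1) by (intro member_le_sum pos) auto
        then show ?thesis using False sc[OF y] b0 by simp
      qed
    qed
    ultimately show ?thesis using u(2)[of n] by (simp add: field_simps)
  qed
  have lim1: "(\<lambda>n. ?b (s n)) \<longlonglongrightarrow> ?b s'"
    by (cases "x \<in> \<Phi> t ?I") (auto intro!: tendsto_intros s(2))
  have "(\<lambda>n. D / u n) \<longlonglongrightarrow> 0"
    by (rule tendsto_divide_0[OF tendsto_const]) (rule filterlim_at_top_imp_at_infinity[OF u(1)])
  then have lim2: "(\<lambda>n. ?b (s n) + D / u n) \<longlonglongrightarrow> ?b s'"
    using tendsto_add[OF lim1] by fastforce
  show ?thesis
    by (rule tendsto_sandwich[OF _ _ lim1 lim2]) (use s(1) sandwich in \<open>auto elim!: eventually_mono\<close>)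
qed

text \<open>The scaled processes are eventually graphs over the same positions, so the limits of the
  single scores give the vague limit. For \<open>s' = \<eta> / w x\<close> this limit is the cluster
  generated by \<open>x\<close>.\<close>

lemma moving_maxima_single_large_limit:
  fixes \<Phi> :: "'a::euclidean_space \<Rightarrow> 'a set \<Rightarrow> 'a set"
  assumes \<Phi>: "neighbourhood_map \<Phi>" and w: "\<And>x. 0 \<le> w x" "w 0 = 1" and \<nu>: "\<nu> \<in> configs10"
    and u: "filterlim u at_top sequentially" "\<And>n. 0 < u n"
    and s: "\<forall>\<^sub>F n in sequentially. 0 < s n" "s \<longlonglongrightarrow> s'"
  shows "limitin vague_topology (\<lambda>n. scaling 1 (u n) (moving_maxima \<Phi> w (ins x (u n * s n) \<nu>)))
    (graph_config (insert x (fst ` \<nu>)) (\<lambda>t. if x \<in> \<Phi> t (insert x (fst ` \<nu>)) then w (x - t) * s' else 0))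
    sequentially"
proof (rule limitin_transform_eventually)
  let ?I = "insert x (fst ` \<nu>)"
  have I: "?I \<in> ground_configs"
    using fst_image_configs10[OF ins_in_configs10[OF \<nu>, of x 1]] by (simp add: fst_image_ins)
  show "limitin vague_topology
      (\<lambda>n. graph_config ?I (\<lambda>t. scoring \<Phi> w t (ins x (u n * s n) \<nu>) / u n))
      (graph_config ?I (\<lambda>t. if x \<in> \<Phi> t ?I then w (x - t) * s' else 0)) sequentially"
    by (rule limitin_graph_config[OF I scoring_single_large_limit[OF \<Phi> w(1) \<nu> _ u s(1,2)]])
  show "\<forall>\<^sub>F n in sequentially. graph_config ?I (\<lambda>t. scoring \<Phi> w t (ins x (u n * s n) \<nu>) / u n) =
      scaling 1 (u n) (moving_maxima \<Phi> w (ins x (u n * s n) \<nu>))"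
    using s(1)
  proof eventually_elim
    case (elim n)
    then have "0 < u n * s n" using u(2) by simp
    then show ?case
      by (simp add: moving_maxima_eq_graph[where w=w, OF \<Phi> ins_in_configs10[OF \<nu>] w(2)]
          scaling_graph_config[OF u(2)] fst_image_ins)
  qed
qed

section \<open>Exceedances at the origin\<close>

definition exceedances ::
  "('a::euclidean_space \<Rightarrow> 'a set \<Rightarrow> 'a set) \<Rightarrow> ('a \<Rightarrow> real) \<Rightarrow> real \<Rightarrow> ('a \<times> real) set \<Rightarrow>
     ('a \<times> real) set" where
  "exceedances \<Phi> w u \<mu> = {p \<in> \<mu>. fst p \<in> \<Phi> 0 (fst ` \<mu>) \<and> u < w (fst p) * snd p}"

lemma finite_exceedances:
  fixes \<Phi> :: "'a::euclidean_space \<Rightarrow> 'a set \<Rightarrow> 'a set"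
  assumes \<Phi>: "neighbourhood_map \<Phi>" and \<mu>: "\<mu> \<in> configs10" "0 \<in> fst ` \<mu>"
  shows "finite (exceedances \<Phi> w u \<mu>)"
proof (rule finite_imageD)
  have "fst ` exceedances \<Phi> w u \<mu> \<subseteq> \<Phi> 0 (fst ` \<mu>)" by (auto simp: exceedances_def)
  then show "finite (fst ` exceedances \<Phi> w u \<mu>)"
    using neighbourhood_mapD(1)[OF \<Phi> fst_image_configs10[OF \<mu>(1)] \<mu>(2)] by (rule finite_subset)
  show "inj_on fst (exceedances \<Phi> w u \<mu>)"
    using \<mu>(1) by (intro inj_onI) (auto simp: exceedances_def configs10_iff simple_config_iff)
qed

lemma exceedances_eq_empty_iff:
  fixes \<Phi> :: "'a::euclidean_space \<Rightarrow> 'a set \<Rightarrow> 'a set"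
  assumes \<Phi>: "neighbourhood_map \<Phi>" and \<mu>: "\<mu> \<in> configs10" "0 \<in> fst ` \<mu>"
  shows "exceedances \<Phi> w u \<mu> \<noteq> {} \<longleftrightarrow> u < scoring \<Phi> w 0 \<mu>"
proof -
  have \<mu>': "\<mu> \<in> configs" using \<mu> configs10_subset by blast
  show ?thesis
    unfolding less_scoring_iff[OF \<Phi> \<mu>]
  proof
    assume "exceedances \<Phi> w u \<mu> \<noteq> {}"
    then obtain x s where "(x, s) \<in> \<mu>" "x \<in> \<Phi> 0 (fst ` \<mu>)" "u < w x * s"
      by (auto simp: exceedances_def)
    then show "\<exists>x\<in>\<Phi> 0 (fst ` \<mu>). u < w (x - 0) * score_at \<mu> x"
      using score_at_eq[OF \<mu>'] by auto
  next
    assume "\<exists>x\<in>\<Phi> 0 (fst ` \<mu>). u < w (x - 0) * score_at \<mu> x"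
    then obtain x where x: "x \<in> \<Phi> 0 (fst ` \<mu>)" "u < w x * score_at \<mu> x" by auto
    then have "(x, score_at \<mu> x) \<in> \<mu>"
      using neighbourhood_mapD(2)[OF \<Phi> fst_image_configs10[OF \<mu>(1)] \<mu>(2)]
      by (intro score_at_mem[OF \<mu>']) auto
    then show "exceedances \<Phi> w u \<mu> \<noteq> {}" using x by (auto simp: exceedances_def)
  qed
qed

text \<open>The neighbourhood of the origin is finite and its other marks are fixed, so
  \<open>u n\<close> eventually dominates their weighted values, whereas
  \<open>s n > 1 / w x\<close> keeps the inserted point an exceedance. The division by the number of
  exceedances thus disappears in the limit.\<close>

lemma exceedances_single_large:
  fixes \<Phi> :: "'a::euclidean_space \<Rightarrow> 'a set \<Rightarrow> 'a set"
  assumes \<Phi>: "neighbourhood_map \<Phi>" and \<nu>: "\<nu> \<in> configs10" and zero: "0 \<in> fst ` \<nu>"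
    and x: "x \<in> \<Phi> 0 (insert x (fst ` \<nu>))" "0 < w x"
    and u: "filterlim u at_top sequentially" "\<And>n. 0 < u n"
    and s: "\<forall>\<^sub>F n in sequentially. 1 / w x < s n"
  shows "\<forall>\<^sub>F n in sequentially. exceedances \<Phi> w (u n) (ins x (u n * s n) \<nu>) = {(x, u n * s n)}"
proof -
  let ?I = "insert x (fst ` \<nu>)"
  have \<nu>': "\<nu> \<in> configs" using \<nu> configs10_subset by blast
  have "?I \<in> ground_configs"
    using fst_image_configs10[OF ins_in_configs10[OF \<nu>, of x 1]] by (simp add: fst_image_ins)
  note A = neighbourhood_mapD[OF \<Phi> this, of 0]
  have "\<forall>\<^sub>F n in sequentially. \<forall>y\<in>\<Phi> 0 ?I. w y * score_at \<nu> y \<le> u n"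
    using u(1) A(1) zero by (intro eventually_ball_finite) (auto simp: filterlim_at_top)
  then show ?thesis
    using s
  proof eventually_elim
    case (elim n)
    have "0 < 1 / w x" using x(2) by simp
    then have "0 < s n" using elim(2) by linarith
    then have us: "0 < u n * s n" using u(2) by simp
    have "u n < w x * (u n * s n)"
      using elim(2) x(2) u(2)[of n] by (simp add: field_simps)
    moreover have False if "(y, z) \<in> \<nu>" "y \<noteq> x" "y \<in> \<Phi> 0 ?I" "u n < w y * z" for y z
      using elim(1) that score_at_eq[OF \<nu>' that(1)] by fastforce
    moreover have I: "fst ` ins x (u n * s n) \<nu> = ?I" by (rule fst_image_ins[OF us])
    ultimately show ?case
      unfolding exceedances_def I using us x(1) by (auto simp: ins_def) blast+
  qed
qed

text \<open>
  Averaging over the exceedances at the origin writes a function of the process on the event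
  \<open>\<xi> > u\<close> as a sum over single points, to which the Mecke equation applies.
\<close>

definition exceedance_share ::
  "('a::euclidean_space \<Rightarrow> 'a set \<Rightarrow> 'a set) \<Rightarrow> ('a \<Rightarrow> real) \<Rightarrow> (('a \<times> real) set \<Rightarrow> real) \<Rightarrow> real \<Rightarrow>
     ('a \<times> real) \<Rightarrow> ('a \<times> real) set \<Rightarrow> ennreal" where
  "exceedance_share \<Phi> w f u p \<mu> =
     (if fst p \<in> \<Phi> 0 (fst ` \<mu>) \<and> u < w (fst p) * snd p
      then ennreal (f (scaling 1 u (moving_maxima \<Phi> w \<mu>)) / real (card (exceedances \<Phi> w u \<mu>)))
      else 0)"

text \<open>Equal shares of the exceedances add up to the whole value; without exceedances the sum
  is empty and the score at the origin does not exceed \<open>u\<close>.\<close>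

lemma nn_integral_exceedance_share:
  fixes \<Phi> :: "'a::euclidean_space \<Rightarrow> 'a set \<Rightarrow> 'a set"
  assumes \<Phi>: "neighbourhood_map \<Phi>" and \<mu>: "\<mu> \<in> configs10" "0 \<in> fst ` \<mu>"
    and f: "0 \<le> f (scaling 1 u (moving_maxima \<Phi> w \<mu>))"
  shows "(\<integral>\<^sup>+p. exceedance_share \<Phi> w f u p \<mu> \<partial>count_space \<mu>) =
    (if u < scoring \<Phi> w 0 \<mu> then ennreal (f (scaling 1 u (moving_maxima \<Phi> w \<mu>))) else 0)"
proof -
  let ?E = "exceedances \<Phi> w u \<mu>" and ?c = "f (scaling 1 u (moving_maxima \<Phi> w \<mu>))"
  have fin: "finite ?E" by (rule finite_exceedances[OF \<Phi> \<mu>])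
  have "(\<integral>\<^sup>+p. exceedance_share \<Phi> w f u p \<mu> \<partial>count_space \<mu>) =
      (\<Sum>p\<in>?E. exceedance_share \<Phi> w f u p \<mu>)"
    by (rule nn_integral_count_space'[OF fin]) (auto simp: exceedances_def exceedance_share_def)
  also have "\<dots> = (\<Sum>p\<in>?E. ennreal (?c / real (card ?E)))"
    by (rule sum.cong) (auto simp: exceedances_def exceedance_share_def)
  also have "\<dots> = ennreal (real (card ?E) * (?c / real (card ?E)))"
    by (simp only: sum_constant ennreal_of_nat_eq_real_of_nat)
      (rule ennreal_mult[symmetric], use f in auto)
  also have "\<dots> = (if u < scoring \<Phi> w 0 \<mu> then ennreal ?c else 0)"
    using fin unfolding exceedances_eq_empty_iff[OF \<Phi> \<mu>, symmetric] by auto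
  finally show ?thesis .
qed

lemma measurable_card_exceedances:
  fixes \<Phi> :: "'a::euclidean_space \<Rightarrow> 'a set \<Rightarrow> 'a set"
  assumes \<Phi>: "neighbourhood_map \<Phi>" and w [measurable]: "w \<in> borel_measurable borel"
    and T: "T \<in> N \<rightarrow>\<^sub>M config_algebra configs10"
  shows "(\<lambda>y. real (card (exceedances \<Phi> w u (T y)))) \<in> borel_measurable N"
proof -
  have [measurable]: "(\<lambda>yp. fst ` T (fst yp)) \<in> N \<Otimes>\<^sub>M (borel :: ('a \<times> real) measure) \<rightarrow>\<^sub>M config_algebra ground_configs"
    by (rule measurable_compose[OF measurable_fst measurable_fst_image[OF T]])
  have [measurable]: "Measurable.pred (N \<Otimes>\<^sub>M (borel :: ('a \<times> real) measure))
      (\<lambda>yp. fst (snd yp) \<in> \<Phi> 0 (fst ` T (fst yp)))"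
    by (rule measurable_pred_mem_neighbourhood[OF \<Phi>]) measurable
  have "(\<lambda>yp. if fst (snd yp) \<in> \<Phi> 0 (fst ` T (fst yp)) \<and> u < w (fst (snd yp)) * snd (snd yp) then 1 else 0)
      \<in> borel_measurable (N \<Otimes>\<^sub>M (borel :: ('a \<times> real) measure))" by measurable
  from borel_measurable_nn_integral_count_space[OF T sigma_finite_configs_configs10 this]
  have "(\<lambda>y. enn2real (\<integral>\<^sup>+p. (if fst p \<in> \<Phi> 0 (fst ` T y) \<and> u < w (fst p) * snd p then 1 else 0) \<partial>count_space (T y)))
      \<in> borel_measurable N" by simp
  moreover have "enn2real (\<integral>\<^sup>+p. (if fst p \<in> \<Phi> 0 (fst ` T y) \<and> u < w (fst p) * snd p then 1 else 0) \<partial>count_space (T y)) =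
      real (card (exceedances \<Phi> w u (T y)))" for y
  proof -
    have "(\<integral>\<^sup>+p. (if fst p \<in> \<Phi> 0 (fst ` T y) \<and> u < w (fst p) * snd p then 1 else 0) \<partial>count_space (T y)) =
        (\<integral>\<^sup>+p. indicator (exceedances \<Phi> w u (T y)) p \<partial>count_space (T y))"
      by (rule nn_integral_cong) (auto simp: exceedances_def indicator_def)
    also have "\<dots> = emeasure (count_space UNIV) (exceedances \<Phi> w u (T y))"
      unfolding nn_integral_count_space_indicator_eq count_on_def
      by (rule arg_cong2[where f=emeasure]) (auto simp: exceedances_def)
    finally show ?thesis
      by (cases "finite (exceedances \<Phi> w u (T y))") (auto simp: emeasure_count_space enn2real_of_nat)
  qed
  ultimately show ?thesis by simp
qed

lemma measurable_exceedance_share: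
  fixes \<Phi> :: "'a::euclidean_space \<Rightarrow> 'a set \<Rightarrow> 'a set"
  assumes \<Phi>: "neighbourhood_map \<Phi>" and w [measurable]: "w \<in> borel_measurable borel"
    and w0: "\<And>x. 0 \<le> w x" "w 0 = 1" and f: "f \<in> borel_measurable (config_algebra configs)" and u: "0 < u"
    and p [measurable]: "p \<in> borel_measurable N" and T: "T \<in> N \<rightarrow>\<^sub>M config_algebra configs10"
  shows "(\<lambda>y. exceedance_share \<Phi> w f u (p y) (T y)) \<in> borel_measurable N"
proof -
  note measurable_fst_image[OF T, measurable] measurable_card_exceedances[OF \<Phi> w T, measurable]
  have [measurable]: "Measurable.pred N (\<lambda>y. fst (p y) \<in> \<Phi> 0 (fst ` T y))"
    by (rule measurable_pred_mem_neighbourhood[OF \<Phi>]) measurable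
  have [measurable]: "(\<lambda>y. f (scaling 1 u (moving_maxima \<Phi> w (T y)))) \<in> borel_measurable N"
    by (rule measurable_compose[OF measurable_scaled_moving_maxima[OF \<Phi> w w0 T u] f])
  show ?thesis unfolding exceedance_share_def by measurable
qed

section \<open>Limits of the process\<close>

lemma scaling_in_configs:
  fixes \<mu> :: "('a::euclidean_space \<times> real) set"
  assumes \<mu>: "\<mu> \<in> configs" and c: "0 < c"
  shows "scaling 1 c \<mu> \<in> configs"
proof -
  have "finite (scaling 1 c \<mu> \<inter> (ball 0 r \<times> {\<epsilon><..}))" if "0 < \<epsilon>" for r \<epsilon>
  proof (rule finite_subset)
    show "scaling 1 c \<mu> \<inter> (ball 0 r \<times> {\<epsilon><..}) \<subseteq> scaling 1 c (\<mu> \<inter> (ball 0 r \<times> {\<epsilon> * c<..}))"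
      using c by (fastforce simp: scaling_def field_simps)
    have "finite (\<mu> \<inter> (ball 0 r \<times> {\<epsilon> * c<..}))" using \<mu> that c by (simp add: configs_iff)
    then show "finite (scaling 1 c (\<mu> \<inter> (ball 0 r \<times> {\<epsilon> * c<..})))" by (simp add: scaling_def)
  qed
  moreover have "simple_config (scaling 1 c \<mu>)"
  proof -
    have "0 < s" if ts: "(t, s) \<in> scaling 1 c \<mu>" for t s
    proof -
      obtain s1 where "(t, s1) \<in> \<mu>" "s = s1 / c" using ts by (auto simp: scaling_def)
      then show ?thesis using \<mu> c unfolding configs_iff simple_config_iff by auto
    qed
    moreover have "s = s'" if ts: "(t, s) \<in> scaling 1 c \<mu>" "(t, s') \<in> scaling 1 c \<mu>" for t s s'
    proof -
      obtain s1 s2 where "(t, s1) \<in> \<mu>" "s = s1 / c" "(t, s2) \<in> \<mu>" "s' = s2 / c"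
        using ts by (auto simp: scaling_def)
      then show ?thesis using \<mu> unfolding configs_iff simple_config_iff by metis
    qed
    ultimately show ?thesis unfolding simple_config_iff by blast
  qed
  ultimately show ?thesis by (simp add: configs_iff)
qed

lemma count_on_origin_eq_1:
  fixes \<mu> :: "('a::euclidean_space \<times> real) set"
  assumes "count_on \<mu> ({0} \<times> {1<..}) = 1"
  obtains s where "1 < s" "(0, s) \<in> \<mu>"
proof -
  have "count_on \<mu> ({0} \<times> {1<..}) \<noteq> 0" using assms by simp
  then show thesis using that by (auto simp: count_on_eq_0_iff)
qed

text \<open>The score at the origin is a definite description and has no meaning without a point
  there. Hence the function is cut off by the event of one score above 1 at the origin, and on it
  the score equals the measurable sum \<open>s0\<close> of all scores at the origin.\<close>

lemma measurable_spectral_part: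
  fixes h :: "('a::euclidean_space \<times> real) set \<Rightarrow> ennreal"
  assumes h: "h \<in> borel_measurable (config_algebra configs)"
  shows "(\<lambda>\<mu>. if count_on \<mu> ({0} \<times> {1<..}) = 1 then h (spectral_part \<mu>) else 0)
    \<in> borel_measurable (config_algebra configs)"
proof -
  let ?N = "config_algebra (configs :: ('a \<times> real) set set)"
  define s0 where "s0 \<mu> = enn2real (\<integral>\<^sup>+p. (if fst p = 0 then ennreal (snd p) else 0) \<partial>count_space \<mu>)"
    for \<mu> :: "('a \<times> real) set"
  have "(\<lambda>yp. if fst (snd yp) = 0 then ennreal (snd (snd yp)) else 0) \<in>
      borel_measurable (?N \<Otimes>\<^sub>M (borel :: ('a \<times> real) measure))" by measurable
  from borel_measurable_nn_integral_count_space[OF measurable_ident_sets[OF refl] sigma_finite_configs_configs this]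
  have s0_meas [measurable]: "s0 \<in> borel_measurable ?N"
    unfolding s0_def by (simp cong: if_cong)
  have s0_eq: "s0 \<mu> = s" if \<mu>: "\<mu> \<in> configs" and s: "(0, s) \<in> \<mu>" for \<mu> s
  proof -
    have "(\<integral>\<^sup>+p. (if fst p = 0 then ennreal (snd p) else 0) \<partial>count_space \<mu>) =
        (\<Sum>p\<in>{(0::'a, s)}. if fst p = 0 then ennreal (snd p) else 0)"
      by (rule nn_integral_count_space') (use \<mu> s in \<open>auto simp: configs_iff simple_config_iff\<close>)
    moreover have "0 < s" using \<mu> s by (auto simp: configs_iff simple_config_iff)
    ultimately show ?thesis by (simp add: s0_def)
  qed
  have [measurable]: "(\<lambda>\<mu>. if 0 < s0 \<mu> then scaling 1 (s0 \<mu>) \<mu> else {}) \<in> ?N \<rightarrow>\<^sub>M ?N"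
  proof (rule measurable_config_algebraI)
    show "(if 0 < s0 \<mu> then scaling 1 (s0 \<mu>) \<mu> else {}) \<in> configs" if "\<mu> \<in> space ?N" for \<mu>
      using scaling_in_configs[of \<mu> "s0 \<mu>"] that configs_subset[of \<mu> "{}"] by auto
  next
    fix B :: "('a \<times> real) set" assume [measurable]: "B \<in> sets borel"
    have "Measurable.pred ?N (\<lambda>\<mu>. \<exists>p\<in>\<mu>. (fst p, snd p / s0 \<mu>) \<in> B \<and> 0 < s0 \<mu>)"
      by (rule measurable_pred_ex_config[OF measurable_ident_sets[OF refl] sigma_finite_configs_configs])
        (simp only: case_prod_beta', measurable)
    then have "Measurable.pred ?N (\<lambda>\<mu>. \<not> (\<exists>p\<in>\<mu>. (fst p, snd p / s0 \<mu>) \<in> B \<and> 0 < s0 \<mu>))" by measurable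
    moreover have "(\<not> (\<exists>p\<in>\<mu>. (fst p, snd p / s0 \<mu>) \<in> B \<and> 0 < s0 \<mu>)) \<longleftrightarrow>
        (if 0 < s0 \<mu> then scaling 1 (s0 \<mu>) \<mu> else {}) \<inter> B = {}" for \<mu>
    proof -
      have "scaling 1 (s0 \<mu>) \<mu> = (\<lambda>p. (fst p, snd p / s0 \<mu>)) ` \<mu>"
        by (simp add: scaling_def case_prod_beta')
      moreover have "f ` \<mu> \<inter> B = {} \<longleftrightarrow> \<not> (\<exists>p\<in>\<mu>. f p \<in> B)" for f by blast
      ultimately show ?thesis by (cases "0 < s0 \<mu>") simp_all
    qed
    ultimately show "{\<mu> \<in> space ?N. (if 0 < s0 \<mu> then scaling 1 (s0 \<mu>) \<mu> else {}) \<inter> B = {}} \<in> sets ?N"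
      by (simp add: pred_def)
  qed
  note measurable_compose[OF this h, measurable]
  have "({0::'a} \<times> {1::real<..}) \<in> sets borel"
    unfolding borel_prod[symmetric] by (intro pair_measureI) auto
  note measurable_count_on[OF this, measurable]
  have "(\<lambda>\<mu>. if count_on \<mu> ({0} \<times> {1<..}) = 1 then h (if 0 < s0 \<mu> then scaling 1 (s0 \<mu>) \<mu> else {}) else 0)
      \<in> borel_measurable ?N" by measurable
  moreover have "(if count_on \<mu> ({0} \<times> {1<..}) = 1 then h (if 0 < s0 \<mu> then scaling 1 (s0 \<mu>) \<mu> else {}) else 0) =
      (if count_on \<mu> ({0} \<times> {1<..}) = 1 then h (spectral_part \<mu>) else 0)" if "\<mu> \<in> space ?N" for \<mu>
  proof (cases "count_on \<mu> ({0} \<times> {1<..}) = 1")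
    case True
    then obtain s where s: "1 < s" "(0, s) \<in> \<mu>" by (rule count_on_origin_eq_1)
    have "\<mu> \<in> configs" using that by simp
    then have "s0 \<mu> = s" "score_at \<mu> 0 = s" using s s0_eq score_at_eq by auto
    then show ?thesis using s(1) by (simp add: spectral_part_def)
  qed simp
  ultimately show ?thesis by (subst (asm) measurable_cong) auto
qed

lemma enn2real_divide_ennreal: "0 < b \<Longrightarrow> enn2real (a / ennreal b) = enn2real a / b"
  by (cases a) (auto simp: divide_ennreal ennreal_top_divide)

text \<open>Collects the hypotheses of the theorem with names for the mark law \<open>m\<close> and
  a bound \<open>W\<close> of the weights. Positivity of all tails is stated separately; at the
  interpretation it is derived from regular variation.\<close>

locale moving_maxima_process = prob_space M for M :: "'o measure" +
  fixes P :: "'o \<Rightarrow> ('a::euclidean_space \<times> real) set" and m :: "real measure" and Z :: "'o \<Rightarrow> real"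
    and \<Phi> :: "'a \<Rightarrow> 'a set \<Rightarrow> 'a set" and w :: "'a \<Rightarrow> real" and \<alpha> W :: real
  assumes P: "P \<in> M \<rightarrow>\<^sub>M config_algebra configs10"
    and m: "prob_space m" "sets m = sets borel" "AE s in m. 0 < s"
    and poisson: "poisson_process M P (lborel \<Otimes>\<^sub>M m)"
    and Z: "Z \<in> borel_measurable M" "\<And>\<omega>. \<omega> \<in> space M \<Longrightarrow> 0 < Z \<omega>" "distr M borel Z = m"
    and indep: "indep_set (sets (vimage_algebra (space M) P (config_algebra configs10)))
      (sets (vimage_algebra (space M) Z borel))"
    and \<Phi>: "neighbourhood_map \<Phi>"
    and w [measurable]: "w \<in> borel_measurable borel"
    and w_nonneg: "\<And>x. 0 \<le> w x" and w_0: "w 0 = 1" and w_le: "\<And>x. w x \<le> W"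
    and \<alpha>: "0 < \<alpha>"
    and tail_pos: "\<And>u. 0 < measure m {u<..}"
    and tail_rv: "\<And>y. 0 < y \<Longrightarrow> ((\<lambda>u. measure m {u * y<..} / measure m {u<..}) \<longlongrightarrow> y powr (- \<alpha>)) at_top"
    and card_finite: "(\<integral>\<^sup>+\<omega>. of_nat (card (\<Phi> 0 (fst ` add_origin (P \<omega>) (Z \<omega>)))) \<partial>M) < \<infinity>"
begin

abbreviation palm :: "'o \<Rightarrow> ('a \<times> real) set" where
  "palm \<omega> \<equiv> add_origin (P \<omega>) (Z \<omega>)"

abbreviation palm_ground :: "'o \<Rightarrow> 'a set" where
  "palm_ground \<omega> \<equiv> fst ` palm \<omega>"

lemma W_pos: "0 < W"
  using w_le[of 0] w_0 by simp

lemma measurable_palm [measurable]: "palm \<in> M \<rightarrow>\<^sub>M config_algebra configs10"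
proof -
  have "(\<lambda>\<omega>. ins 0 (Z \<omega>) (P \<omega>)) \<in> M \<rightarrow>\<^sub>M config_algebra configs10"
    by (rule measurable_ins) (use Z P in auto)
  then show ?thesis by (subst measurable_cong) (auto simp: add_origin_eq_ins Z(2))
qed

lemma palm_in_configs10: "\<omega> \<in> space M \<Longrightarrow> palm \<omega> \<in> configs10"
  using measurable_space[OF measurable_palm] by simp

lemma palm_in_configs: "\<omega> \<in> space M \<Longrightarrow> palm \<omega> \<in> configs"
  using palm_in_configs10 configs10_subset by blast

lemma measurable_palm_ground [measurable]: "palm_ground \<in> M \<rightarrow>\<^sub>M config_algebra ground_configs"
  by (rule measurable_fst_image[OF measurable_palm])

lemma palm_ground_in: "\<omega> \<in> space M \<Longrightarrow> palm_ground \<omega> \<in> ground_configs"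
  using measurable_space[OF measurable_palm_ground] by simp

lemma zero_in_palm_ground: "0 \<in> palm_ground \<omega>"
  by (auto simp: add_origin_def)

lemmas palm_neighbourhood = neighbourhood_mapD[OF \<Phi> palm_ground_in zero_in_palm_ground]

text \<open>The limit contribution of a large mark at a point \<open>x\<close> of the neighbourhood
  of the origin: the mark exceeds \<open>u / w x\<close> with probability asymptotic to
  \<open>w x powr \<alpha>\<close> times that of exceeding \<open>u\<close>, and given this, the
  score at the origin is asymptotically \<open>u\<close> times a Pareto variable \<eta>.\<close>

definition cluster_term :: "(('a \<times> real) set \<Rightarrow> ennreal) \<Rightarrow> 'a set \<Rightarrow> 'a \<Rightarrow> ennreal" where
  "cluster_term h \<nu> x =
     ennreal (w x powr \<alpha>) * (\<integral>\<^sup>+\<eta>. h (cluster_config \<Phi> w \<nu> x \<eta>) \<partial>pareto \<alpha>)"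

definition cluster_mean :: "(('a \<times> real) set \<Rightarrow> ennreal) \<Rightarrow> ennreal" where
  "cluster_mean h = (\<integral>\<^sup>+\<omega>. (\<Sum>x\<in>\<Phi> 0 (palm_ground \<omega>). cluster_term h (palm_ground \<omega>) x) \<partial>M)"

lemma measurable_cluster_term:
  assumes h: "h \<in> borel_measurable (config_algebra configs)"
    and T: "T \<in> N \<rightarrow>\<^sub>M config_algebra ground_configs" and X [measurable]: "X \<in> borel_measurable N"
  shows "(\<lambda>y. cluster_term h (T y) (X y)) \<in> borel_measurable N"
proof -
  interpret pareto: prob_space "pareto \<alpha>" by (rule prob_space_pareto)
  have "(\<lambda>y. cluster_config \<Phi> w (T (fst y)) (X (fst y)) (snd y)) \<in> N \<Otimes>\<^sub>M pareto \<alpha> \<rightarrow>\<^sub>M config_algebra configs"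
    by (rule measurable_cluster_config[OF \<Phi> w]) (use T in measurable)
  from measurable_compose[OF this h]
  have "(\<lambda>y. \<integral>\<^sup>+\<eta>. h (cluster_config \<Phi> w (T y) (X y) \<eta>) \<partial>pareto \<alpha>) \<in> borel_measurable N"
    by (intro pareto.borel_measurable_nn_integral) (simp add: case_prod_beta')
  then show ?thesis unfolding cluster_term_def by measurable
qed

text \<open>Regular variation is applied at the level \<open>a = 1 / w x\<close>, above which the
  scaled mark at \<open>x\<close> lifts the origin over \<open>u\<close>; the resulting factor
  \<open>a powr (- \<alpha>)\<close> is \<open>w x powr \<alpha>\<close>.\<close>

lemma exceedance_share_limit:
  assumes f: "continuous_map vague_topology euclideanreal f"
    and bd: "\<And>\<mu>. \<mu> \<in> configs \<Longrightarrow> 0 \<le> f \<mu> \<and> f \<mu> \<le> C"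
    and u: "filterlim u at_top sequentially" "\<And>n. 0 < u n"
    and \<nu>: "\<nu> \<in> configs10" and zero: "0 \<in> fst ` \<nu>"
    and x: "x \<in> \<Phi> 0 (insert x (fst ` \<nu>))"
  shows "(\<lambda>n. (\<integral>\<^sup>+s. exceedance_share \<Phi> w f (u n) (x, s) (ins x s \<nu>) \<partial>m) / ennreal (measure m {u n<..}))
    \<longlonglongrightarrow> cluster_term (\<lambda>\<mu>. ennreal (f \<mu>)) (insert x (fst ` \<nu>)) x"
proof (cases "w x = 0")
  case True
  then have "exceedance_share \<Phi> w f (u n) (x, s) (ins x s \<nu>) = 0" for n s
    using u(2)[of n] by (simp add: exceedance_share_def)
  moreover have "cluster_term (\<lambda>\<mu>. ennreal (f \<mu>)) (insert x (fst ` \<nu>)) x = 0"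
    using True by (simp add: cluster_term_def)
  ultimately show ?thesis by simp
next
  case False
  then have wx: "0 < w x" using w_nonneg[of x] by simp
  let ?I = "insert x (fst ` \<nu>)"
  have I: "?I \<in> ground_configs"
    using fst_image_configs10[OF ins_in_configs10[OF \<nu>, of x 1]] by (simp add: fst_image_ins)
  have f_meas: "f \<in> borel_measurable (config_algebra configs)"
    by (rule borel_measurable_vague_continuous[OF f])
  \<comment> \<open>Expressed in the scaled mark \<open>s\<close>, the integrand still depends on
    \<open>n\<close>; along convergent scaled marks it tends to \<open>f (G s)\<close>, because
    eventually the inserted point is the only exceedance.\<close>
  define h where "h n s = f (scaling 1 (u n) (moving_maxima \<Phi> w (ins x (u n * s) \<nu>))) /
      real (card (exceedances \<Phi> w (u n) (ins x (u n * s) \<nu>)))" for n s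
  define G where "G s = graph_config ?I (\<lambda>t. if x \<in> \<Phi> t ?I then w (x - t) * s else 0)" for s
  have \<nu>_const: "(\<lambda>s::real. \<nu>) \<in> borel \<rightarrow>\<^sub>M config_algebra configs10"
    by (rule measurable_const) (simp add: \<nu>)
  have I_const: "(\<lambda>s::real. ?I) \<in> borel \<rightarrow>\<^sub>M config_algebra ground_configs"
    by (rule measurable_const) (simp add: I)
  have ins_meas: "(\<lambda>s. ins x (u n * s) \<nu>) \<in> borel \<rightarrow>\<^sub>M config_algebra configs10" for n
    by (rule measurable_ins) (use \<nu>_const in measurable)
  have h_meas: "h n \<in> borel_measurable borel" for n
  proof -
    have [measurable]: "(\<lambda>s. f (scaling 1 (u n) (moving_maxima \<Phi> w (ins x (u n * s) \<nu>)))) \<in> borel_measurable borel"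
      by (rule measurable_compose[OF measurable_scaled_moving_maxima[OF \<Phi> w w_nonneg w_0 ins_meas u(2)] f_meas])
    note measurable_card_exceedances[OF \<Phi> w ins_meas, measurable]
    show ?thesis unfolding h_def by measurable
  qed
  have G_meas: "(\<lambda>s. f (G s)) \<in> borel_measurable borel"
  proof (rule measurable_compose[OF _ f_meas])
    have [measurable]: "Measurable.pred (borel \<Otimes>\<^sub>M borel) (\<lambda>st::real \<times> 'a. x \<in> \<Phi> (snd st) ?I)"
      by (rule measurable_pred_mem_neighbourhood[OF \<Phi>]) (use measurable_const[of ?I "config_algebra ground_configs"] I in auto)
    have "G \<in> borel \<rightarrow>\<^sub>M config_algebra configs10"
      unfolding G_def by (rule measurable_graph_config[OF I_const]) measurable
    then show "G \<in> borel \<rightarrow>\<^sub>M config_algebra configs"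
      by (rule measurable_config_algebra_subset) (rule configs10_subset)
  qed
  have X_in: "scaling 1 (u n) (moving_maxima \<Phi> w (ins x s \<nu>)) \<in> configs" for n s
    unfolding moving_maxima_eq_graph[where w=w, OF \<Phi> ins_in_configs10[OF \<nu>] w_0] scaling_graph_config[OF u(2)]
    by (rule graph_config_in_configs[OF fst_image_configs10[OF ins_in_configs10[OF \<nu>]]])
  have h_bd: "0 \<le> h n s" "h n s \<le> C" for n s
  proof -
    let ?k = "card (exceedances \<Phi> w (u n) (ins x (u n * s) \<nu>))"
    note b = bd[OF X_in[of n "u n * s"]]
    show "0 \<le> h n s" unfolding h_def using b by simp
    show "h n s \<le> C"
    proof (cases "?k = 0")
      case True
      then show ?thesis using b by (simp add: h_def)
    next
      case False
      then have "C \<le> C * real ?k" using b by (simp add: mult_le_cancel_left1)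
      then show ?thesis using b False unfolding h_def by (subst pos_divide_le_eq) auto
    qed
  qed
  have "(\<lambda>n. (\<integral>\<^sup>+s. ennreal (h n (s / u n)) * indicator {1 / w x * u n<..} s \<partial>m) / ennreal (measure m {u n<..}))
      \<longlonglongrightarrow> ennreal ((1 / w x) powr (- \<alpha>)) * (\<integral>\<^sup>+\<eta>. ennreal (f (G (1 / w x * \<eta>))) \<partial>pareto \<alpha>)"
  proof (rule regularly_varying_integral_limit[OF m(1,2) \<alpha> tail_rv tail_pos u(1) _ h_meas G_meas h_bd])
    fix s :: "nat \<Rightarrow> real" and s' :: real
    assume s: "\<forall>\<^sub>F n in sequentially. 1 / w x < s n" "s \<longlonglongrightarrow> s'" "0 < s'"
    have "0 < 1 / w x" using wx by simp
    then have s0: "\<forall>\<^sub>F n in sequentially. 0 < s n" 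
      by (intro eventually_mono[OF s(1)]) linarith
    have "(\<lambda>n. f (scaling 1 (u n) (moving_maxima \<Phi> w (ins x (u n * s n) \<nu>)))) \<longlonglongrightarrow> f (G s')"
      unfolding G_def
      by (rule continuous_map_vague_tendsto[OF f
            moving_maxima_single_large_limit[where w=w, OF \<Phi> w_nonneg w_0 \<nu> u s0 s(2)]])
    moreover have "\<forall>\<^sub>F n in sequentially.
        f (scaling 1 (u n) (moving_maxima \<Phi> w (ins x (u n * s n) \<nu>))) = h n (s n)"
      using exceedances_single_large[where w=w, OF \<Phi> \<nu> zero x wx u s(1)]
      by eventually_elim (simp add: h_def)
    ultimately show "(\<lambda>n. h n (s n)) \<longlonglongrightarrow> f (G s')" by (rule Lim_transform_eventually)
  qed (use wx in auto)
  moreover have "(\<integral>\<^sup>+s. exceedance_share \<Phi> w f (u n) (x, s) (ins x s \<nu>) \<partial>m) =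
      (\<integral>\<^sup>+s. ennreal (h n (s / u n)) * indicator {1 / w x * u n<..} s \<partial>m)" for n
  proof (rule nn_integral_cong)
    fix s
    have iff: "1 / w x * u n < s \<longleftrightarrow> u n < w x * s" using wx by (simp add: field_simps)
    show "exceedance_share \<Phi> w f (u n) (x, s) (ins x s \<nu>) =
        ennreal (h n (s / u n)) * indicator {1 / w x * u n<..} s"
    proof (cases "u n < w x * s")
      case True
      then have "0 < w x * s" using u(2)[of n] by simp
      then have "0 < s" using wx by (simp add: zero_less_mult_iff)
      then have "fst ` ins x s \<nu> = ?I" by (rule fst_image_ins)
      moreover have "u n * (s / u n) = s" using u(2)[of n] by simp
      ultimately show ?thesis using True x iff by (simp add: exceedance_share_def h_def)
    next
      case False
      then show ?thesis using iff by (simp add: exceedance_share_def)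
    qed
  qed
  moreover have "ennreal ((1 / w x) powr (- \<alpha>)) * (\<integral>\<^sup>+\<eta>. ennreal (f (G (1 / w x * \<eta>))) \<partial>pareto \<alpha>) =
      cluster_term (\<lambda>\<mu>. ennreal (f \<mu>)) ?I x"
  proof -
    have "G (1 / w x * \<eta>) = cluster_config \<Phi> w ?I x \<eta>" for \<eta>
      unfolding G_def cluster_config_def by (rule graph_config_cong) simp
    then show ?thesis using wx by (simp add: cluster_term_def powr_minus powr_divide inverse_eq_divide)
  qed
  ultimately show ?thesis by simp
qed

text \<open>An exceedance at \<open>x\<close> needs a mark above \<open>u / W\<close>, uniformly in
  \<open>x\<close>, and a share is at most \<open>C\<close>. The dependence on \<open>x\<close> is
  thereby reduced to the indicator of the neighbourhood of the origin.\<close>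

lemma exceedance_share_bound:
  assumes bd: "\<And>\<mu>. \<mu> \<in> configs \<Longrightarrow> 0 \<le> f \<mu> \<and> f \<mu> \<le> C"
    and u: "0 < u" and \<nu>: "\<nu> \<in> configs10"
  shows "(\<integral>\<^sup>+s. exceedance_share \<Phi> w f u (x, s) (ins x s \<nu>) \<partial>m) / ennreal (measure m {u<..}) \<le>
    (if x \<in> \<Phi> 0 (insert x (fst ` \<nu>)) then ennreal (C * (measure m {u * (1 / W)<..} / measure m {u<..})) else 0)"
proof -
  interpret m: prob_space m by (rule m(1))
  let ?I = "insert x (fst ` \<nu>)"
  \<comment> \<open>The sign of \<open>C\<close> is read off at the empty configuration.\<close>
  have C: "0 \<le> C"
    using bd[OF graph_config_in_configs[of "{}::'a set" "\<lambda>_. 0"]] by (force simp: ground_configs_iff)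
  have le: "exceedance_share \<Phi> w f u (x, s) (ins x s \<nu>) \<le>
      (if x \<in> \<Phi> 0 ?I then ennreal C * indicator {u * (1 / W)<..} s else 0)" for s
  proof (cases "x \<in> \<Phi> 0 (fst ` ins x s \<nu>) \<and> u < w x * s")
    case True
    then have "0 < w x * s" using u by simp
    then have s: "0 < s" using w_nonneg[of x] by (auto simp: zero_less_mult_iff)
    then have I: "fst ` ins x s \<nu> = ?I" by (rule fst_image_ins)
    have "u < W * s" using True w_le[of x] s by (meson less_le_trans mult_right_mono less_imp_le)
    then have us: "u * (1 / W) < s" using W_pos by (simp add: field_simps)
    let ?k = "card (exceedances \<Phi> w u (ins x s \<nu>))"
    have "scaling 1 u (moving_maxima \<Phi> w (ins x s \<nu>)) \<in> configs"
      unfolding moving_maxima_eq_graph[where w=w, OF \<Phi> ins_in_configs10[OF \<nu>] w_0] scaling_graph_config[OF u]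
      by (rule graph_config_in_configs[OF fst_image_configs10[OF ins_in_configs10[OF \<nu>]]])
    note b = bd[OF this]
    have "f (scaling 1 u (moving_maxima \<Phi> w (ins x s \<nu>))) / real ?k \<le> C"
    proof (cases "?k = 0")
      case True
      then show ?thesis using C by simp
    next
      case False
      then have "C \<le> C * real ?k" using b by (simp add: mult_le_cancel_left1)
      then show ?thesis using b False by (subst pos_divide_le_eq) auto
    qed
    then show ?thesis
      using True I us by (simp add: exceedance_share_def ennreal_leI)
  qed (auto simp: exceedance_share_def)
  show ?thesis
  proof (cases "x \<in> \<Phi> 0 ?I")
    case True
    have "(\<integral>\<^sup>+s. exceedance_share \<Phi> w f u (x, s) (ins x s \<nu>) \<partial>m) \<le>
        (\<integral>\<^sup>+s. ennreal C * indicator {u * (1 / W)<..} s \<partial>m)"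
      by (rule nn_integral_mono) (use le True in simp)
    also have "\<dots> = ennreal (C * measure m {u * (1 / W)<..})"
      using C m(2) by (simp add: nn_integral_cmult_indicator m.emeasure_eq_measure ennreal_mult)
    finally have "(\<integral>\<^sup>+s. exceedance_share \<Phi> w f u (x, s) (ins x s \<nu>) \<partial>m) / ennreal (measure m {u<..}) \<le>
        ennreal (C * measure m {u * (1 / W)<..}) / ennreal (measure m {u<..})"
      by (rule divide_right_mono_ennreal)
    also have "\<dots> = ennreal (C * (measure m {u * (1 / W)<..} / measure m {u<..}))"
      using C tail_pos[of u] by (subst divide_ennreal) auto
    finally show ?thesis using True by simp
  next
    case False
    then have "exceedance_share \<Phi> w f u (x, s) (ins x s \<nu>) = 0" for s using le[of s] by simp
    then show ?thesis by simp
  qed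
qed

text \<open>The second formula concerns functions of positions alone: inserting any positive mark
  adds the same position, so the mark integrates out. It turns both the limit and the dominating
  function into expectations over the Palm version.\<close>

lemma palm_formula:
  obtains L :: "'a measure" where "sigma_finite_measure L" "sets L = sets borel"
    "\<And>F. F \<in> borel_measurable (borel \<Otimes>\<^sub>M config_algebra configs10) \<Longrightarrow>
      (\<integral>\<^sup>+\<omega>. \<integral>\<^sup>+p. F (p, palm \<omega>) \<partial>count_space (palm \<omega>) \<partial>M) =
      (\<integral>\<^sup>+x. \<integral>\<^sup>+s. \<integral>\<^sup>+\<omega>. F ((x, s), ins x s (palm \<omega>)) \<partial>M \<partial>m \<partial>L)"
    "\<And>G. (\<lambda>y. G (fst y) (snd y)) \<in> borel_measurable (borel \<Otimes>\<^sub>M config_algebra ground_configs) \<Longrightarrow>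
      (\<integral>\<^sup>+\<omega>. (\<Sum>x\<in>\<Phi> 0 (palm_ground \<omega>). G x (palm_ground \<omega>)) \<partial>M) =
      (\<integral>\<^sup>+x. \<integral>\<^sup>+\<omega>. (if x \<in> \<Phi> 0 (insert x (palm_ground \<omega>)) then G x (insert x (palm_ground \<omega>)) else 0) \<partial>M \<partial>L)"
proof -
  interpret m: prob_space m by (rule m(1))
  obtain L :: "'a measure" where L: "sigma_finite_measure L" "sets L = sets borel"
    and F: "\<And>F. F \<in> borel_measurable (borel \<Otimes>\<^sub>M config_algebra configs10) \<Longrightarrow>
      (\<integral>\<^sup>+\<omega>. \<integral>\<^sup>+p. F (p, palm \<omega>) \<partial>count_space (palm \<omega>) \<partial>M) =
      (\<integral>\<^sup>+x. \<integral>\<^sup>+s. \<integral>\<^sup>+\<omega>. F ((x, s), ins x s (palm \<omega>)) \<partial>M \<partial>m \<partial>L)"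
    by (rule palm_mecke[OF prob_space_axioms P m poisson Z indep]) (assumption, rule that)
  have "(\<integral>\<^sup>+\<omega>. (\<Sum>x\<in>\<Phi> 0 (palm_ground \<omega>). G x (palm_ground \<omega>)) \<partial>M) =
      (\<integral>\<^sup>+x. \<integral>\<^sup>+\<omega>. (if x \<in> \<Phi> 0 (insert x (palm_ground \<omega>)) then G x (insert x (palm_ground \<omega>)) else 0) \<partial>M \<partial>L)"
    if G: "(\<lambda>y. G (fst y) (snd y)) \<in> borel_measurable (borel \<Otimes>\<^sub>M config_algebra ground_configs)" for G
  proof -
    let ?F = "\<lambda>p \<mu>. if fst p \<in> \<Phi> 0 (fst ` \<mu>) then G (fst p) (fst ` \<mu>) else (0::ennreal)"
    have [measurable]: "(\<lambda>y. fst ` snd y) \<in> (borel :: ('a \<times> real) measure) \<Otimes>\<^sub>M config_algebra configs10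
        \<rightarrow>\<^sub>M config_algebra ground_configs"
      by (rule measurable_fst_image[OF measurable_snd])
    have [measurable]: "Measurable.pred ((borel :: ('a \<times> real) measure) \<Otimes>\<^sub>M config_algebra configs10)
        (\<lambda>y. fst (fst y) \<in> \<Phi> 0 (fst ` snd y))"
      by (rule measurable_pred_mem_neighbourhood[OF \<Phi>]) measurable
    have "(\<lambda>y. (fst (fst y), fst ` snd y)) \<in> (borel :: ('a \<times> real) measure) \<Otimes>\<^sub>M config_algebra configs10
        \<rightarrow>\<^sub>M borel \<Otimes>\<^sub>M config_algebra ground_configs" by measurable
    from measurable_compose[OF this G]
    have [measurable]: "(\<lambda>y. G (fst (fst y)) (fst ` snd y)) \<in>
        borel_measurable ((borel :: ('a \<times> real) measure) \<Otimes>\<^sub>M config_algebra configs10)" by simp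
    have F_meas: "(\<lambda>y. ?F (fst y) (snd y)) \<in> borel_measurable ((borel :: ('a \<times> real) measure) \<Otimes>\<^sub>M config_algebra configs10)"
      by measurable
    have "(\<integral>\<^sup>+\<omega>. (\<Sum>x\<in>\<Phi> 0 (palm_ground \<omega>). G x (palm_ground \<omega>)) \<partial>M) =
        (\<integral>\<^sup>+\<omega>. \<integral>\<^sup>+p. ?F p (palm \<omega>) \<partial>count_space (palm \<omega>) \<partial>M)"
      by (intro nn_integral_cong nn_integral_count_space_fst[symmetric] palm_in_configs palm_neighbourhood)
    also have "\<dots> = (\<integral>\<^sup>+x. \<integral>\<^sup>+s. \<integral>\<^sup>+\<omega>. ?F (x, s) (ins x s (palm \<omega>)) \<partial>M \<partial>m \<partial>L)"
      using F[OF F_meas] by (simp cong: if_cong)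
    also have "\<dots> = (\<integral>\<^sup>+x. \<integral>\<^sup>+\<omega>. (if x \<in> \<Phi> 0 (insert x (palm_ground \<omega>)) then G x (insert x (palm_ground \<omega>)) else 0) \<partial>M \<partial>L)"
    proof (rule nn_integral_cong)
      fix x
      have "(\<integral>\<^sup>+s. \<integral>\<^sup>+\<omega>. ?F (x, s) (ins x s (palm \<omega>)) \<partial>M \<partial>m) =
          (\<integral>\<^sup>+s. \<integral>\<^sup>+\<omega>. (if x \<in> \<Phi> 0 (insert x (palm_ground \<omega>)) then G x (insert x (palm_ground \<omega>)) else 0) \<partial>M \<partial>m)"
        by (rule nn_integral_cong_AE, use m(3) in eventually_elim) (simp add: fst_image_ins cong: if_cong)
      then show "(\<integral>\<^sup>+s. \<integral>\<^sup>+\<omega>. ?F (x, s) (ins x s (palm \<omega>)) \<partial>M \<partial>m) =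
          (\<integral>\<^sup>+\<omega>. (if x \<in> \<Phi> 0 (insert x (palm_ground \<omega>)) then G x (insert x (palm_ground \<omega>)) else 0) \<partial>M)"
        by (simp add: m.emeasure_space_1)
    qed
    finally show ?thesis .
  qed
  then show thesis using L F by (intro that) auto
qed

text \<open>Dominated convergence over the inserted position and the environment. The mark is
  integrated out beforehand, since regular variation concerns the mark with everything else
  fixed.\<close>

lemma exceedance_limit:
  assumes f: "continuous_map vague_topology euclideanreal f"
    and bd: "\<And>\<mu>. \<mu> \<in> configs \<Longrightarrow> 0 \<le> f \<mu> \<and> f \<mu> \<le> C"
    and u: "filterlim u at_top sequentially" "\<And>n. 0 < u n"
  shows "(\<lambda>n. (\<integral>\<^sup>+\<omega>. (if u n < scoring \<Phi> w 0 (palm \<omega>)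
      then ennreal (f (scaling 1 (u n) (moving_maxima \<Phi> w (palm \<omega>)))) else 0) \<partial>M) / ennreal (measure m {u n<..}))
    \<longlonglongrightarrow> cluster_mean (\<lambda>\<mu>. ennreal (f \<mu>))"
proof -
  interpret m: prob_space m by (rule m(1))
  obtain L :: "'a measure" where L: "sigma_finite_measure L" "sets L = sets borel"
    and palm1: "\<And>F. F \<in> borel_measurable (borel \<Otimes>\<^sub>M config_algebra configs10) \<Longrightarrow>
      (\<integral>\<^sup>+\<omega>. \<integral>\<^sup>+p. F (p, palm \<omega>) \<partial>count_space (palm \<omega>) \<partial>M) =
      (\<integral>\<^sup>+x. \<integral>\<^sup>+s. \<integral>\<^sup>+\<omega>. F ((x, s), ins x s (palm \<omega>)) \<partial>M \<partial>m \<partial>L)"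
    and palm2: "\<And>G. (\<lambda>y. G (fst y) (snd y)) \<in> borel_measurable (borel \<Otimes>\<^sub>M config_algebra ground_configs) \<Longrightarrow>
      (\<integral>\<^sup>+\<omega>. (\<Sum>x\<in>\<Phi> 0 (palm_ground \<omega>). G x (palm_ground \<omega>)) \<partial>M) =
      (\<integral>\<^sup>+x. \<integral>\<^sup>+\<omega>. (if x \<in> \<Phi> 0 (insert x (palm_ground \<omega>)) then G x (insert x (palm_ground \<omega>)) else 0) \<partial>M \<partial>L)"
    by (rule palm_formula) (rule that)
  note L(2) [measurable_cong] m(2) [measurable_cong]
  interpret L: sigma_finite_measure L by (rule L(1))
  interpret mM: pair_sigma_finite m M ..
  have f_meas: "f \<in> borel_measurable (config_algebra configs)"
    by (rule borel_measurable_vague_continuous[OF f])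
  then have ef_meas: "(\<lambda>\<mu>. ennreal (f \<mu>)) \<in> borel_measurable (config_algebra configs)" by simp
  let ?I = "\<lambda>y. insert (fst y) (palm_ground (snd y))"
  have I [measurable]: "?I \<in> L \<Otimes>\<^sub>M M \<rightarrow>\<^sub>M config_algebra ground_configs"
  proof -
    have "(\<lambda>y. ins (fst y) 1 (palm (snd y))) \<in> L \<Otimes>\<^sub>M M \<rightarrow>\<^sub>M config_algebra configs10"
      by (rule measurable_ins) measurable
    from measurable_fst_image[OF this] show ?thesis by (simp add: fst_image_ins)
  qed
  have mem [measurable]: "Measurable.pred (L \<Otimes>\<^sub>M M) (\<lambda>y. fst y \<in> \<Phi> 0 (?I y))"
    by (rule measurable_pred_mem_neighbourhood[OF \<Phi> _ I]) measurable
  let ?sh = "\<lambda>n x s \<mu>. exceedance_share \<Phi> w f (u n) (x, s) (ins x s \<mu>)"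
  have share1: "(\<lambda>y. exceedance_share \<Phi> w f (u n) (fst y) (snd y)) \<in>
      borel_measurable ((borel :: ('a \<times> real) measure) \<Otimes>\<^sub>M config_algebra configs10)" for n
    by (rule measurable_exceedance_share[OF \<Phi> w w_nonneg w_0 f_meas u(2)]) measurable
  have share2: "(\<lambda>y. ?sh n (fst (fst y)) (snd y) (palm (snd (fst y)))) \<in> borel_measurable ((L \<Otimes>\<^sub>M M) \<Otimes>\<^sub>M m)" for n
  proof (rule measurable_exceedance_share[OF \<Phi> w w_nonneg w_0 f_meas u(2)])
    show "(\<lambda>y. ins (fst (fst y)) (snd y) (palm (snd (fst y)))) \<in> (L \<Otimes>\<^sub>M M) \<Otimes>\<^sub>M m \<rightarrow>\<^sub>M config_algebra configs10"
      by (rule measurable_ins) measurable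
  qed measurable
  have share3: "(\<lambda>y. ?sh n x (fst y) (palm (snd y))) \<in> borel_measurable (m \<Otimes>\<^sub>M M)" for n x
  proof (rule measurable_exceedance_share[OF \<Phi> w w_nonneg w_0 f_meas u(2)])
    show "(\<lambda>y. ins x (fst y) (palm (snd y))) \<in> m \<Otimes>\<^sub>M M \<rightarrow>\<^sub>M config_algebra configs10"
      by (rule measurable_ins) measurable
  qed measurable
  define S where "S n y = (\<integral>\<^sup>+s. ?sh n (fst y) s (palm (snd y)) \<partial>m)" for n y
  have S_meas [measurable]: "S n \<in> borel_measurable (L \<Otimes>\<^sub>M M)" for n
    unfolding S_def using m.borel_measurable_nn_integral_fst[OF share2] by simp
  have eq: "(\<integral>\<^sup>+\<omega>. (if u n < scoring \<Phi> w 0 (palm \<omega>)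
      then ennreal (f (scaling 1 (u n) (moving_maxima \<Phi> w (palm \<omega>)))) else 0) \<partial>M) = (\<integral>\<^sup>+y. S n y \<partial>(L \<Otimes>\<^sub>M M))" for n
  proof -
    have "(\<integral>\<^sup>+\<omega>. (if u n < scoring \<Phi> w 0 (palm \<omega>)
        then ennreal (f (scaling 1 (u n) (moving_maxima \<Phi> w (palm \<omega>)))) else 0) \<partial>M) =
        (\<integral>\<^sup>+\<omega>. \<integral>\<^sup>+p. exceedance_share \<Phi> w f (u n) p (palm \<omega>) \<partial>count_space (palm \<omega>) \<partial>M)"
    proof (rule nn_integral_cong)
      fix \<omega> assume \<omega>: "\<omega> \<in> space M"
      have "scaling 1 (u n) (moving_maxima \<Phi> w (palm \<omega>)) \<in> configs"
        unfolding moving_maxima_eq_graph[where w=w, OF \<Phi> palm_in_configs10[OF \<omega>] w_0] scaling_graph_config[OF u(2)]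
        by (rule graph_config_in_configs[OF palm_ground_in[OF \<omega>]])
      then show "(if u n < scoring \<Phi> w 0 (palm \<omega>)
          then ennreal (f (scaling 1 (u n) (moving_maxima \<Phi> w (palm \<omega>)))) else 0) =
          (\<integral>\<^sup>+p. exceedance_share \<Phi> w f (u n) p (palm \<omega>) \<partial>count_space (palm \<omega>))"
        using bd by (intro nn_integral_exceedance_share[OF \<Phi> palm_in_configs10[OF \<omega>] zero_in_palm_ground, symmetric]) auto
    qed
    also have "\<dots> = (\<integral>\<^sup>+x. \<integral>\<^sup>+s. \<integral>\<^sup>+\<omega>. ?sh n x s (palm \<omega>) \<partial>M \<partial>m \<partial>L)"
      using palm1[OF share1[of n]] by simp
    also have "\<dots> = (\<integral>\<^sup>+x. \<integral>\<^sup>+\<omega>. \<integral>\<^sup>+s. ?sh n x s (palm \<omega>) \<partial>m \<partial>M \<partial>L)"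
      using share3[of n] by (intro nn_integral_cong mM.Fubini'[symmetric]) (simp add: case_prod_beta')
    also have "\<dots> = (\<integral>\<^sup>+y. S n y \<partial>(L \<Otimes>\<^sub>M M))"
      by (subst nn_integral_fst[OF S_meas[of n], symmetric]) (simp only: S_def fst_conv snd_conv)
    finally show ?thesis .
  qed
  define c where "c y = (if fst y \<in> \<Phi> 0 (?I y) then cluster_term (\<lambda>\<mu>. ennreal (f \<mu>)) (?I y) (fst y) else 0)" for y
  have [measurable]: "(\<lambda>y. cluster_term (\<lambda>\<mu>. ennreal (f \<mu>)) (?I y) (fst y)) \<in> borel_measurable (L \<Otimes>\<^sub>M M)"
    by (rule measurable_cluster_term[OF ef_meas I]) measurable
  have c_meas [measurable]: "c \<in> borel_measurable (L \<Otimes>\<^sub>M M)" unfolding c_def by measurable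
  have c_int: "(\<integral>\<^sup>+y. c y \<partial>(L \<Otimes>\<^sub>M M)) = cluster_mean (\<lambda>\<mu>. ennreal (f \<mu>))"
  proof -
    have "(\<lambda>y. cluster_term (\<lambda>\<mu>. ennreal (f \<mu>)) (snd y) (fst y)) \<in> borel_measurable (borel \<Otimes>\<^sub>M config_algebra ground_configs)"
      by (rule measurable_cluster_term[OF ef_meas]) measurable
    from palm2[OF this] show ?thesis
      unfolding cluster_mean_def
      by (subst nn_integral_fst[OF c_meas, symmetric]) (simp add: c_def cong: if_cong)
  qed
  \<comment> \<open>The tail ratios converge and are therefore bounded, which yields a dominating
    function independent of \<open>n\<close>.\<close>
  have "(\<lambda>n. measure m {u n * (1 / W)<..} / measure m {u n<..}) \<longlonglongrightarrow> (1 / W) powr (- \<alpha>)"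
    using filterlim_compose[OF tail_rv[of "1 / W"] u(1)] W_pos by simp
  then have "Bseq (\<lambda>n. measure m {u n * (1 / W)<..} / measure m {u n<..})"
    by (intro convergent_imp_Bseq convergentI)
  then obtain B where B: "\<And>n. measure m {u n * (1 / W)<..} / measure m {u n<..} \<le> B"
    by (auto simp: Bseq_def abs_le_iff)
  have C: "0 \<le> C"
    using bd[OF graph_config_in_configs[of "{}::'a set" "\<lambda>_. 0"]] by (force simp: ground_configs_iff)
  let ?b = "\<lambda>y. ennreal (C * B) * (if fst y \<in> \<Phi> 0 (?I y) then 1 else 0)"
  have "(\<lambda>n. \<integral>\<^sup>+y. S n y / ennreal (measure m {u n<..}) \<partial>(L \<Otimes>\<^sub>M M)) \<longlonglongrightarrow> (\<integral>\<^sup>+y. c y \<partial>(L \<Otimes>\<^sub>M M))"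
  proof (rule nn_integral_dominated_convergence[where w="?b"])
    show "AE y in L \<Otimes>\<^sub>M M. S n y / ennreal (measure m {u n<..}) \<le> ?b y" for n
    proof (rule AE_I2)
      fix y assume "y \<in> space (L \<Otimes>\<^sub>M M)"
      then have \<omega>: "snd y \<in> space M" by (auto simp: space_pair_measure)
      have "S n y / ennreal (measure m {u n<..}) \<le>
          (if fst y \<in> \<Phi> 0 (?I y) then ennreal (C * (measure m {u n * (1 / W)<..} / measure m {u n<..})) else 0)"
        unfolding S_def by (rule exceedance_share_bound[OF bd u(2) palm_in_configs10[OF \<omega>]])
      also have "\<dots> \<le> ?b y"
        using mult_left_mono[OF B[of n] C] by (auto intro!: ennreal_leI)
      finally show "S n y / ennreal (measure m {u n<..}) \<le> ?b y" .
    qed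
    show "(\<integral>\<^sup>+y. ?b y \<partial>(L \<Otimes>\<^sub>M M)) < \<infinity>"
    proof -
      have b_meas: "(\<lambda>y. if fst y \<in> \<Phi> 0 (?I y) then 1 else 0 :: ennreal) \<in> borel_measurable (L \<Otimes>\<^sub>M M)" by measurable
      \<comment> \<open>For the constant function 1 the formula identifies the integral of the
        indicator with the expected size of the neighbourhood of the origin.\<close>
      have "(\<lambda>y. 1 :: ennreal) \<in> borel_measurable ((borel :: 'a measure) \<Otimes>\<^sub>M config_algebra ground_configs)" by simp
      from palm2[OF this]
      have "(\<integral>\<^sup>+y. (if fst y \<in> \<Phi> 0 (?I y) then 1 else 0) \<partial>(L \<Otimes>\<^sub>M M)) = (\<integral>\<^sup>+\<omega>. of_nat (card (\<Phi> 0 (palm_ground \<omega>))) \<partial>M)"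
        using nn_integral_fst[OF b_meas] by (simp cong: if_cong)
      then have "(\<integral>\<^sup>+y. (if fst y \<in> \<Phi> 0 (?I y) then 1 else 0) \<partial>(L \<Otimes>\<^sub>M M)) < \<infinity>" using card_finite by simp
      then show ?thesis
        by (subst nn_integral_cmult[OF b_meas]) (simp add: ennreal_mult_less_top)
    qed
    show "AE y in L \<Otimes>\<^sub>M M. (\<lambda>n. S n y / ennreal (measure m {u n<..})) \<longlonglongrightarrow> c y"
    proof (rule AE_I2)
      fix y assume "y \<in> space (L \<Otimes>\<^sub>M M)"
      then have \<omega>: "snd y \<in> space M" by (auto simp: space_pair_measure)
      show "(\<lambda>n. S n y / ennreal (measure m {u n<..})) \<longlonglongrightarrow> c y"
      proof (cases "fst y \<in> \<Phi> 0 (?I y)")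
        case True
        then show ?thesis
          unfolding S_def c_def
          using exceedance_share_limit[OF f bd u palm_in_configs10[OF \<omega>] zero_in_palm_ground True] by simp
      next
        case False
        have "S n y / ennreal (measure m {u n<..}) \<le> (if fst y \<in> \<Phi> 0 (?I y)
            then ennreal (C * (measure m {u n * (1 / W)<..} / measure m {u n<..})) else 0)" for n
          unfolding S_def by (rule exceedance_share_bound[OF bd u(2) palm_in_configs10[OF \<omega>]])
        then have "S n y / ennreal (measure m {u n<..}) = 0" for n using False by simp
        then show ?thesis using False by (simp add: c_def)
      qed
    qed
  qed measurable
  then show ?thesis
    unfolding eq c_int by (simp add: nn_integral_divide)
qed

section \<open>The limit functional as a measure\<close>

lemma measurable_cluster_config_at:
  assumes h: "h \<in> borel_measurable (config_algebra configs)" and \<nu>: "\<nu> \<in> ground_configs"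
  shows "(\<lambda>\<eta>. h (cluster_config \<Phi> w \<nu> x \<eta>)) \<in> borel_measurable (pareto \<alpha>)"
proof -
  have "(\<lambda>\<eta>. cluster_config \<Phi> w \<nu> x \<eta>) \<in> pareto \<alpha> \<rightarrow>\<^sub>M config_algebra configs"
    by (rule measurable_cluster_config[OF \<Phi> w]) (use measurable_const[of \<nu> "config_algebra ground_configs"] \<nu> in auto)
  then show ?thesis by (rule measurable_compose[OF _ h])
qed

text \<open>Written as an integral over a counting measure, the random sum falls under the
  measurability and convergence results for random configurations.\<close>

lemma cluster_mean_eq:
  "cluster_mean h =
    (\<integral>\<^sup>+\<omega>. \<integral>\<^sup>+x. cluster_term h (palm_ground \<omega>) x \<partial>count_space (\<Phi> 0 (palm_ground \<omega>)) \<partial>M)"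
  unfolding cluster_mean_def
  by (rule nn_integral_cong) (simp add: nn_integral_count_space_finite palm_neighbourhood)

lemma measurable_cluster_sum:
  assumes h: "h \<in> borel_measurable (config_algebra configs)"
  shows "(\<lambda>\<omega>. \<integral>\<^sup>+x. cluster_term h (palm_ground \<omega>) x \<partial>count_space (\<Phi> 0 (palm_ground \<omega>))) \<in> borel_measurable M"
proof -
  have 1: "(\<lambda>y. cluster_term h (palm_ground (fst y)) (snd y)) \<in> borel_measurable (M \<Otimes>\<^sub>M borel)"
    by (rule measurable_cluster_term[OF h]) measurable
  have 2: "(\<lambda>\<omega>. \<Phi> 0 (palm_ground \<omega>)) \<in> M \<rightarrow>\<^sub>M config_algebra ground_configs"
    by (rule measurable_neighbourhood[OF \<Phi>]) measurable
  show ?thesis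
    using borel_measurable_nn_integral_count_space[OF 2 sigma_finite_configs_ground 1] by simp
qed

text \<open>The limit law is obtained from its integrals, without realising a random cluster on some
  probability space.\<close>

lemma cluster_mean_functional:
  obtains Q where "sets Q = sets (config_algebra configs)"
    "\<And>h. h \<in> borel_measurable (config_algebra configs) \<Longrightarrow> (\<integral>\<^sup>+\<mu>. h \<mu> \<partial>Q) = cluster_mean h"
proof (rule nn_integral_functional[of "config_algebra configs" cluster_mean])
  let ?N = "config_algebra (configs :: ('a \<times> real) set set)"
  show "cluster_mean f = cluster_mean g" if "\<And>x. x \<in> space ?N \<Longrightarrow> f x = g x" for f g
    unfolding cluster_mean_def cluster_term_def
    by (intro nn_integral_cong sum.cong arg_cong2[where f="(*)"])
      (simp_all add: that cluster_config_in_configs palm_ground_in)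
  show "cluster_mean (\<lambda>_. 0) = 0" by (simp add: cluster_mean_def cluster_term_def)
  show "cluster_mean (\<lambda>x. f x + g x) = cluster_mean f + cluster_mean g"
    if fg: "f \<in> borel_measurable ?N" "g \<in> borel_measurable ?N" for f g
  proof -
    have *: "cluster_term (\<lambda>x. f x + g x) (palm_ground \<omega>) x =
        cluster_term f (palm_ground \<omega>) x + cluster_term g (palm_ground \<omega>) x" if "\<omega> \<in> space M" for \<omega> x
      unfolding cluster_term_def
      by (subst nn_integral_add)
        (use fg that in \<open>auto intro!: measurable_cluster_config_at palm_ground_in simp: distrib_left\<close>)
    have "cluster_mean (\<lambda>x. f x + g x) = (\<integral>\<^sup>+\<omega>.
        (\<integral>\<^sup>+x. cluster_term f (palm_ground \<omega>) x \<partial>count_space (\<Phi> 0 (palm_ground \<omega>))) +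
        (\<integral>\<^sup>+x. cluster_term g (palm_ground \<omega>) x \<partial>count_space (\<Phi> 0 (palm_ground \<omega>))) \<partial>M)"
      unfolding cluster_mean_eq
    proof (intro nn_integral_cong)
      fix \<omega> assume "\<omega> \<in> space M"
      then have "(\<integral>\<^sup>+x. cluster_term (\<lambda>x. f x + g x) (palm_ground \<omega>) x \<partial>count_space (\<Phi> 0 (palm_ground \<omega>))) =
          (\<integral>\<^sup>+x. cluster_term f (palm_ground \<omega>) x + cluster_term g (palm_ground \<omega>) x
            \<partial>count_space (\<Phi> 0 (palm_ground \<omega>)))"
        using * by (intro nn_integral_cong) auto
      also have "\<dots> = (\<integral>\<^sup>+x. cluster_term f (palm_ground \<omega>) x \<partial>count_space (\<Phi> 0 (palm_ground \<omega>))) +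
          (\<integral>\<^sup>+x. cluster_term g (palm_ground \<omega>) x \<partial>count_space (\<Phi> 0 (palm_ground \<omega>)))"
        by (rule nn_integral_add) auto
      finally show "(\<integral>\<^sup>+x. cluster_term (\<lambda>x. f x + g x) (palm_ground \<omega>) x \<partial>count_space (\<Phi> 0 (palm_ground \<omega>))) =
          (\<integral>\<^sup>+x. cluster_term f (palm_ground \<omega>) x \<partial>count_space (\<Phi> 0 (palm_ground \<omega>))) +
          (\<integral>\<^sup>+x. cluster_term g (palm_ground \<omega>) x \<partial>count_space (\<Phi> 0 (palm_ground \<omega>)))" .
    qed
    also have "\<dots> = cluster_mean f + cluster_mean g"
      unfolding cluster_mean_eq by (rule nn_integral_add) (use fg in \<open>auto intro: measurable_cluster_sum\<close>)
    finally show ?thesis .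
  qed
  show "cluster_mean (\<lambda>x. c * f x) = c * cluster_mean f" if f: "f \<in> borel_measurable ?N" for f c
  proof -
    have *: "cluster_term (\<lambda>x. c * f x) (palm_ground \<omega>) x = c * cluster_term f (palm_ground \<omega>) x"
      if "\<omega> \<in> space M" for \<omega> x
      unfolding cluster_term_def
      by (subst nn_integral_cmult)
        (use f that in \<open>auto intro!: measurable_cluster_config_at palm_ground_in simp: mult.left_commute\<close>)
    have "cluster_mean (\<lambda>x. c * f x) = (\<integral>\<^sup>+\<omega>. c *
        (\<integral>\<^sup>+x. cluster_term f (palm_ground \<omega>) x \<partial>count_space (\<Phi> 0 (palm_ground \<omega>))) \<partial>M)"
      unfolding cluster_mean_eq
    proof (intro nn_integral_cong)
      fix \<omega> assume "\<omega> \<in> space M"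
      then have "(\<integral>\<^sup>+x. cluster_term (\<lambda>x. c * f x) (palm_ground \<omega>) x \<partial>count_space (\<Phi> 0 (palm_ground \<omega>))) =
          (\<integral>\<^sup>+x. c * cluster_term f (palm_ground \<omega>) x \<partial>count_space (\<Phi> 0 (palm_ground \<omega>)))"
        using * by (intro nn_integral_cong) auto
      also have "\<dots> = c * (\<integral>\<^sup>+x. cluster_term f (palm_ground \<omega>) x \<partial>count_space (\<Phi> 0 (palm_ground \<omega>)))"
        by (rule nn_integral_cmult) auto
      finally show "(\<integral>\<^sup>+x. cluster_term (\<lambda>x. c * f x) (palm_ground \<omega>) x \<partial>count_space (\<Phi> 0 (palm_ground \<omega>))) =
          c * (\<integral>\<^sup>+x. cluster_term f (palm_ground \<omega>) x \<partial>count_space (\<Phi> 0 (palm_ground \<omega>)))" .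
    qed
    also have "\<dots> = c * cluster_mean f"
      unfolding cluster_mean_eq by (rule nn_integral_cmult) (use f in \<open>auto intro: measurable_cluster_sum\<close>)
    finally show ?thesis .
  qed
  show "cluster_mean (\<lambda>x. SUP i. F i x) = (SUP i. cluster_mean (F i))"
    if F: "\<And>i::nat. F i \<in> borel_measurable ?N" "incseq F" for F
  proof -
    have inc: "F i \<mu> \<le> F j \<mu>" if "i \<le> j" for i j \<mu> using F(2) that by (auto simp: incseq_def le_fun_def)
    have inc_term: "cluster_term (F i) \<nu> x \<le> cluster_term (F j) \<nu> x" if "i \<le> j" for i j \<nu> x
      unfolding cluster_term_def by (intro mult_left_mono nn_integral_mono inc that) simp
    have "cluster_term (\<lambda>x. SUP i. F i x) (palm_ground \<omega>) x = (SUP i. cluster_term (F i) (palm_ground \<omega>) x)"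
      if "\<omega> \<in> space M" for \<omega> x
    proof -
      have "(\<integral>\<^sup>+\<eta>. (SUP i. F i (cluster_config \<Phi> w (palm_ground \<omega>) x \<eta>)) \<partial>pareto \<alpha>) =
          (SUP i. \<integral>\<^sup>+\<eta>. F i (cluster_config \<Phi> w (palm_ground \<omega>) x \<eta>) \<partial>pareto \<alpha>)"
        by (rule nn_integral_monotone_convergence_SUP)
          (use F(1) that inc in \<open>auto intro!: measurable_cluster_config_at palm_ground_in simp: incseq_def le_fun_def\<close>)
      then show ?thesis unfolding cluster_term_def by (simp add: SUP_mult_left_ennreal)
    qed
    then have "cluster_mean (\<lambda>x. SUP i. F i x) =
        (\<integral>\<^sup>+\<omega>. \<integral>\<^sup>+x. (SUP i. cluster_term (F i) (palm_ground \<omega>) x) \<partial>count_space (\<Phi> 0 (palm_ground \<omega>)) \<partial>M)"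
      unfolding cluster_mean_eq by (intro nn_integral_cong) simp
    also have "\<dots> = (\<integral>\<^sup>+\<omega>. (SUP i. \<integral>\<^sup>+x. cluster_term (F i) (palm_ground \<omega>) x \<partial>count_space (\<Phi> 0 (palm_ground \<omega>))) \<partial>M)"
      by (intro nn_integral_cong nn_integral_monotone_convergence_SUP)
        (auto simp: incseq_def le_fun_def intro: inc_term)
    also have "\<dots> = (SUP i. cluster_mean (F i))"
      unfolding cluster_mean_eq
      by (rule nn_integral_monotone_convergence_SUP)
        (auto simp: incseq_def le_fun_def intro!: nn_integral_mono inc_term measurable_cluster_sum F(1))
    finally show ?thesis .
  qed
qed (rule that)

definition tail_constant :: real where
  "tail_constant = (\<integral>\<omega>. (\<Sum>x\<in>\<Phi> 0 (palm_ground \<omega>). w x powr \<alpha>) \<partial>M)"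

lemma cluster_term_1: "cluster_term (\<lambda>_. 1) \<nu> x = ennreal (w x powr \<alpha>)"
  using prob_space.emeasure_space_1[OF prob_space_pareto] by (simp add: cluster_term_def)

lemma cluster_mean_1:
  "cluster_mean (\<lambda>_. 1) = (\<integral>\<^sup>+\<omega>. ennreal (\<Sum>x\<in>\<Phi> 0 (palm_ground \<omega>). w x powr \<alpha>) \<partial>M)"
  by (simp add: cluster_mean_def cluster_term_1)

text \<open>Finite because weights are at most \<open>W\<close> and the expected neighbourhood size
  is finite; positive because the origin lies in its own neighbourhood and contributes
  \<open>w 0 powr \<alpha> = 1\<close>.\<close>

lemma tail_constant:
  "integrable M (\<lambda>\<omega>. \<Sum>x\<in>\<Phi> 0 (palm_ground \<omega>). w x powr \<alpha>)"
  "cluster_mean (\<lambda>_. 1) = ennreal tail_constant" "0 < tail_constant"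
proof -
  let ?S = "\<lambda>\<omega>. \<Sum>x\<in>\<Phi> 0 (palm_ground \<omega>). w x powr \<alpha>"
  have S0: "0 \<le> ?S \<omega>" for \<omega> by (rule sum_nonneg) simp
  have "(\<lambda>\<omega>. \<integral>\<^sup>+x. cluster_term (\<lambda>_. 1) (palm_ground \<omega>) x \<partial>count_space (\<Phi> 0 (palm_ground \<omega>))) \<in> borel_measurable M"
    by (rule measurable_cluster_sum) simp
  then have "(\<lambda>\<omega>. enn2real (\<integral>\<^sup>+x. cluster_term (\<lambda>_. 1) (palm_ground \<omega>) x \<partial>count_space (\<Phi> 0 (palm_ground \<omega>)))) \<in> borel_measurable M"
    by measurable
  moreover have "enn2real (\<integral>\<^sup>+x. cluster_term (\<lambda>_. 1) (palm_ground \<omega>) x \<partial>count_space (\<Phi> 0 (palm_ground \<omega>))) = ?S \<omega>"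
    if "\<omega> \<in> space M" for \<omega>
    using S0[of \<omega>] by (simp add: nn_integral_count_space_finite palm_neighbourhood that cluster_term_1)
  ultimately have meas: "?S \<in> borel_measurable M" by (subst (asm) measurable_cong) auto
  have "(\<integral>\<^sup>+\<omega>. ennreal (?S \<omega>) \<partial>M) \<le> (\<integral>\<^sup>+\<omega>. ennreal (W powr \<alpha>) * of_nat (card (\<Phi> 0 (palm_ground \<omega>))) \<partial>M)"
  proof (rule nn_integral_mono)
    fix \<omega>
    have "?S \<omega> \<le> (\<Sum>x\<in>\<Phi> 0 (palm_ground \<omega>). W powr \<alpha>)"
      using \<alpha> by (intro sum_mono powr_mono2 w_nonneg w_le) auto
    then have "ennreal (?S \<omega>) \<le> ennreal (W powr \<alpha> * real (card (\<Phi> 0 (palm_ground \<omega>))))"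
      by (intro ennreal_leI) (simp add: mult.commute)
    then show "ennreal (?S \<omega>) \<le> ennreal (W powr \<alpha>) * of_nat (card (\<Phi> 0 (palm_ground \<omega>)))"
      by (simp add: ennreal_mult ennreal_of_nat_eq_real_of_nat)
  qed
  also have "\<dots> = ennreal (W powr \<alpha>) * (\<integral>\<^sup>+\<omega>. of_nat (card (\<Phi> 0 (palm_ground \<omega>))) \<partial>M)"
  proof (rule nn_integral_cmult)
    have "(\<lambda>\<omega>. \<Phi> 0 (palm_ground \<omega>)) \<in> M \<rightarrow>\<^sub>M config_algebra ground_configs"
      by (rule measurable_neighbourhood[OF \<Phi>]) measurable
    then have "(\<lambda>\<omega>. count_on (\<Phi> 0 (palm_ground \<omega>)) UNIV) \<in> borel_measurable M"
      by (rule measurable_count_on_compose) simp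
    moreover have "count_on (\<Phi> 0 (palm_ground \<omega>)) UNIV = of_nat (card (\<Phi> 0 (palm_ground \<omega>)))"
      if "\<omega> \<in> space M" for \<omega>
      using palm_neighbourhood(1)[OF that] by (simp add: count_on_finite)
    ultimately show "(\<lambda>\<omega>. of_nat (card (\<Phi> 0 (palm_ground \<omega>))) :: ennreal) \<in> borel_measurable M"
      by (subst (asm) measurable_cong) auto
  qed
  also have "\<dots> < \<infinity>" using card_finite by (simp add: ennreal_mult_less_top)
  finally have fin: "(\<integral>\<^sup>+\<omega>. ennreal (?S \<omega>) \<partial>M) < \<infinity>" .
  show int: "integrable M ?S" by (rule integrableI_nonneg[OF meas _ fin]) (simp add: S0)
  show "cluster_mean (\<lambda>_. 1) = ennreal tail_constant"
    unfolding cluster_mean_1 tail_constant_def by (rule nn_integral_eq_integral[OF int]) (simp add: S0)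
  have "1 \<le> ?S \<omega>" if "\<omega> \<in> space M" for \<omega>
  proof -
    have "w 0 powr \<alpha> \<le> ?S \<omega>"
      using palm_neighbourhood[OF that] by (intro member_le_sum) auto
    then show ?thesis by (simp add: w_0)
  qed
  then have "(\<integral>\<omega>. 1 \<partial>M) \<le> (\<integral>\<omega>. ?S \<omega> \<partial>M)" by (intro integral_mono int) auto
  then show "0 < tail_constant" by (simp add: tail_constant_def prob_space)
qed

text \<open>The cluster has score \<eta> at the origin, since \<open>x\<close> lies in the
  neighbourhood of 0 and the weight ratio there is 1. Rescaling by this score cancels \<eta>, so the
  Pareto integral is over a constant. The free branch \<open>g\<close> lets the same computation
  show that the score at the origin exceeds 1 almost surely.\<close>

lemma cluster_term_spectral:
  assumes \<omega>: "\<omega> \<in> space M" and x: "x \<in> \<Phi> 0 (palm_ground \<omega>)"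
  shows "cluster_term (\<lambda>\<mu>. if count_on \<mu> ({0} \<times> {1<..}) = 1 then h (spectral_part \<mu>) else g \<mu>) (palm_ground \<omega>) x =
    (if w x = 0 then 0 else ennreal (w x powr \<alpha>) * h (spectral_config \<Phi> w (palm_ground \<omega>) x))"
proof (cases "w x = 0")
  case False
  then have wx: "0 < w x" using w_nonneg[of x] by simp
  interpret pareto: prob_space "pareto \<alpha>" by (rule prob_space_pareto)
  let ?\<nu> = "palm_ground \<omega>"
  have "AE \<eta> in pareto \<alpha>. (if count_on (cluster_config \<Phi> w ?\<nu> x \<eta>) ({0} \<times> {1<..}) = 1
      then h (spectral_part (cluster_config \<Phi> w ?\<nu> x \<eta>)) else g (cluster_config \<Phi> w ?\<nu> x \<eta>)) =
      h (spectral_config \<Phi> w ?\<nu> x)"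
    using AE_pareto_gt_1[OF \<alpha>]
  proof eventually_elim
    case (elim \<eta>)
    have "cluster_config \<Phi> w ?\<nu> x \<eta> \<inter> ({0} \<times> {1<..}) = {(0, \<eta>)}"
      using elim wx x zero_in_palm_ground[of \<omega>] unfolding cluster_config_def graph_config_def by auto
    then have 1: "count_on (cluster_config \<Phi> w ?\<nu> x \<eta>) ({0} \<times> {1<..}) = 1"
      and "(0, \<eta>) \<in> cluster_config \<Phi> w ?\<nu> x \<eta>" by (auto simp: count_on_def)
    then have "score_at (cluster_config \<Phi> w ?\<nu> x \<eta>) 0 = \<eta>"
      by (intro score_at_eq cluster_config_in_configs palm_ground_in \<omega>)
    then have "spectral_part (cluster_config \<Phi> w ?\<nu> x \<eta>) = spectral_config \<Phi> w ?\<nu> x"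
      using elim by (simp add: spectral_part_def scaling_cluster_config spectral_config_eq_cluster)
    then show ?case using 1 by simp
  qed
  then have "(\<integral>\<^sup>+\<eta>. (if count_on (cluster_config \<Phi> w ?\<nu> x \<eta>) ({0} \<times> {1<..}) = 1
      then h (spectral_part (cluster_config \<Phi> w ?\<nu> x \<eta>)) else g (cluster_config \<Phi> w ?\<nu> x \<eta>)) \<partial>pareto \<alpha>) =
      (\<integral>\<^sup>+\<eta>. h (spectral_config \<Phi> w ?\<nu> x) \<partial>pareto \<alpha>)"
    by (rule nn_integral_cong_AE)
  then show ?thesis using False pareto.emeasure_space_1 by (simp add: cluster_term_def)
qed (simp add: cluster_term_def)

section \<open>The tail configuration\<close>

abbreviation process :: "'o \<Rightarrow> ('a \<times> real) set" where
  "process \<omega> \<equiv> moving_maxima \<Phi> w (palm \<omega>)"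

abbreviation origin_score :: "'o \<Rightarrow> real" where
  "origin_score \<omega> \<equiv> score_at (process \<omega>) 0"

lemma origin_score_eq: "\<omega> \<in> space M \<Longrightarrow> origin_score \<omega> = scoring \<Phi> w 0 (palm \<omega>)"
  by (rule score_at_moving_maxima[where w=w, OF \<Phi> palm_in_configs10 w_0 zero_in_palm_ground])

lemma measurable_origin_score [measurable]: "origin_score \<in> borel_measurable M"
proof -
  have "(\<lambda>\<omega>. sup_score \<Phi> w 0 (palm \<omega>)) \<in> borel_measurable M"
    by (rule borel_measurable_sup_score[OF \<Phi> w]) measurable
  then have "(\<lambda>\<omega>. enn2real (sup_score \<Phi> w 0 (palm \<omega>))) \<in> borel_measurable M" by measurable
  moreover have "enn2real (sup_score \<Phi> w 0 (palm \<omega>)) = origin_score \<omega>" if "\<omega> \<in> space M" for \<omega>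
    using scoring_pos[where w=w, OF \<Phi> palm_in_configs10[OF that] zero_in_palm_ground w_0]
    by (simp add: origin_score_eq[OF that]
        flip: scoring_eq_sup_score[OF \<Phi> w_nonneg palm_in_configs10[OF that] zero_in_palm_ground])
  ultimately show ?thesis by (subst (asm) measurable_cong) auto
qed

lemma measurable_scaled_process:
  "0 < u \<Longrightarrow> (\<lambda>\<omega>. scaling 1 u (process \<omega>)) \<in> M \<rightarrow>\<^sub>M config_algebra configs"
  by (rule measurable_scaled_moving_maxima[OF \<Phi> w w_nonneg w_0 measurable_palm])

text \<open>Dominated convergence and the coupling work along sequences; a limit at infinity over
  the reals may be tested on all sequences tending to infinity.\<close>

lemma exceedance_limit_at_top:
  assumes f: "continuous_map vague_topology euclideanreal f"
    and bd: "\<And>\<mu>. \<mu> \<in> configs \<Longrightarrow> 0 \<le> f \<mu> \<and> f \<mu> \<le> C"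
  shows "((\<lambda>u. (\<integral>\<^sup>+\<omega>. ennreal (f (scaling 1 u (process \<omega>))) * indicator {\<omega> \<in> space M. u < origin_score \<omega>} \<omega> \<partial>M) /
      ennreal (measure m {u<..})) \<longlongrightarrow> cluster_mean (\<lambda>\<mu>. ennreal (f \<mu>))) at_top"
    (is "(?A \<longlongrightarrow> _) at_top")
proof (rule tendsto_at_topI_sequentially)
  fix u :: "nat \<Rightarrow> real" assume u: "filterlim u at_top sequentially"
  \<comment> \<open>The sequential statement asks for a positive level at every index; raising
    levels to at least 1 affects only finitely many indices.\<close>
  define v where "v n = max (u n) 1" for n
  have v: "filterlim v at_top sequentially" "0 < v n" for n
    unfolding v_def by (rule filterlim_at_top_mono[OF u]) auto
  have "?A (v n) = (\<integral>\<^sup>+\<omega>. (if v n < scoring \<Phi> w 0 (palm \<omega>)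
      then ennreal (f (scaling 1 (v n) (process \<omega>))) else 0) \<partial>M) / ennreal (measure m {v n<..})" for n
    by (intro arg_cong2[where f="(/)"] nn_integral_cong) (auto simp: origin_score_eq split: split_indicator)
  then have "(\<lambda>n. ?A (v n)) \<longlonglongrightarrow> cluster_mean (\<lambda>\<mu>. ennreal (f \<mu>))"
    using exceedance_limit[OF f bd v] by simp
  moreover have "\<forall>\<^sub>F n in sequentially. ?A (v n) = ?A (u n)"
  proof -
    have "\<forall>\<^sub>F n in sequentially. 1 \<le> u n" using u by (simp add: filterlim_at_top)
    then show ?thesis by eventually_elim (simp add: v_def max_absorb1)
  qed
  ultimately show "(\<lambda>n. ?A (u n)) \<longlonglongrightarrow> cluster_mean (\<lambda>\<mu>. ennreal (f \<mu>))"
    by (rule Lim_transform_eventually)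
qed

section \<open>Tail of the score at the origin\<close>

lemma exceedance_set [measurable]: "{\<omega> \<in> space M. u < origin_score \<omega>} \<in> sets M"
  by measurable

text \<open>This is the limit of the exceedance integrals for the constant function 1.\<close>

lemma tail_ratio:
  "((\<lambda>u. prob {\<omega> \<in> space M. u < origin_score \<omega>} / measure m {u<..}) \<longlongrightarrow> tail_constant) at_top"
proof -
  have "continuous_map vague_topology euclideanreal (\<lambda>\<mu>. 1)" by simp
  from exceedance_limit_at_top[OF this, of 1]
  have "((\<lambda>u. ennreal (prob {\<omega> \<in> space M. u < origin_score \<omega>} / measure m {u<..}))
      \<longlongrightarrow> ennreal tail_constant) at_top"
    by (simp add: emeasure_eq_measure divide_ennreal tail_pos tail_constant(2))
  then show ?thesis
    using tail_constant(3) by (subst (asm) tendsto_ennreal_iff) (auto intro!: always_eventually divide_nonneg_nonneg)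
qed

lemma eventually_exceedance_pos:
  "\<forall>\<^sub>F u in at_top. 0 < prob {\<omega> \<in> space M. u < origin_score \<omega>}"
  using order_tendstoD(1)[OF tail_ratio tail_constant(3)]
  by eventually_elim (use tail_pos in \<open>auto simp: zero_less_divide_iff\<close>)

text \<open>The tail ratio of the score is that of the mark times a quotient of two expressions with
  the same nonzero limit \<open>tail_constant\<close>.\<close>

lemma origin_score_regularly_varying: "regularly_varying_tail M origin_score \<alpha>"
  unfolding regularly_varying_tail_def
proof (intro allI impI)
  fix y :: real assume y: "0 < y"
  let ?p = "\<lambda>u. prob {\<omega> \<in> space M. u < origin_score \<omega>}" and ?q = "\<lambda>u. measure m {u<..}"
  have "filterlim (\<lambda>u. u * y) at_top at_top"
    by (rule filterlim_at_top_mult_tendsto_pos[OF tendsto_const y filterlim_ident])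
  from filterlim_compose[OF tail_ratio this]
  have 1: "((\<lambda>u. ?p (u * y) / ?q (u * y)) \<longlongrightarrow> tail_constant) at_top" .
  have "((\<lambda>u. (?p (u * y) / ?q (u * y)) * (?q (u * y) / ?q u) / (?p u / ?q u))
      \<longlongrightarrow> tail_constant * y powr (- \<alpha>) / tail_constant) at_top"
    by (intro tendsto_intros 1 tail_rv[OF y] tail_ratio) (use tail_constant(3) in simp)
  moreover have "(?p (u * y) / ?q (u * y)) * (?q (u * y) / ?q u) / (?p u / ?q u) = ?p (u * y) / ?p u" for u
    using tail_pos[of u] tail_pos[of "u * y"] by simp
  ultimately have "((\<lambda>u. ?p (u * y) / ?p u) \<longlongrightarrow> tail_constant * y powr (- \<alpha>) / tail_constant) at_top"
    by (simp only:)
  then show "((\<lambda>u. ?p (u * y) / ?p u) \<longlongrightarrow> y powr (- \<alpha>)) at_top"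
    using tail_constant(3) by simp
qed

text \<open>The limit measure has total mass \<open>cluster_mean\<close> of the constant 1, that is
  \<open>tail_constant\<close>, whence the normalisation.\<close>

lemma tail_law:
  obtains Q where "sets Q = sets (config_algebra configs)" "prob_space Q"
    "\<And>h. h \<in> borel_measurable (config_algebra configs) \<Longrightarrow>
      (\<integral>\<^sup>+\<mu>. h \<mu> \<partial>Q) = ennreal (1 / tail_constant) * cluster_mean h"
proof -
  obtain R where R: "sets R = sets (config_algebra configs)"
    "\<And>h. h \<in> borel_measurable (config_algebra configs) \<Longrightarrow> (\<integral>\<^sup>+\<mu>. h \<mu> \<partial>R) = cluster_mean h"
    by (rule cluster_mean_functional) (rule that)
  define Q where "Q = density R (\<lambda>_. ennreal (1 / tail_constant))"
  have Q: "sets Q = sets (config_algebra configs)" by (simp add: Q_def R)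
  have nn: "(\<integral>\<^sup>+\<mu>. h \<mu> \<partial>Q) = ennreal (1 / tail_constant) * cluster_mean h"
    if "h \<in> borel_measurable (config_algebra configs)" for h
  proof -
    have h: "h \<in> borel_measurable R" using that R(1) by (simp cong: measurable_cong_sets)
    show ?thesis unfolding Q_def
      by (subst nn_integral_density) (use h R(2)[OF that] in \<open>auto simp: nn_integral_cmult\<close>)
  qed
  have "prob_space Q"
  proof (rule prob_spaceI)
    have "emeasure Q (space Q) = (\<integral>\<^sup>+\<mu>. 1 \<partial>Q)" by simp
    also have "\<dots> = ennreal (1 / tail_constant) * cluster_mean (\<lambda>_. 1)" by (rule nn) simp
    also have "\<dots> = 1"
      using tail_constant(3) by (simp add: tail_constant(2) flip: ennreal_mult)
    finally show "emeasure Q (space Q) = 1" .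
  qed
  with Q nn show thesis by (intro that)
qed

lemma tail_law_convergence:
  assumes Q: "sets Q = sets (config_algebra configs)" "prob_space Q"
    and nn: "\<And>h. h \<in> borel_measurable (config_algebra configs) \<Longrightarrow>
      (\<integral>\<^sup>+\<mu>. h \<mu> \<partial>Q) = ennreal (1 / tail_constant) * cluster_mean h"
  shows "vague_weak_conv
    (\<lambda>u. distr (uniform_measure M {\<omega> \<in> space M. u < origin_score \<omega>})
      (config_algebra configs) (\<lambda>\<omega>. scaling 1 u (process \<omega>))) Q at_top"
  unfolding vague_weak_conv_def
proof (intro allI impI)
  fix f :: "('a \<times> real) set \<Rightarrow> real"
  assume f: "continuous_map vague_topology euclideanreal f \<and> bounded (f ` configs)"
  interpret Q: prob_space Q by fact
  obtain B where B: "\<And>\<mu>. \<mu> \<in> configs \<Longrightarrow> \<bar>f \<mu>\<bar> \<le> B"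
    using f unfolding bounded_iff by auto
  \<comment> \<open>The limit of exceedance integrals is available for nonnegative functions; adding
    a bound makes \<open>f\<close> nonnegative, and the shift is subtracted again under probability
    measures.\<close>
  define g where "g \<mu> = f \<mu> + B" for \<mu>
  have g: "continuous_map vague_topology euclideanreal g"
    unfolding g_def using f by (intro continuous_map_add) auto
  have g_bd: "0 \<le> g \<mu> \<and> g \<mu> \<le> 2 * B" if "\<mu> \<in> configs" for \<mu>
    using B[OF that] by (auto simp: g_def abs_le_iff)
  have f_meas: "f \<in> borel_measurable (config_algebra configs)"
    and g_meas: "g \<in> borel_measurable (config_algebra configs)"
    using f g by (auto intro: borel_measurable_vague_continuous)
  have f_int: "(\<integral>\<mu>. f \<mu> \<partial>R) = enn2real (\<integral>\<^sup>+\<mu>. ennreal (g \<mu>) \<partial>R) - B"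
    if R: "prob_space R" "sets R = sets (config_algebra configs)" for R
  proof -
    interpret R: prob_space R by (rule R(1))
    have sp: "space R = configs" using sets_eq_imp_space_eq[OF R(2)] by simp
    have gR: "g \<in> borel_measurable R" and fR: "f \<in> borel_measurable R"
      using g_meas f_meas R(2) by (simp_all cong: measurable_cong_sets)
    have "integrable R f"
      by (rule R.integrable_const_bound[of _ B]) (use B fR sp in auto)
    then have "(\<integral>\<mu>. g \<mu> \<partial>R) = (\<integral>\<mu>. f \<mu> \<partial>R) + B"
      unfolding g_def by (simp add: R.prob_space)
    moreover have "(\<integral>\<mu>. g \<mu> \<partial>R) = enn2real (\<integral>\<^sup>+\<mu>. ennreal (g \<mu>) \<partial>R)"
      by (rule integral_eq_nn_integral[OF gR]) (use g_bd sp in auto)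
    ultimately show ?thesis by simp
  qed
  let ?E = "\<lambda>u. {\<omega> \<in> space M. u < origin_score \<omega>}"
  let ?A = "\<lambda>u. \<integral>\<^sup>+\<omega>. ennreal (g (scaling 1 u (process \<omega>))) * indicator (?E u) \<omega> \<partial>M"
  let ?D = "\<lambda>u. distr (uniform_measure M (?E u)) (config_algebra configs) (\<lambda>\<omega>. scaling 1 u (process \<omega>))"
  have A: "((\<lambda>u. enn2real (?A u / ennreal (measure m {u<..}))) \<longlongrightarrow>
      enn2real (cluster_mean (\<lambda>\<mu>. ennreal (g \<mu>)))) at_top"
  proof -
    \<comment> \<open>The passage from \<open>ennreal\<close> to the reals is continuous only at
      finite values.\<close>
    have fin: "cluster_mean (\<lambda>\<mu>. ennreal (g \<mu>)) \<noteq> \<infinity>"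
    proof -
      have "(\<integral>\<^sup>+\<mu>. ennreal (g \<mu>) \<partial>Q) \<le> (\<integral>\<^sup>+\<mu>. ennreal (2 * B) \<partial>Q)"
        by (intro nn_integral_mono ennreal_leI)
          (use g_bd sets_eq_imp_space_eq[OF Q(1)] in auto)
      also have "\<dots> < \<infinity>" by (simp add: Q.emeasure_space_1)
      finally have "ennreal (1 / tail_constant) * cluster_mean (\<lambda>\<mu>. ennreal (g \<mu>)) < \<infinity>"
        using nn[of "\<lambda>\<mu>. ennreal (g \<mu>)"] g_meas by simp
      then show ?thesis using tail_constant(3) by (auto simp: ennreal_mult_less_top)
    qed
    have "((\<lambda>u. ?A u / ennreal (measure m {u<..})) \<longlongrightarrow>
        ennreal (enn2real (cluster_mean (\<lambda>\<mu>. ennreal (g \<mu>))))) at_top"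
      using exceedance_limit_at_top[OF g g_bd] fin by (simp add: less_top)
    then show ?thesis by (rule tendsto_enn2real) simp
  qed
  \<comment> \<open>The conditional expectation is a quotient whose numerator and denominator are
    both divided by the tail of the mark, so that each has a limit.\<close>
  have lim: "((\<lambda>u. enn2real (?A u / ennreal (measure m {u<..})) / (prob (?E u) / measure m {u<..}) - B) \<longlongrightarrow>
      enn2real (cluster_mean (\<lambda>\<mu>. ennreal (g \<mu>))) / tail_constant - B) at_top"
    by (intro tendsto_diff tendsto_divide tendsto_const tail_ratio A) (use tail_constant(3) in simp)
  have "\<forall>\<^sub>F u in at_top. enn2real (?A u / ennreal (measure m {u<..})) / (prob (?E u) / measure m {u<..}) - B =
      (\<integral>\<mu>. f \<mu> \<partial>?D u)"
    using eventually_exceedance_pos eventually_gt_at_top[of 0]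
  proof eventually_elim
    case (elim u)
    have T: "(\<lambda>\<omega>. scaling 1 u (process \<omega>)) \<in> uniform_measure M (?E u) \<rightarrow>\<^sub>M config_algebra configs"
      using measurable_scaled_process[OF elim(2)] by (simp cong: measurable_cong_sets)
    have pr: "prob_space (uniform_measure M (?E u))"
      by (rule prob_space_uniform_measure) (use elim(1) in \<open>auto simp: emeasure_eq_measure\<close>)
    have gT: "(\<lambda>\<omega>. ennreal (g (scaling 1 u (process \<omega>)))) \<in> borel_measurable M"
      using measurable_compose[OF measurable_scaled_process[OF elim(2)] g_meas] by measurable
    have "(\<integral>\<mu>. f \<mu> \<partial>?D u) = enn2real (\<integral>\<^sup>+\<mu>. ennreal (g \<mu>) \<partial>?D u) - B"
      by (rule f_int) (use prob_space.prob_space_distr[OF pr T] in auto)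
    also have "(\<integral>\<^sup>+\<mu>. ennreal (g \<mu>) \<partial>?D u) = (\<integral>\<^sup>+\<omega>. ennreal (g (scaling 1 u (process \<omega>))) \<partial>uniform_measure M (?E u))"
      by (rule nn_integral_distr[OF T]) (use g_meas in simp)
    also have "\<dots> = ?A u / emeasure M (?E u)"
      by (rule nn_integral_uniform_measure[OF gT exceedance_set])
    also have "enn2real (?A u / emeasure M (?E u)) = enn2real (?A u) / prob (?E u)"
      unfolding emeasure_eq_measure by (rule enn2real_divide_ennreal[OF elim(1)])
    also have "\<dots> = enn2real (?A u / ennreal (measure m {u<..})) / (prob (?E u) / measure m {u<..})"
      unfolding enn2real_divide_ennreal[OF tail_pos] using tail_pos[of u] by simp
    finally show ?case by simp
  qed
  moreover have "(\<integral>\<mu>. f \<mu> \<partial>Q) = enn2real (cluster_mean (\<lambda>\<mu>. ennreal (g \<mu>))) / tail_constant - B"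
    using nn[of "\<lambda>\<mu>. ennreal (g \<mu>)"] g_meas tail_constant(3)
    by (simp add: f_int[OF Q(2,1)] enn2real_mult)
  ultimately show "((\<lambda>u. \<integral>\<mu>. f \<mu> \<partial>?D u) \<longlongrightarrow> (\<integral>\<mu>. f \<mu> \<partial>Q)) at_top"
    using Lim_transform_eventually[OF lim] by simp
qed

lemma cluster_mean_spectral:
  "cluster_mean (\<lambda>\<mu>. if count_on \<mu> ({0} \<times> {1<..}) = 1 then h (spectral_part \<mu>) else g \<mu>) =
    (\<integral>\<^sup>+\<omega>. (\<Sum>x\<in>\<Phi> 0 (palm_ground \<omega>). if w x = 0 then 0
      else ennreal (w x powr \<alpha>) * h (spectral_config \<Phi> w (palm_ground \<omega>) x)) \<partial>M)"
  unfolding cluster_mean_def by (intro nn_integral_cong sum.cong refl cluster_term_spectral)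

lemma origin_count_measurable:
  "{\<mu> \<in> configs. count_on \<mu> ({0::'a} \<times> {1::real<..}) = 1} \<in> sets (config_algebra configs)"
proof -
  have "({0::'a} \<times> {1::real<..}) \<in> sets borel"
    unfolding borel_prod[symmetric] by (intro pair_measureI) auto
  note measurable_count_on[OF this, measurable]
  have "{\<mu> \<in> space (config_algebra configs). count_on \<mu> ({0::'a} \<times> {1::real<..}) = 1} \<in> sets (config_algebra configs)"
    by measurable
  then show ?thesis by simp
qed

lemma tail_law_origin:
  assumes Q: "sets Q = sets (config_algebra configs)"
    and nn: "\<And>h. h \<in> borel_measurable (config_algebra configs) \<Longrightarrow>
      (\<integral>\<^sup>+\<mu>. h \<mu> \<partial>Q) = ennreal (1 / tail_constant) * cluster_mean h"
  shows "AE \<mu> in Q. count_on \<mu> ({0} \<times> {1<..}) = 1"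
proof -
  \<comment> \<open>The constant function applied to \<open>spectral_part\<close> brings the
    integrand into the shape of \<open>cluster_mean_spectral\<close> with \<open>h\<close> zero and
    \<open>g\<close> one.\<close>
  let ?h = "\<lambda>\<mu> :: ('a \<times> real) set. if count_on \<mu> ({0} \<times> {1<..}) = 1 then (\<lambda>_. 0) (spectral_part \<mu>) else (1 :: ennreal)"
  have h: "?h \<in> borel_measurable (config_algebra configs)"
    using origin_count_measurable by (intro measurable_If) auto
  have "(\<integral>\<^sup>+\<mu>. ?h \<mu> \<partial>Q) = 0"
    unfolding nn[OF h] cluster_mean_spectral[of "\<lambda>_. 0" "\<lambda>_. 1"] by (simp cong: if_cong)
  moreover have "?h \<in> borel_measurable Q" using h Q by (simp cong: measurable_cong_sets)
  ultimately have "AE \<mu> in Q. ?h \<mu> = 0" using nn_integral_0_iff_AE by blast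
  then show ?thesis by eventually_elim (auto split: if_splits)
qed

text \<open>Both laws are weak limits of the same family, so they agree on bounded vaguely
  continuous functions, and these determine a law on configurations.\<close>

lemma tail_configuration_law:
  assumes Y: "tail_configuration M process N Y"
    and Q: "sets Q = sets (config_algebra configs)" "prob_space Q"
    and nn: "\<And>h. h \<in> borel_measurable (config_algebra configs) \<Longrightarrow>
      (\<integral>\<^sup>+\<mu>. h \<mu> \<partial>Q) = ennreal (1 / tail_constant) * cluster_mean h"
  shows "distr N (config_algebra configs) Y = Q"
proof (rule measure_eqI_vague)
  show "prob_space (distr N (config_algebra configs) Y)"
    using Y unfolding tail_configuration_def by (auto intro: prob_space.prob_space_distr)
  fix f :: "('a \<times> real) set \<Rightarrow> real"
  assume f: "continuous_map vague_topology euclideanreal f" "bounded (f ` configs)"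
  have conv: "vague_weak_conv
      (\<lambda>u. distr (uniform_measure M {\<omega> \<in> space M. u < origin_score \<omega>})
        (config_algebra configs) (\<lambda>\<omega>. scaling 1 u (process \<omega>))) (distr N (config_algebra configs) Y) at_top"
    using Y unfolding tail_configuration_def by blast
  have convQ: "vague_weak_conv
      (\<lambda>u. distr (uniform_measure M {\<omega> \<in> space M. u < origin_score \<omega>})
        (config_algebra configs) (\<lambda>\<omega>. scaling 1 u (process \<omega>))) Q at_top"
    by (rule tail_law_convergence[OF Q nn])
  show "(\<integral>\<mu>. f \<mu> \<partial>distr N (config_algebra configs) Y) = (\<integral>\<mu>. f \<mu> \<partial>Q)"
    using tendsto_unique[OF trivial_limit_at_top_linorder
        conv[unfolded vague_weak_conv_def, rule_format, OF conjI[OF f]]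
        convQ[unfolded vague_weak_conv_def, rule_format, OF conjI[OF f]]] .
qed (use Q in auto)

lemma spectral_tail_configuration:
  assumes Y: "tail_configuration M process N Y"
    and h: "h \<in> borel_measurable (config_algebra configs)" and h0: "\<And>\<mu>. \<mu> \<in> configs \<Longrightarrow> 0 \<le> h \<mu>"
  shows "(\<integral>\<^sup>+\<omega>. ennreal (h (spectral_part (Y \<omega>))) \<partial>N) =
    ennreal (1 / tail_constant) * (\<integral>\<^sup>+\<omega>. (\<Sum>x\<in>\<Phi> 0 (palm_ground \<omega>). if w x = 0 then 0
      else ennreal (h (spectral_config \<Phi> w (palm_ground \<omega>) x) * w x powr \<alpha>)) \<partial>M)"
proof -
  obtain Q where Q: "sets Q = sets (config_algebra configs)" "prob_space Q"
    and nn: "\<And>h. h \<in> borel_measurable (config_algebra configs) \<Longrightarrow>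
      (\<integral>\<^sup>+\<mu>. h \<mu> \<partial>Q) = ennreal (1 / tail_constant) * cluster_mean h"
    by (rule tail_law) (rule that)
  \<comment> \<open>Almost surely \<open>Y\<close> has exactly one score above 1 at the origin, so
    the guard does not change the integral while it makes the integrand measurable.\<close>
  let ?g = "\<lambda>\<mu>. if count_on \<mu> ({0} \<times> {1<..}) = 1 then ennreal (h (spectral_part \<mu>)) else 0"
  have eh: "(\<lambda>\<mu>. ennreal (h \<mu>)) \<in> borel_measurable (config_algebra configs)" using h by measurable
  note g = measurable_spectral_part[OF eh]
  have law: "distr N (config_algebra configs) Y = Q" by (rule tail_configuration_law[OF Y Q nn])
  have Ym: "Y \<in> N \<rightarrow>\<^sub>M config_algebra configs" and one: "AE \<omega> in N. count_on (Y \<omega>) ({0} \<times> {1<..}) = 1"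
    using Y unfolding tail_configuration_def by auto
  have "(\<integral>\<^sup>+\<omega>. ennreal (h (spectral_part (Y \<omega>))) \<partial>N) = (\<integral>\<^sup>+\<omega>. ?g (Y \<omega>) \<partial>N)"
    by (rule nn_integral_cong_AE) (use one in eventually_elim, simp)
  also have "\<dots> = (\<integral>\<^sup>+\<mu>. ?g \<mu> \<partial>Q)"
    unfolding law[symmetric] by (rule nn_integral_distr[OF Ym, symmetric]) (use g in simp)
  also have "\<dots> = ennreal (1 / tail_constant) * (\<integral>\<^sup>+\<omega>. (\<Sum>x\<in>\<Phi> 0 (palm_ground \<omega>). if w x = 0 then 0
      else ennreal (w x powr \<alpha>) * ennreal (h (spectral_config \<Phi> w (palm_ground \<omega>) x))) \<partial>M)"
    unfolding nn[OF g] cluster_mean_spectral[of "\<lambda>\<mu>. ennreal (h \<mu>)" "\<lambda>_. 0"] ..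
  also have "(\<integral>\<^sup>+\<omega>. (\<Sum>x\<in>\<Phi> 0 (palm_ground \<omega>). if w x = 0 then 0
      else ennreal (w x powr \<alpha>) * ennreal (h (spectral_config \<Phi> w (palm_ground \<omega>) x))) \<partial>M) =
      (\<integral>\<^sup>+\<omega>. (\<Sum>x\<in>\<Phi> 0 (palm_ground \<omega>). if w x = 0 then 0
      else ennreal (h (spectral_config \<Phi> w (palm_ground \<omega>) x) * w x powr \<alpha>)) \<partial>M)"
  proof (intro nn_integral_cong sum.cong refl)
    fix \<omega> x assume "\<omega> \<in> space M"
    then have "0 \<le> h (spectral_config \<Phi> w (palm_ground \<omega>) x)"
      unfolding spectral_config_eq_cluster by (intro h0 cluster_config_in_configs palm_ground_in)
    then show "(if w x = 0 then 0
        else ennreal (w x powr \<alpha>) * ennreal (h (spectral_config \<Phi> w (palm_ground \<omega>) x))) =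
        (if w x = 0 then 0 else ennreal (h (spectral_config \<Phi> w (palm_ground \<omega>) x) * w x powr \<alpha>))"
      by (simp add: ennreal_mult mult.commute)
  qed
  finally show ?thesis .
qed

text \<open>The canonical realisation: the limit law itself as probability space, with the identity
  map.\<close>

lemma tail_configuration_exists:
  "\<exists>(N :: ('a \<times> real) set measure) Y. tail_configuration M process N Y"
proof -
  obtain Q where Q: "sets Q = sets (config_algebra configs)" "prob_space Q"
    and nn: "\<And>h. h \<in> borel_measurable (config_algebra configs) \<Longrightarrow>
      (\<integral>\<^sup>+\<mu>. h \<mu> \<partial>Q) = ennreal (1 / tail_constant) * cluster_mean h"
    by (rule tail_law) (rule that)
  have "tail_configuration M process Q (\<lambda>\<mu>. \<mu>)"
    unfolding tail_configuration_def distr_id2[OF Q(1)[symmetric]]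
  proof (intro conjI)
    show "AE \<mu> in Q. count_on \<mu> ({0} \<times> {1<..}) = 1" by (rule tail_law_origin[OF Q(1) nn])
    show "vague_weak_conv
        (\<lambda>u. distr (uniform_measure M {\<omega> \<in> space M. u < origin_score \<omega>})
          (config_algebra configs) (\<lambda>\<omega>. scaling 1 u (process \<omega>))) Q at_top"
      by (rule tail_law_convergence[OF Q nn])
  qed (rule Q(2) measurable_ident_sets[OF Q(1)])+
  then show ?thesis by blast
qed

end

text \<open>Existence is stated on a probability space of configurations because an arbitrary type
  \<open>'p\<close> may be too small to carry the law; the spectral formula is stated for every
  realisation on any type.\<close>

theorem theorem5p4:
  fixes M :: "'o measure"
    and P :: "'o \<Rightarrow> ('a::euclidean_space \<times> real) set"
    and \<zeta> \<zeta>\<^sub>0 :: "'o \<Rightarrow> real"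
    and \<alpha> :: real
    and \<Phi> :: "'a \<Rightarrow> 'a set \<Rightarrow> 'a set"
    and w :: "'a \<Rightarrow> real"
  defines "Pt \<equiv> \<lambda>\<omega>. add_origin (P \<omega>) (\<zeta>\<^sub>0 \<omega>)"
  defines "Pt' \<equiv> \<lambda>\<omega>. fst ` Pt \<omega>"
  defines "Xt \<equiv> \<lambda>\<omega>. moving_maxima \<Phi> w (Pt \<omega>)"
  defines "\<xi> \<equiv> \<lambda>\<omega>. score_at (Xt \<omega>) 0"
  defines "\<kappa> \<equiv> \<integral>\<omega>. (\<Sum>t\<in>\<Phi> 0 (Pt' \<omega>). w t powr \<alpha>) \<partial>M"
  assumes "prob_space M"
    and "\<zeta> \<in> borel_measurable M" and "\<forall>\<omega>\<in>space M. 0 < \<zeta> \<omega>"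
    and "0 < \<alpha>" and "regularly_varying_tail M \<zeta> \<alpha>"
    and "P \<in> M \<rightarrow>\<^sub>M config_algebra configs10"
    and "poisson_process M P (lborel \<Otimes>\<^sub>M distr M borel \<zeta>)"
    and "\<zeta>\<^sub>0 \<in> borel_measurable M" and "\<forall>\<omega>\<in>space M. 0 < \<zeta>\<^sub>0 \<omega>"
    and "distr M borel \<zeta>\<^sub>0 = distr M borel \<zeta>"
    and "prob_space.indep_set M
           (sets (vimage_algebra (space M) P (config_algebra configs10)))
           (sets (vimage_algebra (space M) \<zeta>\<^sub>0 borel))"
    and "neighbourhood_map \<Phi>"
    and "w \<in> borel_measurable borel" and "\<forall>x. 0 \<le> w x" and "w 0 = 1"
    and "bounded (range w)"
    and "(\<integral>\<^sup>+\<omega>. of_nat (card (\<Phi> 0 (Pt' \<omega>))) \<partial>M) < \<infinity>"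
  shows
    "(integrable M (\<lambda>\<omega>. \<Sum>t\<in>\<Phi> 0 (Pt' \<omega>). w t powr \<alpha>) \<and> 0 < \<kappa> \<and>
      ((\<lambda>u. \<P>(\<omega> in M. \<xi> \<omega> > u) / \<P>(\<omega> in M. \<zeta> \<omega> > u)) \<longlongrightarrow> \<kappa>) at_top \<and>
      regularly_varying_tail M \<xi> \<alpha>) \<and>
     (\<exists>(N :: ('a \<times> real) set measure) Y. tail_configuration M Xt N Y) \<and>
     (\<forall>(N :: 'p measure) Y. tail_configuration M Xt N Y \<longrightarrow>
        (\<forall>h\<in>borel_measurable (config_algebra configs). (\<forall>\<mu>\<in>configs. 0 \<le> h \<mu>) \<longrightarrow>
          (\<integral>\<^sup>+\<omega>. ennreal (h (spectral_part (Y \<omega>))) \<partial>N) =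
            ennreal (1 / \<kappa>) *
            (\<integral>\<^sup>+\<omega>. (\<Sum>x\<in>\<Phi> 0 (Pt' \<omega>).
                if w x = 0 then 0
                else ennreal (h (spectral_config \<Phi> w (Pt' \<omega>) x) * w x powr \<alpha>)) \<partial>M)))"
proof -
  interpret prob_space M by fact
  let ?m = "distr M borel \<zeta>"
  have tail: "measure ?m {u<..} = \<P>(\<omega> in M. u < \<zeta> \<omega>)" for u
  proof -
    have "\<zeta> -` {u<..} \<inter> space M = {\<omega> \<in> space M. u < \<zeta> \<omega>}" by auto
    then show ?thesis using assms(7) by (simp add: measure_distr)
  qed
  have rv: "((\<lambda>u. measure ?m {u * y<..} / measure ?m {u<..}) \<longlongrightarrow> y powr (- \<alpha>)) at_top" if "0 < y" for y
    using \<open>regularly_varying_tail M \<zeta> \<alpha>\<close> that unfolding regularly_varying_tail_def tail by blast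
  \<comment> \<open>If a tail vanished, the ratios for \<open>y = 1\<close> would eventually be
    \<open>0 / 0\<close>, which is 0 by convention, whereas regular variation makes them tend to
    1.\<close>
  have pos: "0 < measure ?m {u<..}" for u
  proof (rule ccontr)
    assume "\<not> 0 < measure ?m {u<..}"
    then have "prob {\<omega> \<in> space M. u < \<zeta> \<omega>} \<le> 0" by (simp add: tail)
    then have zero: "measure ?m {v<..} = 0" if "u \<le> v" for v
    proof -
      have "prob {\<omega> \<in> space M. v < \<zeta> \<omega>} \<le> prob {\<omega> \<in> space M. u < \<zeta> \<omega>}"
        using assms(7) that by (intro finite_measure_mono) auto
      then have "prob {\<omega> \<in> space M. v < \<zeta> \<omega>} \<le> 0"
        using \<open>prob {\<omega> \<in> space M. u < \<zeta> \<omega>} \<le> 0\<close> by linarith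
      then show ?thesis unfolding tail measure_le_0_iff .
    qed
    have "\<forall>\<^sub>F v in at_top. 0 = measure ?m {v * 1<..} / measure ?m {v<..}"
      using eventually_ge_at_top[of u] by eventually_elim (simp add: zero)
    then have "((\<lambda>v. measure ?m {v * 1<..} / measure ?m {v<..}) \<longlongrightarrow> 0) at_top"
      by (rule Lim_transform_eventually[OF tendsto_const])
    then have "(0 :: real) = 1 powr (- \<alpha>)"
      using tendsto_unique[OF trivial_limit_at_top_linorder _ rv[of 1]] by force
    then show False by simp
  qed
  obtain W where "\<forall>x. \<bar>w x\<bar> \<le> W" using \<open>bounded (range w)\<close> by (auto simp: bounded_iff)
  then have W: "w x \<le> W" for x by (simp add: abs_le_iff)
  interpret moving_maxima_process M P ?m \<zeta>\<^sub>0 \<Phi> w \<alpha> W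
  proof (rule moving_maxima_process.intro[OF \<open>prob_space M\<close> moving_maxima_process_axioms.intro])
    show "prob_space ?m" using assms(7) by (rule prob_space_distr)
    show "AE s in ?m. 0 < s" using assms(7,8) by (subst AE_distr_iff) auto
    show "(\<integral>\<^sup>+\<omega>. of_nat (card (\<Phi> 0 (fst ` add_origin (P \<omega>) (\<zeta>\<^sub>0 \<omega>)))) \<partial>M) < \<infinity>"
      using assms(22) by (simp add: Pt_def Pt'_def)
  qed (use assms W pos rv in auto)
  show ?thesis
    unfolding \<xi>_def Xt_def Pt'_def Pt_def \<kappa>_def tail_constant_def[symmetric]
    using tail_constant(1,3) tail_ratio origin_score_regularly_varying tail_configuration_exists
      spectral_tail_configuration
    unfolding tail by blast
qed

end
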